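(* Let $X=(X_t)_{t\ge 0}$ be an arbitrary real-valued semimartingale on a filtered probability space, let $g$ be a weight function, let $\Delta_n>0$ with $\Delta_n\to0$, and let $(k_n)$ be a sequence of positive integers such that $k_n\to\infty$ and $u_n=k_n\Delta_n\to 0$. Then for every $t\ge0$ which is not a fixed time of discontinuity of $X$, as $n\to\infty$, $$\frac1{k_n}V(X,g,p,0)^n_t\ \stackrel{\mathbb P}{\longrightarrow}\ \begin{cases}\overline g(p)\sum_{s\le t}|\Delta X_s|^p,&\text{if }p>2,\\[2pt] \overline g(2)\,[X,X]_t,&\text{if }p=2.\end{cases}$$
   Context: A weight function is a function $g:[0,1]\to\mathbb R$ that is continuous, piecewise $C^1$ with a piecewise Lipschitz derivative $g'$, with $g(0)=g(1)=0$ and $\int_0^1g(s)^2ds>0$; it is extended to $\mathbb R$ by $0$ outside $[0,1]$. For $p>0$, $\overline g(p)=\int|g(s)|^p\,ds$. Put $g^n_j=g(j/k_n)$. For a process $Y$: $\Delta^n_iY=Y_{i\Delta_n}-Y_{(i-1)\Delta_n}$, $\overline Y(g)^n_i=\sum_{j=1}^{k_n-1}g^n_j\,\Delta^n_{i+j}Y$, and $$V(Y,g,p,0)^n_t=\sum_{i=0}^{[t/\Delta_n]-k_n}|\overline Y(g)^n_i|^p .$$ $\Delta X_s$ is the jump of $X$ at time $s$, $[X,X]$ its quadratic variation; $t$ is a fixed time of discontinuity if $\mathbb P(\Delta X_t\ne0)>0$; $\stackrel{\mathbb P}{\longrightarrow}$ is convergence in probability. *)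

theory Defs
  imports "HOL-Probability.Probability"
begin

text \<open>A process is a function \<open>Y :: real \<Rightarrow> 'a \<Rightarrow> real\<close>, time first; only its values at times
  \<open>t \<ge> 0\<close> are used.\<close>

section \<open>Semimartingales\<close>

text \<open>The filtration is indexed by all reals in order to use the library's \<open>filtration\<close> and
  \<open>stopping_time\<close>. This is no restriction: a filtration \<open>(F t)\<close>, \<open>t \<ge> 0\<close>, can be continued by
  \<open>F t = F 0\<close> for \<open>t < 0\<close>, and below only \<open>t \<ge> 0\<close> matters. The usual conditions are not assumed.\<close>

definition filtered_prob_space :: "'a measure \<Rightarrow> (real \<Rightarrow> 'a measure) \<Rightarrow> bool" where
  "filtered_prob_space M F \<longleftrightarrow>
     prob_space M \<and> filtration (space M) F \<and> (\<forall>t. subalgebra M (F t))"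

definition adapted :: "(real \<Rightarrow> 'a measure) \<Rightarrow> (real \<Rightarrow> 'a \<Rightarrow> real) \<Rightarrow> bool" where
  "adapted F Y \<longleftrightarrow> (\<forall>t\<ge>0. Y t \<in> borel_measurable (F t))"

definition cadlag :: "(real \<Rightarrow> real) \<Rightarrow> bool" where
  "cadlag f \<longleftrightarrow> (\<forall>t\<ge>0. (f \<longlongrightarrow> f t) (at_right t)) \<and> (\<forall>t>0. \<exists>l. (f \<longlongrightarrow> l) (at_left t))"

definition cadlag_process :: "'a measure \<Rightarrow> (real \<Rightarrow> 'a \<Rightarrow> real) \<Rightarrow> bool" where
  "cadlag_process M Y \<longleftrightarrow> (\<forall>\<omega>\<in>space M. cadlag (\<lambda>t. Y t \<omega>))"

definition finite_variation :: "(real \<Rightarrow> real) \<Rightarrow> bool" where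
  "finite_variation f \<longleftrightarrow>
     (\<forall>t\<ge>0. \<exists>B. \<forall>(m::nat) r. mono_on {..m} r \<and> r ` {..m} \<subseteq> {0..t} \<longrightarrow>
        (\<Sum>i<m. \<bar>f (r (Suc i)) - f (r i)\<bar>) \<le> B)"

definition martingale ::
    "'a measure \<Rightarrow> (real \<Rightarrow> 'a measure) \<Rightarrow> (real \<Rightarrow> 'a \<Rightarrow> real) \<Rightarrow> bool" where
  "martingale M F Y \<longleftrightarrow> adapted F Y \<and> (\<forall>t\<ge>0. integrable M (Y t)) \<and>
     (\<forall>s t. 0 \<le> s \<and> s \<le> t \<longrightarrow> (AE \<omega> in M. real_cond_exp M (F s) (Y t) \<omega> = Y s \<omega>))"

text \<open>Localizing times may be taken finite, and uniform integrability of the stopped martingales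
  need not be demanded: replacing \<open>T n\<close> by \<open>min (T n) n\<close> gives both.\<close>

definition local_martingale ::
    "'a measure \<Rightarrow> (real \<Rightarrow> 'a measure) \<Rightarrow> (real \<Rightarrow> 'a \<Rightarrow> real) \<Rightarrow> bool" where
  "local_martingale M F Y \<longleftrightarrow> adapted F Y \<and> cadlag_process M Y \<and>
     (\<exists>T :: nat \<Rightarrow> 'a \<Rightarrow> real.
        (\<forall>n. stopping_time F (T n) \<and> (\<forall>\<omega>\<in>space M. 0 \<le> T n \<omega>)) \<and>
        (AE \<omega> in M. incseq (\<lambda>n. T n \<omega>) \<and> filterlim (\<lambda>n. T n \<omega>) at_top sequentially) \<and>
        (\<forall>n. martingale M F (\<lambda>t \<omega>. Y (min t (T n \<omega>)) \<omega>)))"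

definition semimartingale ::
    "'a measure \<Rightarrow> (real \<Rightarrow> 'a measure) \<Rightarrow> (real \<Rightarrow> 'a \<Rightarrow> real) \<Rightarrow> bool" where
  "semimartingale M F X \<longleftrightarrow> adapted F X \<and> cadlag_process M X \<and>
     (\<exists>L A. local_martingale M F L \<and> (\<forall>\<omega>\<in>space M. L 0 \<omega> = 0) \<and>
        adapted F A \<and> cadlag_process M A \<and>
        (\<forall>\<omega>\<in>space M. A 0 \<omega> = 0 \<and> finite_variation (\<lambda>t. A t \<omega>)) \<and>
        (AE \<omega> in M. \<forall>t\<ge>0. X t \<omega> = X 0 \<omega> + L t \<omega> + A t \<omega>))"

section \<open>Convergence in probability, jumps and quadratic variation\<close>

definition conv_in_prob :: "'a measure \<Rightarrow> (nat \<Rightarrow> 'a \<Rightarrow> real) \<Rightarrow> ('a \<Rightarrow> real) \<Rightarrow> bool" where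
  "conv_in_prob M Z W \<longleftrightarrow>
     (\<forall>n. Z n \<in> borel_measurable M) \<and> W \<in> borel_measurable M \<and>
     (\<forall>\<epsilon>>0. (\<lambda>n. measure M {\<omega>\<in>space M. \<bar>Z n \<omega> - W \<omega>\<bar> > \<epsilon>}) \<longlonglongrightarrow> 0)"

text \<open>Convention: no jump at time 0.\<close>

definition jump :: "(real \<Rightarrow> real) \<Rightarrow> real \<Rightarrow> real" where
  "jump f s = (if s > 0 then f s - Lim (at_left s) f else 0)"

definition fixed_time_of_discontinuity :: "'a measure \<Rightarrow> (real \<Rightarrow> 'a \<Rightarrow> real) \<Rightarrow> real \<Rightarrow> bool" where
  "fixed_time_of_discontinuity M X t \<longleftrightarrow>
     measure M {\<omega>\<in>space M. jump (\<lambda>s. X s \<omega>) t \<noteq> 0} > 0"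

definition partition_seq :: "real \<Rightarrow> (nat \<Rightarrow> nat \<Rightarrow> real) \<Rightarrow> (nat \<Rightarrow> nat) \<Rightarrow> bool" where
  "partition_seq t \<tau> N \<longleftrightarrow>
     (\<forall>n. \<tau> n 0 = 0 \<and> \<tau> n (N n) = t \<and> (\<forall>i<N n. \<tau> n i \<le> \<tau> n (Suc i))) \<and>
     (\<forall>\<epsilon>>0. \<forall>\<^sub>F n in sequentially. \<forall>i<N n. \<tau> n (Suc i) - \<tau> n i < \<epsilon>)"

text \<open>\<open>is_quadratic_variation M X t Q\<close>: the random variable \<open>Q\<close> is a version of \<open>[X,X]\<^sub>t\<close>, the limit
  in probability of the sums of squared increments over deterministic partitions of \<open>[0,t]\<close> whose
  mesh tends to 0 (so \<open>[X,X]\<^sub>0 = 0\<close>). Such a \<open>Q\<close> is unique up to null sets, and it exists for every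
  semimartingale; \<open>quadratic_variation\<close> selects a version.\<close>

definition is_quadratic_variation ::
    "'a measure \<Rightarrow> (real \<Rightarrow> 'a \<Rightarrow> real) \<Rightarrow> real \<Rightarrow> ('a \<Rightarrow> real) \<Rightarrow> bool" where
  "is_quadratic_variation M X t Q \<longleftrightarrow>
     (\<forall>\<tau> N. partition_seq t \<tau> N \<longrightarrow>
        conv_in_prob M (\<lambda>n \<omega>. \<Sum>i<N n. (X (\<tau> n (Suc i)) \<omega> - X (\<tau> n i) \<omega>)\<^sup>2) Q)"

definition quadratic_variation :: "'a measure \<Rightarrow> (real \<Rightarrow> 'a \<Rightarrow> real) \<Rightarrow> real \<Rightarrow> 'a \<Rightarrow> real" where
  "quadratic_variation M X t = (SOME Q. is_quadratic_variation M X t Q)"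

section \<open>Weight functions and pre-averaged power variations\<close>

text \<open>The finite set \<open>D\<close> contains the breakpoints. Each open interval avoiding \<open>D\<close> lies inside one
  piece; a finite maximum over the pieces gives the common Lipschitz constant \<open>C\<close>, and a Lipschitz
  derivative on an open piece extends continuously to its closure.\<close>

definition weight_function :: "(real \<Rightarrow> real) \<Rightarrow> bool" where
  "weight_function g \<longleftrightarrow>
     continuous_on {0..1} g \<and>
     (\<exists>D C. finite D \<and> {0, 1} \<subseteq> D \<and> g C1_differentiable_on ({0..1} - D) \<and>
        (\<forall>a b. {a<..<b} \<subseteq> {0..1} - D \<longrightarrow> C-lipschitz_on {a<..<b} (deriv g))) \<and>
     g 0 = 0 \<and> g 1 = 0 \<and> integral {0..1} (\<lambda>s. (g s)\<^sup>2) > 0 \<and>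
     (\<forall>s. s \<notin> {0..1} \<longrightarrow> g s = 0)"

definition gbar :: "(real \<Rightarrow> real) \<Rightarrow> real \<Rightarrow> real" where
  "gbar g p = (LBINT s. \<bar>g s\<bar> powr p)"

text \<open>In the definitions below \<open>d\<close> and \<open>k\<close> stand for \<open>\<Delta>\<^sub>n\<close> and \<open>k\<^sub>n\<close>, and \<open>y\<close> is a path.\<close>

definition increment :: "real \<Rightarrow> (real \<Rightarrow> real) \<Rightarrow> int \<Rightarrow> real" where
  "increment d y i = y (of_int i * d) - y (of_int (i - 1) * d)"

definition preaverage :: "(real \<Rightarrow> real) \<Rightarrow> nat \<Rightarrow> real \<Rightarrow> (real \<Rightarrow> real) \<Rightarrow> int \<Rightarrow> real" where
  "preaverage g k d y i = (\<Sum>j=1..k-1. g (real j / real k) * increment d y (i + int j))"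

definition power_variation ::
    "(real \<Rightarrow> real) \<Rightarrow> real \<Rightarrow> nat \<Rightarrow> real \<Rightarrow> (real \<Rightarrow> real) \<Rightarrow> real \<Rightarrow> real" where
  "power_variation g p k d y t = (\<Sum>i\<in>{0..\<lfloor>t / d\<rfloor> - int k}. \<bar>preaverage g k d y i\<bar> powr p)"

end

theory Submission
  imports Defs
begin

text \<open>Expanding the squared pre-averages splits their normalized sum into a diagonal part, which is
  a Riemann sum of \<open>g\<^sup>2\<close> times the sum of the squared increments of \<open>X\<close>, and an off-diagonal
  quadratic form \<open>\<Sum>\<^bsub>m<l\<^esub> c(l,m) \<Delta>\<^sub>mX \<Delta>\<^sub>lX\<close> whose coefficients have bounded variation in each index and
  live near the diagonal. Such a form tends to 0 in probability. Indeed, the increments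
  \<open>\<Delta>\<^sub>mX\<close> of size at most \<open>\<epsilon>\<close> contribute a transform \<open>\<Sum>\<^sub>l h\<^sub>l \<Delta>\<^sub>lX\<close> with \<open>\<bar>h\<^sub>l\<bar> \<le> const \<epsilon>\<close>, and transforms of
  a semimartingale by bounded predictable integrands are tight, by Burkholder's weak-type inequality
  for the local martingale part. The larger increments are boundedly many on each path, and Abel
  summation multiplies each of them by an oscillation of \<open>X\<close> just after a jump. With \<open>c\<close> the indicator
  of the blocks of a coarser partition the same fact yields the existence of the quadratic variation.

  For \<open>p > 2\<close> replace \<open>\<bar>x\<bar>\<^sup>p\<close> by \<open>max 0 (\<bar>x\<bar>\<^sup>p - \<epsilon>\<^sup>p)\<close>. As this function vanishes near 0, the convergence
  holds path by path, each large jump being seen by \<open>k\<close> consecutive pre-averages. The error is at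
  most \<open>\<epsilon>\<^bsup>p-2\<^esup> x\<^sup>2\<close>, which the case \<open>p = 2\<close> controls.\<close>

section \<open>Convergence in probability\<close>

text \<open>A localized martingale part is only integrable, since its jumps need not have second
  moments. No L2 isometry bounds the transforms, and a weak L1 inequality takes its place. Its right
  side involves only the L1 norm of the final value, which all partitions share, so the bound is
  uniform in the partition and the integrand. This uniformity matters because the integrand built
  from small increments changes with \<open>n\<close> and with the threshold. A sum of many small
  increments need not be small, but inside a window shorter than the gaps between big jumps it
  telescopes, up to one omitted term. Bounded variation of the coefficients lets Abel summation
  replace increments by such telescoped sums. The first and last \<open>k\<close> increments are met
  by too few windows. Their squares vanish in the limit, at the right end because \<open>t\<close>
  is not a fixed time of discontinuity. For \<open>p > 2\<close>, summability of the squared jumps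
  is not presupposed. It is extracted from tightness of the squared pre-averages, since truncated
  jump sums are limits of functionals lying below these. Hence jump sums take values in
  \<open>ennreal\<close>.\<close>

definition prob_tight :: "'a measure \<Rightarrow> (nat \<Rightarrow> 'a \<Rightarrow> real) \<Rightarrow> bool" where
  "prob_tight M Z \<longleftrightarrow>
     (\<forall>\<delta>>0. \<exists>B>0. \<forall>\<^sub>F n in sequentially. measure M {\<omega>\<in>space M. \<bar>Z n \<omega>\<bar> > B} \<le> \<delta>)"

context prob_space
begin

lemma conv_in_probI:
  assumes "\<And>n. Z n \<in> borel_measurable M" "W \<in> borel_measurable M"
    and "\<And>\<epsilon> \<delta>. 0 < \<epsilon> \<Longrightarrow> 0 < \<delta> \<Longrightarrow> \<forall>\<^sub>F n in sequentially. prob {\<omega>\<in>space M. \<bar>Z n \<omega> - W \<omega>\<bar> > \<epsilon>} \<le> \<delta>"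
  shows "conv_in_prob M Z W"
  unfolding conv_in_prob_def
proof (intro conjI allI impI assms(1,2))
  fix \<epsilon> :: real assume e: "0 < \<epsilon>"
  show "(\<lambda>n. prob {\<omega>\<in>space M. \<bar>Z n \<omega> - W \<omega>\<bar> > \<epsilon>}) \<longlonglongrightarrow> 0"
  proof (rule tendstoI)
    fix d :: real assume "0 < d"
    then have "\<forall>\<^sub>F n in sequentially. prob {\<omega>\<in>space M. \<bar>Z n \<omega> - W \<omega>\<bar> > \<epsilon>} \<le> d / 2"
      using assms(3)[OF e, of "d / 2"] by simp
    then show "\<forall>\<^sub>F n in sequentially. dist (prob {\<omega>\<in>space M. \<bar>Z n \<omega> - W \<omega>\<bar> > \<epsilon>}) 0 < d"
      by eventually_elim (use \<open>0 < d\<close> in \<open>simp add: dist_real_def\<close>)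
  qed
qed

lemma conv_in_probD:
  assumes "conv_in_prob M Z W" "0 < \<epsilon>" "0 < \<delta>"
  shows "\<forall>\<^sub>F n in sequentially. prob {\<omega>\<in>space M. \<bar>Z n \<omega> - W \<omega>\<bar> > \<epsilon>} \<le> \<delta>"
proof -
  have "(\<lambda>n. prob {\<omega>\<in>space M. \<bar>Z n \<omega> - W \<omega>\<bar> > \<epsilon>}) \<longlonglongrightarrow> 0"
    using assms unfolding conv_in_prob_def by blast
  from order_tendstoD(2)[OF this assms(3)] show ?thesis
    by eventually_elim simp
qed

lemma conv_in_prob_measurable:
  assumes "conv_in_prob M Z W"
  shows "Z n \<in> borel_measurable M" "W \<in> borel_measurable M"
  using assms unfolding conv_in_prob_def by auto

text \<open>Only the two covering sets have to be events. The set of \<open>P\<close> may be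
  arbitrary, as monotonicity of a finite measure asks measurability of the larger set alone.\<close>

lemma prob_le_add:
  assumes "\<And>\<omega>. \<omega> \<in> space M \<Longrightarrow> P \<omega> \<Longrightarrow> Q \<omega> \<or> R \<omega>"
    and "{\<omega>\<in>space M. Q \<omega>} \<in> events" "{\<omega>\<in>space M. R \<omega>} \<in> events"
    and "prob {\<omega>\<in>space M. Q \<omega>} \<le> a" "prob {\<omega>\<in>space M. R \<omega>} \<le> b"
  shows "prob {\<omega>\<in>space M. P \<omega>} \<le> a + b"
proof -
  have "prob {\<omega>\<in>space M. P \<omega>} \<le> prob ({\<omega>\<in>space M. Q \<omega>} \<union> {\<omega>\<in>space M. R \<omega>})"
    using assms(1-3) by (intro finite_measure_mono) blast+
  also have "\<dots> \<le> prob {\<omega>\<in>space M. Q \<omega>} + prob {\<omega>\<in>space M. R \<omega>}"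
    by (rule measure_Un_le[OF assms(2,3)])
  finally show ?thesis using assms(4,5) by linarith
qed

lemma conv_in_prob_add:
  assumes "conv_in_prob M Z W" "conv_in_prob M Z' W'"
  shows "conv_in_prob M (\<lambda>n \<omega>. Z n \<omega> + Z' n \<omega>) (\<lambda>\<omega>. W \<omega> + W' \<omega>)"
proof (rule conv_in_probI)
  note [measurable] = conv_in_prob_measurable[OF assms(1)] conv_in_prob_measurable[OF assms(2)]
  show "(\<lambda>\<omega>. Z n \<omega> + Z' n \<omega>) \<in> borel_measurable M" for n by measurable
  show "(\<lambda>\<omega>. W \<omega> + W' \<omega>) \<in> borel_measurable M" by measurable
  fix \<epsilon> \<delta> :: real assume "0 < \<epsilon>" "0 < \<delta>"
  then have "0 < \<epsilon> / 2" "0 < \<delta> / 2" by auto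
  from conv_in_probD[OF assms(1) this] conv_in_probD[OF assms(2) this]
  show "\<forall>\<^sub>F n in sequentially. prob {\<omega>\<in>space M. \<bar>Z n \<omega> + Z' n \<omega> - (W \<omega> + W' \<omega>)\<bar> > \<epsilon>} \<le> \<delta>"
  proof eventually_elim
    case (elim n)
    have "prob {\<omega>\<in>space M. \<bar>Z n \<omega> + Z' n \<omega> - (W \<omega> + W' \<omega>)\<bar> > \<epsilon>} \<le> \<delta> / 2 + \<delta> / 2"
      by (rule prob_le_add[OF _ _ _ elim]) (arith, measurable, measurable)
    then show ?case by simp
  qed
qed

lemma conv_in_prob_AE_cong:
  assumes "conv_in_prob M Z W" "\<And>n. Z' n \<in> borel_measurable M" "W' \<in> borel_measurable M"
    and "\<And>n. AE \<omega> in M. Z n \<omega> = Z' n \<omega>" "AE \<omega> in M. W \<omega> = W' \<omega>"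
  shows "conv_in_prob M Z' W'"
proof (rule conv_in_probI)
  note [measurable] = conv_in_prob_measurable[OF assms(1)] assms(2,3)
  fix \<epsilon> \<delta> :: real assume "0 < \<epsilon>" "0 < \<delta>"
  from conv_in_probD[OF assms(1) this]
  show "\<forall>\<^sub>F n in sequentially. prob {\<omega>\<in>space M. \<bar>Z' n \<omega> - W' \<omega>\<bar> > \<epsilon>} \<le> \<delta>"
  proof eventually_elim
    case (elim n)
    have "AE \<omega> in M. \<omega> \<in> {\<omega>\<in>space M. \<bar>Z' n \<omega> - W' \<omega>\<bar> > \<epsilon>} \<longleftrightarrow> \<omega> \<in> {\<omega>\<in>space M. \<bar>Z n \<omega> - W \<omega>\<bar> > \<epsilon>}"
      using assms(4)[of n] assms(5) by eventually_elim simp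
    then have "prob {\<omega>\<in>space M. \<bar>Z' n \<omega> - W' \<omega>\<bar> > \<epsilon>} = prob {\<omega>\<in>space M. \<bar>Z n \<omega> - W \<omega>\<bar> > \<epsilon>}"
      by (intro measure_eq_AE) auto
    with elim show ?case by simp
  qed
qed (use assms in auto)

lemma prob_decseq_null:
  assumes "\<And>m. A m \<in> events" "decseq A" "AE \<omega> in M. \<exists>m. \<omega> \<notin> A m"
  shows "(\<lambda>m. prob (A m)) \<longlonglongrightarrow> 0"
proof -
  have "(\<lambda>m. prob (A m)) \<longlonglongrightarrow> prob (\<Inter>m. A m)"
    using assms by (intro finite_Lim_measure_decseq) auto
  moreover have "prob (\<Inter>m. A m) = 0"
  proof -
    have "AE \<omega> in M. \<omega> \<notin> (\<Inter>m. A m)" using assms(3) by eventually_elim auto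
    moreover have "(\<Inter>m. A m) \<in> events" using assms(1) by auto
    ultimately show ?thesis
      using AE_iff_null_sets[of "\<Inter>m. A m" M] by (simp add: measure_eq_0_null_sets)
  qed
  ultimately show ?thesis by simp
qed

lemma conv_in_prob_AE:
  assumes [measurable]: "\<And>n. Z n \<in> borel_measurable M" "W \<in> borel_measurable M"
    and lim: "AE \<omega> in M. (\<lambda>n. Z n \<omega>) \<longlonglongrightarrow> W \<omega>"
  shows "conv_in_prob M Z W"
proof (rule conv_in_probI)
  fix \<epsilon> \<delta> :: real assume e: "0 < \<epsilon>" and d: "0 < \<delta>"
  define A where "A m = {\<omega>\<in>space M. \<exists>n\<ge>m. \<bar>Z n \<omega> - W \<omega>\<bar> > \<epsilon>}" for m
  have meas: "A m \<in> events" for m unfolding A_def by measurable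
  have "(\<lambda>m. prob (A m)) \<longlonglongrightarrow> 0"
  proof (rule prob_decseq_null[OF meas])
    show "decseq A" unfolding decseq_def A_def using order_trans by blast
    show "AE \<omega> in M. \<exists>m. \<omega> \<notin> A m"
      using lim
    proof eventually_elim
      case (elim \<omega>)
      from tendstoD[OF this e] obtain m where "\<And>n. n \<ge> m \<Longrightarrow> dist (Z n \<omega>) (W \<omega>) < \<epsilon>"
        unfolding eventually_sequentially by blast
      then have "\<omega> \<notin> A m" unfolding A_def dist_real_def using less_asym by blast
      then show ?case by blast
    qed
  qed
  from order_tendstoD(2)[OF this d]
  show "\<forall>\<^sub>F n in sequentially. prob {\<omega>\<in>space M. \<bar>Z n \<omega> - W \<omega>\<bar> > \<epsilon>} \<le> \<delta>"
  proof eventually_elim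
    case (elim n)
    have "prob {\<omega>\<in>space M. \<bar>Z n \<omega> - W \<omega>\<bar> > \<epsilon>} \<le> prob (A n)"
      by (rule finite_measure_mono[OF _ meas]) (auto simp: A_def)
    with elim show ?case by simp
  qed
qed (use assms in auto)


section \<open>Tightness, products with null sequences, and completeness\<close>

lemma prob_tightD:
  assumes "prob_tight M Z" "0 < \<delta>"
  obtains B where "B > 0" "\<forall>\<^sub>F n in sequentially. prob {\<omega>\<in>space M. \<bar>Z n \<omega>\<bar> > B} \<le> \<delta>"
  using assms unfolding prob_tight_def by blast

lemma prob_tight_AE_bounded:
  assumes [measurable]: "\<And>n. Z n \<in> borel_measurable M"
    and bnd: "AE \<omega> in M. \<exists>B. \<forall>n. \<bar>Z n \<omega>\<bar> \<le> B"
  shows "prob_tight M Z"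
  unfolding prob_tight_def
proof (intro allI impI)
  fix \<delta> :: real assume d: "0 < \<delta>"
  define A where "A m = {\<omega>\<in>space M. \<exists>n. \<bar>Z n \<omega>\<bar> > real m}" for m
  have meas: "A m \<in> events" for m unfolding A_def by measurable
  have "(\<lambda>m. prob (A m)) \<longlonglongrightarrow> 0"
  proof (rule prob_decseq_null[OF meas])
    show "decseq A" unfolding decseq_def A_def
      using le_less_trans[OF of_nat_mono] by blast
    show "AE \<omega> in M. \<exists>m. \<omega> \<notin> A m"
      using bnd
    proof eventually_elim
      case (elim \<omega>)
      then obtain B where B: "\<And>n. \<bar>Z n \<omega>\<bar> \<le> B" by blast
      obtain m where "B \<le> real m" using real_arch_simple by blast
      with B have "\<omega> \<notin> A m" unfolding A_def by (auto simp: not_less intro: order_trans)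
      then show ?case by blast
    qed
  qed
  from order_tendstoD(2)[OF this d] have "\<forall>\<^sub>F m in sequentially. prob (A m) < \<delta> \<and> m > 0"
    by (intro eventually_conj eventually_gt_at_top)
  then obtain m where m: "prob (A m) < \<delta>" "m > 0"
    unfolding eventually_sequentially by blast
  have "prob {\<omega>\<in>space M. \<bar>Z n \<omega>\<bar> > real m} \<le> \<delta>" for n
  proof -
    have "prob {\<omega>\<in>space M. \<bar>Z n \<omega>\<bar> > real m} \<le> prob (A m)"
      by (rule finite_measure_mono[OF _ meas]) (auto simp: A_def)
    with m show ?thesis by simp
  qed
  with m show "\<exists>B>0. \<forall>\<^sub>F n in sequentially. prob {\<omega>\<in>space M. \<bar>Z n \<omega>\<bar> > B} \<le> \<delta>"
    by (intro exI[of _ "real m"]) simp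
qed

lemma conv_in_prob_tight:
  assumes "conv_in_prob M Z W"
  shows "prob_tight M Z"
  unfolding prob_tight_def
proof (intro allI impI)
  note [measurable] = conv_in_prob_measurable[OF assms]
  fix \<delta> :: real assume d: "0 < \<delta>"
  have "prob_tight M (\<lambda>_. W)" by (rule prob_tight_AE_bounded) auto
  from prob_tightD[OF this, of "\<delta> / 2"] d
  obtain B where B: "B > 0" "prob {\<omega>\<in>space M. \<bar>W \<omega>\<bar> > B} \<le> \<delta> / 2" by auto
  have "\<forall>\<^sub>F n in sequentially. prob {\<omega>\<in>space M. \<bar>Z n \<omega>\<bar> > B + 1} \<le> \<delta>"
    using conv_in_probD[OF assms zero_less_one half_gt_zero[OF d]]
  proof eventually_elim
    case (elim n)
    have "prob {\<omega>\<in>space M. \<bar>Z n \<omega>\<bar> > B + 1} \<le> \<delta> / 2 + \<delta> / 2"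
      by (rule prob_le_add[OF _ _ _ elim B(2)]) (arith, measurable, measurable)
    then show ?case by simp
  qed
  then show "\<exists>B>0. \<forall>\<^sub>F n in sequentially. prob {\<omega>\<in>space M. \<bar>Z n \<omega>\<bar> > B} \<le> \<delta>"
    using B by (intro exI[of _ "B + 1"]) simp
qed

lemma prob_tight_mult_null:
  assumes "prob_tight M Z" and [measurable]: "\<And>n. Z n \<in> borel_measurable M" and a: "a \<longlonglongrightarrow> 0"
  shows "conv_in_prob M (\<lambda>n \<omega>. a n * Z n \<omega>) (\<lambda>_. 0)"
proof (rule conv_in_probI)
  fix \<epsilon> \<delta> :: real assume e: "0 < \<epsilon>" and d: "0 < \<delta>"
  from prob_tightD[OF assms(1) d] obtain B where B: "B > 0"
    "\<forall>\<^sub>F n in sequentially. prob {\<omega>\<in>space M. \<bar>Z n \<omega>\<bar> > B} \<le> \<delta>" .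
  from tendstoD[OF a, of "\<epsilon> / B"] e B(1) have "\<forall>\<^sub>F n in sequentially. \<bar>a n\<bar> < \<epsilon> / B" by simp
  with B(2) show "\<forall>\<^sub>F n in sequentially. prob {\<omega>\<in>space M. \<bar>a n * Z n \<omega> - 0\<bar> > \<epsilon>} \<le> \<delta>"
  proof eventually_elim
    case (elim n)
    have "{\<omega>\<in>space M. \<bar>a n * Z n \<omega> - 0\<bar> > \<epsilon>} \<subseteq> {\<omega>\<in>space M. \<bar>Z n \<omega>\<bar> > B}"
    proof (safe, rule ccontr)
      fix \<omega> assume *: "\<epsilon> < \<bar>a n * Z n \<omega> - 0\<bar>" "\<not> B < \<bar>Z n \<omega>\<bar>"
      then have "\<bar>a n * Z n \<omega>\<bar> \<le> \<epsilon> / B * B"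
        unfolding abs_mult using elim(2) by (intro mult_mono) auto
      with * B(1) show False by simp
    qed
    then have "prob {\<omega>\<in>space M. \<bar>a n * Z n \<omega> - 0\<bar> > \<epsilon>} \<le> prob {\<omega>\<in>space M. \<bar>Z n \<omega>\<bar> > B}"
      by (intro finite_measure_mono) auto
    with elim show ?case by simp
  qed
qed auto

lemma conv_in_prob_mult_seq:
  assumes "conv_in_prob M Z W" and "a \<longlonglongrightarrow> b"
  shows "conv_in_prob M (\<lambda>n \<omega>. a n * Z n \<omega>) (\<lambda>\<omega>. b * W \<omega>)"
proof -
  note [measurable] = conv_in_prob_measurable[OF assms(1)]
  have "(\<lambda>n. a n - b) \<longlonglongrightarrow> 0" using assms(2) by (simp add: LIM_zero)
  from prob_tight_mult_null[OF conv_in_prob_tight[OF assms(1)] _ this]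
  have 1: "conv_in_prob M (\<lambda>n \<omega>. (a n - b) * Z n \<omega>) (\<lambda>_. 0)" by simp
  have 2: "conv_in_prob M (\<lambda>n \<omega>. b * Z n \<omega>) (\<lambda>\<omega>. b * W \<omega>)"
  proof (rule conv_in_probI)
    fix \<epsilon> \<delta> :: real assume e: "0 < \<epsilon>" and d: "0 < \<delta>"
    \<comment> \<open>The summand 1 admits \<open>b = 0\<close>.\<close>
    have "0 < \<epsilon> / (\<bar>b\<bar> + 1)" using e by simp
    from conv_in_probD[OF assms(1) this d]
    show "\<forall>\<^sub>F n in sequentially. prob {\<omega>\<in>space M. \<bar>b * Z n \<omega> - b * W \<omega>\<bar> > \<epsilon>} \<le> \<delta>"
    proof eventually_elim
      case (elim n)
      have "\<epsilon> / (\<bar>b\<bar> + 1) < \<bar>z\<bar>" if "\<epsilon> < \<bar>b * z\<bar>" for z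
      proof -
        have "\<bar>b * z\<bar> \<le> (\<bar>b\<bar> + 1) * \<bar>z\<bar>" by (simp add: abs_mult distrib_right)
        with that have "\<epsilon> < (\<bar>b\<bar> + 1) * \<bar>z\<bar>" by simp
        moreover have "0 < \<bar>b\<bar> + 1" by simp
        ultimately show ?thesis by (simp only: pos_divide_less_eq mult.commute)
      qed
      then have "{\<omega>\<in>space M. \<bar>b * Z n \<omega> - b * W \<omega>\<bar> > \<epsilon>} \<subseteq> {\<omega>\<in>space M. \<epsilon> / (\<bar>b\<bar> + 1) < \<bar>Z n \<omega> - W \<omega>\<bar>}"
        by (auto simp: right_diff_distrib[symmetric])
      then have "prob {\<omega>\<in>space M. \<bar>b * Z n \<omega> - b * W \<omega>\<bar> > \<epsilon>} \<le> prob {\<omega>\<in>space M. \<epsilon> / (\<bar>b\<bar> + 1) < \<bar>Z n \<omega> - W \<omega>\<bar>}"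
        by (intro finite_measure_mono) auto
      with elim show ?case by simp
    qed
  qed auto
  from conv_in_prob_add[OF 1 2] show ?thesis by (simp add: algebra_simps)
qed

lemma conv_in_prob_diff:
  assumes "conv_in_prob M Z W" "conv_in_prob M Z' W'"
  shows "conv_in_prob M (\<lambda>n \<omega>. Z n \<omega> - Z' n \<omega>) (\<lambda>\<omega>. W \<omega> - W' \<omega>)"
  using conv_in_prob_add[OF assms(1) conv_in_prob_mult_seq[OF assms(2) tendsto_const[of "-1"]]] by simp

lemma conv_in_prob_squeeze:
  assumes "conv_in_prob M Y (\<lambda>_. 0)" and [measurable]: "\<And>n. Z n \<in> borel_measurable M"
    and "\<And>n \<omega>. \<omega> \<in> space M \<Longrightarrow> \<bar>Z n \<omega>\<bar> \<le> Y n \<omega>"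
  shows "conv_in_prob M Z (\<lambda>_. 0)"
proof (rule conv_in_probI)
  note [measurable] = conv_in_prob_measurable[OF assms(1)]
  fix \<epsilon> \<delta> :: real assume e: "0 < \<epsilon>" and d: "0 < \<delta>"
  from conv_in_probD[OF assms(1) this]
  show "\<forall>\<^sub>F n in sequentially. prob {\<omega>\<in>space M. \<bar>Z n \<omega> - 0\<bar> > \<epsilon>} \<le> \<delta>"
  proof eventually_elim
    case (elim n)
    have "prob {\<omega>\<in>space M. \<bar>Z n \<omega> - 0\<bar> > \<epsilon>} \<le> prob {\<omega>\<in>space M. \<bar>Y n \<omega> - 0\<bar> > \<epsilon>}"
    proof (rule finite_measure_mono)
      show "{\<omega>\<in>space M. \<bar>Z n \<omega> - 0\<bar> > \<epsilon>} \<subseteq> {\<omega>\<in>space M. \<bar>Y n \<omega> - 0\<bar> > \<epsilon>}"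
      proof safe
        fix \<omega> assume "\<omega> \<in> space M" "\<epsilon> < \<bar>Z n \<omega> - 0\<bar>"
        with assms(3)[of \<omega> n] show "\<epsilon> < \<bar>Y n \<omega> - 0\<bar>" by linarith
      qed
    qed measurable
    with elim show ?case by simp
  qed
qed auto

text \<open>A rapidly Cauchy subsequence converges almost surely by Borel-Cantelli, and the Cauchy
  property carries its limit back to the whole sequence. This is how the quadratic variation is
  constructed.\<close>

lemma conv_in_prob_complete:
  assumes [measurable]: "\<And>n. Y n \<in> borel_measurable M"
    and cauchy: "\<And>\<epsilon> \<delta>. 0 < \<epsilon> \<Longrightarrow> 0 < \<delta> \<Longrightarrow>
      \<exists>N. \<forall>m\<ge>N. \<forall>n\<ge>N. prob {\<omega>\<in>space M. \<bar>Y m \<omega> - Y n \<omega>\<bar> > \<epsilon>} \<le> \<delta>"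
  obtains W where "conv_in_prob M Y W"
proof -
  define e where "e j = (1 / 2 :: real) ^ j" for j :: nat
  have epos: "e j > 0" for j by (simp add: e_def)
  have "\<exists>N. \<forall>m\<ge>N. \<forall>n\<ge>N. prob {\<omega>\<in>space M. \<bar>Y m \<omega> - Y n \<omega>\<bar> > e j} \<le> e j" for j
    using cauchy[OF epos epos] .
  then obtain N where N: "\<And>j m n. N j \<le> m \<Longrightarrow> N j \<le> n \<Longrightarrow> prob {\<omega>\<in>space M. \<bar>Y m \<omega> - Y n \<omega>\<bar> > e j} \<le> e j"
    by metis
  \<comment> \<open>The maximum makes \<open>r\<close> monotone with \<open>r j\<close> and
    \<open>r (Suc j)\<close> both beyond \<open>N j\<close>; the summand \<open>j\<close> makes it
    tend to infinity.\<close>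
  define r where "r j = Max (N ` {..j}) + j" for j
  have rN: "N j \<le> r j" for j unfolding r_def by (intro trans_le_add1 Max_ge) auto
  have rS: "r j \<le> r (Suc j)" for j unfolding r_def by (intro add_mono Max_mono) auto
  have rj: "j \<le> r j" for j unfolding r_def by simp
  define A where "A j = {\<omega>\<in>space M. \<bar>Y (r (Suc j)) \<omega> - Y (r j) \<omega>\<bar> > e j}" for j
  have "AE \<omega> in M. \<forall>\<^sub>F j in sequentially. \<omega> \<in> space M - A j"
  proof (rule borel_cantelli_AE1)
    show "A j \<in> events" for j unfolding A_def by measurable
    show "emeasure M (A j) < \<infinity>" for j by (simp add: less_top[symmetric])
    have "summable e" unfolding e_def by (rule summable_geometric) simp
    moreover have "norm (prob (A j)) \<le> e j" for j
      unfolding A_def using N[of j "r (Suc j)" "r j"] rN[of j] rS[of j] by simp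
    ultimately show "summable (\<lambda>j. prob (A j))" by (rule summable_comparison_test'[of _ 0])
  qed
  then have AEconv: "AE \<omega> in M. convergent (\<lambda>j. Y (r j) \<omega>)"
  proof eventually_elim
    case (elim \<omega>)
    then obtain J where J: "\<And>j. j \<ge> J \<Longrightarrow> \<bar>Y (r (Suc j)) \<omega> - Y (r j) \<omega>\<bar> \<le> e j"
      unfolding eventually_sequentially A_def by (auto simp: not_less)
    have "summable (\<lambda>j. Y (r (Suc j)) \<omega> - Y (r j) \<omega>)"
    proof (rule summable_comparison_test')
      show "summable e" unfolding e_def by (rule summable_geometric) simp
      show "norm (Y (r (Suc j)) \<omega> - Y (r j) \<omega>) \<le> e j" if "j \<ge> J" for j using J[OF that] by simp
    qed
    then have "convergent (\<lambda>n. \<Sum>j<n. Y (r (Suc j)) \<omega> - Y (r j) \<omega>)"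
      by (simp add: summable_iff_convergent)
    then have "convergent (\<lambda>n. (Y (r n) \<omega> - Y (r 0) \<omega>) + Y (r 0) \<omega>)"
      unfolding sum_lessThan_telescope[of "\<lambda>j. Y (r j) \<omega>"] by (intro convergent_add convergent_const)
    then show ?case by simp
  qed
  \<comment> \<open>Where the subsequence diverges \<open>lim\<close> is an arbitrary value, but
    this happens only on a null set.\<close>
  define W where "W \<omega> = lim (\<lambda>j. Y (r j) \<omega>)" for \<omega>
  have [measurable]: "W \<in> borel_measurable M" unfolding W_def by measurable
  have sub: "conv_in_prob M (\<lambda>j. Y (r j)) W"
  proof (rule conv_in_prob_AE)
    show "AE \<omega> in M. (\<lambda>j. Y (r j) \<omega>) \<longlonglongrightarrow> W \<omega>"
      using AEconv by eventually_elim (simp add: W_def convergent_LIMSEQ_iff)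
  qed auto
  have "conv_in_prob M Y W"
  proof (rule conv_in_probI)
    fix \<epsilon> \<delta> :: real assume "0 < \<epsilon>" "0 < \<delta>"
    then have pos: "0 < \<epsilon> / 2" "0 < \<delta> / 2" by auto
    from cauchy[OF pos] obtain N' where N': "\<And>m n. N' \<le> m \<Longrightarrow> N' \<le> n \<Longrightarrow>
      prob {\<omega>\<in>space M. \<bar>Y m \<omega> - Y n \<omega>\<bar> > \<epsilon> / 2} \<le> \<delta> / 2" by blast
    have "\<forall>\<^sub>F n in sequentially. n \<ge> N'" by (rule eventually_ge_at_top)
    with conv_in_probD[OF sub pos]
    have "\<forall>\<^sub>F n in sequentially. prob {\<omega>\<in>space M. \<bar>Y (r n) \<omega> - W \<omega>\<bar> > \<epsilon> / 2} \<le> \<delta> / 2 \<and> N' \<le> n"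
      by eventually_elim simp
    then show "\<forall>\<^sub>F n in sequentially. prob {\<omega>\<in>space M. \<bar>Y n \<omega> - W \<omega>\<bar> > \<epsilon>} \<le> \<delta>"
    proof eventually_elim
      case (elim n)
      then have "N' \<le> r n" using rj[of n] by simp
      with elim have 1: "prob {\<omega>\<in>space M. \<bar>Y n \<omega> - Y (r n) \<omega>\<bar> > \<epsilon> / 2} \<le> \<delta> / 2"
        by (intro N') auto
      have "prob {\<omega>\<in>space M. \<bar>Y n \<omega> - W \<omega>\<bar> > \<epsilon>} \<le> \<delta> / 2 + \<delta> / 2"
        by (rule prob_le_add[OF _ _ _ 1 conjunct1[OF elim]])
          (arith, measurable, measurable)
      then show ?case by simp
    qed
  qed auto
  then show ?thesis by (rule that)
qed

end

section \<open>A weak-type inequality for martingale transforms\<close>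

text \<open>Burkholder's special function: it is zigzag concave, nonpositive on the axis \<open>y = 0\<close>, and
  dominates \<open>1{\<bar>y\<bar> \<ge> 1} - 2 \<bar>x\<bar>\<close>. The functions \<open>burk_x\<close> and \<open>burk_y\<close> are its partial
  derivatives.\<close>

definition burk :: "real \<Rightarrow> real \<Rightarrow> real" where
  "burk x y = (if \<bar>x\<bar> + \<bar>y\<bar> \<le> 1 then y\<^sup>2 - x\<^sup>2 else 1 - 2 * \<bar>x\<bar>)"

definition burk_x :: "real \<Rightarrow> real \<Rightarrow> real" where
  "burk_x x y = (if \<bar>x\<bar> + \<bar>y\<bar> \<le> 1 then - 2 * x else - 2 * sgn x)"

definition burk_y :: "real \<Rightarrow> real \<Rightarrow> real" where
  "burk_y x y = (if \<bar>x\<bar> + \<bar>y\<bar> \<le> 1 then 2 * y else 0)"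

lemma burk_measurable [measurable]:
  "case_prod burk \<in> borel_measurable (borel \<Otimes>\<^sub>M borel)"
  "case_prod burk_x \<in> borel_measurable (borel \<Otimes>\<^sub>M borel)"
  "case_prod burk_y \<in> borel_measurable (borel \<Otimes>\<^sub>M borel)"
  unfolding burk_def burk_x_def burk_y_def by measurable

lemma burk_derivs_bounded: "\<bar>burk_x x y\<bar> \<le> 2" "\<bar>burk_y x y\<bar> \<le> 2"
  by (auto simp: burk_x_def burk_y_def sgn_if)

lemma burk_axis: "burk x 0 \<le> 0"
  by (auto simp: burk_def)

lemma square_le_abs_of_le_1: "\<bar>x\<bar> \<le> 1 \<Longrightarrow> x\<^sup>2 \<le> \<bar>x :: real\<bar>"
  using mult_left_le[of "\<bar>x\<bar>" "\<bar>x\<bar>"] by (simp add: power2_eq_square flip: abs_mult)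

lemma burk_abs_le: "\<bar>burk x y\<bar> \<le> 1 + 2 * \<bar>x\<bar>"
proof (cases "\<bar>x\<bar> + \<bar>y\<bar> \<le> 1")
  case True
  then have "x\<^sup>2 \<le> \<bar>x\<bar>" "y\<^sup>2 \<le> \<bar>y\<bar>" by (auto intro: square_le_abs_of_le_1)
  then have "\<bar>y\<^sup>2 - x\<^sup>2\<bar> \<le> 1 + 2 * \<bar>x\<bar>"
    using True zero_le_power2[of x] zero_le_power2[of y] by linarith
  then show ?thesis using True by (simp add: burk_def)
qed (simp add: burk_def)

lemma burk_ge: "of_bool (\<bar>y\<bar> \<ge> 1) - 2 * \<bar>x\<bar> \<le> burk x y"
proof (cases "\<bar>x\<bar> + \<bar>y\<bar> \<le> 1")
  case True
  show ?thesis
  proof (cases "\<bar>y\<bar> \<ge> 1")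
    case y: True
    with True have "x = 0" "\<bar>y\<bar> = 1" by auto
    moreover from this have "y\<^sup>2 = 1" by (simp add: abs_square_eq_1)
    ultimately show ?thesis by (simp add: burk_def)
  next
    case False
    have "x\<^sup>2 \<le> \<bar>x\<bar>" using True by (intro square_le_abs_of_le_1) linarith
    then have "- (2 * \<bar>x\<bar>) \<le> y\<^sup>2 - x\<^sup>2" using zero_le_power2[of y] by linarith
    then show ?thesis using True False by (simp add: burk_def)
  qed
qed (auto simp: burk_def)

text \<open>The tangent plane bounds the function along directions no steeper than the diagonals.
  Outside the diamond |x| + |y| <= 1 the function is 1 - 2|x|, which is concave and dominates y^2 -
  x^2 inside; within the diamond the quadratic term d^2 - k^2 has the right sign. The delicate case
  is a step from inside to outside.\<close>

lemma burk_zigzag: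
  assumes k: "\<bar>k\<bar> \<le> \<bar>d\<bar>"
  shows "burk (x + d) (y + k) \<le> burk x y + burk_x x y * d + burk_y x y * k"
proof (cases "\<bar>x\<bar> + \<bar>y\<bar> \<le> 1")
  case True
  have kd: "k\<^sup>2 \<le> d\<^sup>2" using k by (simp add: abs_le_square_iff)
  show ?thesis
  proof (cases "\<bar>x + d\<bar> + \<bar>y + k\<bar> \<le> 1")
    case T2: True
    then show ?thesis using True kd by (simp add: burk_def burk_x_def burk_y_def power2_eq_square algebra_simps)
  next
    case False
    \<comment> \<open>The square expands to 1 - 2|x + d| + (x + d)^2, so this is the tangent bound
      for an endpoint outside the diamond.\<close>
    have main: "(1 - \<bar>x + d\<bar>)\<^sup>2 \<le> (y + k)\<^sup>2 + d\<^sup>2 - k\<^sup>2"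
    proof (cases "\<bar>x + d\<bar> \<le> 1")
      case T3: True
      have "(1 - \<bar>x + d\<bar>)\<^sup>2 \<le> \<bar>y + k\<bar>\<^sup>2" using False T3 by (intro power_mono) auto
      with kd show ?thesis by simp
    next
      case F3: False
      \<comment> \<open>From |x + d| <= |x| + |d| and |x| <= 1 - |y|.\<close>
      have "(\<bar>x + d\<bar> - 1)\<^sup>2 \<le> (\<bar>d\<bar> - \<bar>y\<bar>)\<^sup>2" using F3 True by (intro power_mono) auto
      also have "\<dots> = d\<^sup>2 + y\<^sup>2 - 2 * (\<bar>y\<bar> * \<bar>d\<bar>)" by (simp add: power2_diff)
      also have "\<dots> \<le> d\<^sup>2 + y\<^sup>2 + 2 * (y * k)"
      proof -
        have "- (y * k) \<le> \<bar>y\<bar> * \<bar>k\<bar>" by (metis abs_ge_minus_self abs_mult)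
        also have "\<dots> \<le> \<bar>y\<bar> * \<bar>d\<bar>" using k by (intro mult_left_mono) auto
        finally show ?thesis by linarith
      qed
      also have "\<dots> = (y + k)\<^sup>2 + d\<^sup>2 - k\<^sup>2" by (simp add: power2_sum)
      finally show ?thesis by (simp add: power2_commute)
    qed
    have "\<bar>x + d\<bar>\<^sup>2 = (x + d)\<^sup>2" by simp
    with main have "1 - 2 * \<bar>x + d\<bar> \<le> (y + k)\<^sup>2 + d\<^sup>2 - k\<^sup>2 - (x + d)\<^sup>2"
      unfolding power2_diff by simp
    also have "\<dots> = y\<^sup>2 - x\<^sup>2 - 2 * x * d + 2 * y * k" by (simp add: power2_sum)
    finally show ?thesis using True False by (simp add: burk_def burk_x_def burk_y_def)
  qed
next
  case False
  have s: "\<bar>x\<bar> + sgn x * d \<le> \<bar>x + d\<bar>" by (auto simp: sgn_if)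
  have "burk (x + d) (y + k) \<le> 1 - 2 * \<bar>x + d\<bar>"
  proof (cases "\<bar>x + d\<bar> + \<bar>y + k\<bar> \<le> 1")
    case True
    then have "\<bar>y + k\<bar>\<^sup>2 \<le> (1 - \<bar>x + d\<bar>)\<^sup>2" by (intro power_mono) auto
    then show ?thesis using True by (simp add: burk_def power2_diff)
  qed (simp add: burk_def)
  with s False show ?thesis by (simp add: burk_def burk_x_def burk_y_def)
qed

section \<open>Transforms of discrete-time martingales\<close>

context prob_space
begin

lemma martingale_diff_orthogonal:
  assumes sub: "subalgebra M G" and Y: "integrable M Y" and Y': "integrable M Y'"
    and mart: "AE \<omega> in M. real_cond_exp M G Y' \<omega> = Y \<omega>"
    and z: "z \<in> borel_measurable G" and zB: "\<And>\<omega>. \<omega> \<in> space M \<Longrightarrow> \<bar>z \<omega>\<bar> \<le> B"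
  shows "integrable M (\<lambda>\<omega>. z \<omega> * (Y' \<omega> - Y \<omega>))" "(\<integral>\<omega>. z \<omega> * (Y' \<omega> - Y \<omega>) \<partial>M) = 0"
proof -
  interpret G: finite_measure_subalgebra M G by unfold_locales (rule sub)
  have [measurable]: "z \<in> borel_measurable M" by (rule measurable_from_subalg[OF sub z])
  note [measurable] = borel_measurable_integrable[OF Y] borel_measurable_integrable[OF Y']
  have int: "integrable M (\<lambda>\<omega>. z \<omega> * V \<omega>)" if V: "integrable M V" for V
  proof (rule Bochner_Integration.integrable_bound[of M "\<lambda>\<omega>. B * V \<omega>"])
    show "integrable M (\<lambda>\<omega>. B * V \<omega>)" using V by simp
    show "AE \<omega> in M. norm (z \<omega> * V \<omega>) \<le> norm (B * V \<omega>)"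
      using zB by (intro AE_I2) (force simp: abs_mult intro!: mult_right_mono)
  qed (use borel_measurable_integrable[OF V] in measurable)
  show "integrable M (\<lambda>\<omega>. z \<omega> * (Y' \<omega> - Y \<omega>))" using Y Y' by (intro int) auto
  have "(\<integral>\<omega>. z \<omega> * Y' \<omega> \<partial>M) = (\<integral>\<omega>. z \<omega> * real_cond_exp M G Y' \<omega> \<partial>M)"
    using G.real_cond_exp_intg(2)[OF int[OF Y'] z] by simp
  also have "\<dots> = (\<integral>\<omega>. z \<omega> * Y \<omega> \<partial>M)"
    using mart by (intro integral_cong_AE) (auto)
  finally show "(\<integral>\<omega>. z \<omega> * (Y' \<omega> - Y \<omega>) \<partial>M) = 0"
    using int[OF Y] int[OF Y'] by (simp add: right_diff_distrib)
qed

text \<open>Because |h| <= 1, each increment of the transform \<open>P\<close> is dominated by that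
  of \<open>Y\<close>, so the pair moves in zigzag directions and the mean of \<open>burk\<close> at
  the rescaled pair cannot increase. It starts nonpositive, since \<open>P\<close> starts at 0. The
  lower bound \<open>burk_ge\<close> at time \<open>N\<close> then yields the estimate, with its
  factor 2.\<close>

theorem martingale_transform_weak_type:
  fixes G :: "nat \<Rightarrow> 'a measure" and Y h :: "nat \<Rightarrow> 'a \<Rightarrow> real"
  assumes sub: "\<And>i. i \<le> N \<Longrightarrow> subalgebra M (G i)"
    and mono: "\<And>i. i < N \<Longrightarrow> subalgebra (G (Suc i)) (G i)"
    and Ymeas: "\<And>i. i \<le> N \<Longrightarrow> Y i \<in> borel_measurable (G i)"
    and Yint: "\<And>i. i \<le> N \<Longrightarrow> integrable M (Y i)"
    and mart: "\<And>i. i < N \<Longrightarrow> AE \<omega> in M. real_cond_exp M (G i) (Y (Suc i)) \<omega> = Y i \<omega>"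
    and hmeas: "\<And>i. i < N \<Longrightarrow> h i \<in> borel_measurable (G i)"
    and hbound: "\<And>i \<omega>. i < N \<Longrightarrow> \<omega> \<in> space M \<Longrightarrow> \<bar>h i \<omega>\<bar> \<le> 1"
    and a: "a > 0"
  shows "prob {\<omega>\<in>space M. \<bar>\<Sum>i<N. h i \<omega> * (Y (Suc i) \<omega> - Y i \<omega>)\<bar> \<ge> a} \<le> 2 / a * (\<integral>\<omega>. \<bar>Y N \<omega>\<bar> \<partial>M)"
proof -
  define P where "P n \<omega> = (\<Sum>i<n. h i \<omega> * (Y (Suc i) \<omega> - Y i \<omega>))" for n \<omega>
  have Pmeas: "n \<le> N \<Longrightarrow> P n \<in> borel_measurable (G n)" for n
  proof (induction n)
    case 0 then show ?case by (simp add: P_def)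
  next
    case (Suc n)
    then have "P n \<in> borel_measurable (G (Suc n))" "h n \<in> borel_measurable (G (Suc n))"
      "Y n \<in> borel_measurable (G (Suc n))" "Y (Suc n) \<in> borel_measurable (G (Suc n))"
      using mono[of n] hmeas[of n] Ymeas[of n] Ymeas[of "Suc n"] by (auto intro: measurable_from_subalg)
    then have "(\<lambda>\<omega>. P n \<omega> + h n \<omega> * (Y (Suc n) \<omega> - Y n \<omega>)) \<in> borel_measurable (G (Suc n))"
      by measurable
    then show ?case by (simp add: P_def)
  qed
  define u where "u n \<omega> = burk (Y n \<omega> / a) (P n \<omega> / a)" for n \<omega>
  have PM: "P n \<in> borel_measurable M" and YM: "Y n \<in> borel_measurable M" if "n \<le> N" for n
    using measurable_from_subalg[OF sub[OF that]] Pmeas[OF that] Ymeas[OF that] by auto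
  have umeas: "u n \<in> borel_measurable M" if "n \<le> N" for n
    using PM[OF that] YM[OF that] unfolding u_def by measurable
  have uint: "integrable M (u n)" if "n \<le> N" for n
  proof (rule Bochner_Integration.integrable_bound[of M "\<lambda>\<omega>. 1 + 2 * \<bar>Y n \<omega> / a\<bar>"])
    show "integrable M (\<lambda>\<omega>. 1 + 2 * \<bar>Y n \<omega> / a\<bar>)" using Yint[OF that] by auto
    show "AE \<omega> in M. norm (u n \<omega>) \<le> norm (1 + 2 * \<bar>Y n \<omega> / a\<bar>)"
    proof (rule AE_I2)
      fix \<omega> show "norm (u n \<omega>) \<le> norm (1 + 2 * \<bar>Y n \<omega> / a\<bar>)"
        using burk_abs_le[of "Y n \<omega> / a" "P n \<omega> / a"] unfolding u_def by simp
    qed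
  qed (rule umeas[OF that])
  have "n \<le> N \<Longrightarrow> (\<integral>\<omega>. u n \<omega> \<partial>M) \<le> 0" for n
  proof (induction n)
    case 0
    have "u 0 \<omega> \<le> 0" for \<omega> unfolding u_def P_def by (simp add: burk_axis)
    then show ?case using integral_mono[OF uint[OF 0] integrable_zero] by simp
  next
    case (Suc n)
    then have n: "n < N" "n \<le> N" by auto
    \<comment> \<open>The slope of the tangent plane in the direction of the increment of
      \<open>Y\<close>. It is bounded and known at time \<open>n\<close>, hence orthogonal to that
      increment.\<close>
    define z where "z \<omega> = (burk_x (Y n \<omega> / a) (P n \<omega> / a) + burk_y (Y n \<omega> / a) (P n \<omega> / a) * h n \<omega>) / a" for \<omega>
    have zG: "z \<in> borel_measurable (G n)"
      using Pmeas[OF n(2)] Ymeas[OF n(2)] hmeas[OF n(1)] unfolding z_def by measurable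
    have zB: "\<bar>z \<omega>\<bar> \<le> 4 / a" if "\<omega> \<in> space M" for \<omega>
    proof -
      have "\<bar>burk_y (Y n \<omega> / a) (P n \<omega> / a) * h n \<omega>\<bar> \<le> 2 * 1"
        unfolding abs_mult using burk_derivs_bounded hbound[OF n(1) that] by (intro mult_mono) auto
      with burk_derivs_bounded(1)[of "Y n \<omega> / a" "P n \<omega> / a"]
      have "\<bar>burk_x (Y n \<omega> / a) (P n \<omega> / a) + burk_y (Y n \<omega> / a) (P n \<omega> / a) * h n \<omega>\<bar> \<le> 4" by linarith
      then show ?thesis unfolding z_def using a by (simp add: divide_right_mono)
    qed
    note orth = martingale_diff_orthogonal[OF sub[OF n(2)] Yint[OF n(2)] Yint[OF Suc.prems] mart[OF n(1)] zG zB]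
    have "(\<integral>\<omega>. u (Suc n) \<omega> \<partial>M) \<le> (\<integral>\<omega>. u n \<omega> + z \<omega> * (Y (Suc n) \<omega> - Y n \<omega>) \<partial>M)"
    proof (rule integral_mono)
      fix \<omega> assume w: "\<omega> \<in> space M"
      let ?d = "(Y (Suc n) \<omega> - Y n \<omega>) / a" and ?k = "h n \<omega> * (Y (Suc n) \<omega> - Y n \<omega>) / a"
      have "\<bar>?k\<bar> \<le> \<bar>?d\<bar>" using hbound[OF n(1) w] a
        by (simp add: abs_mult divide_right_mono mult_left_le_one_le)
      from burk_zigzag[OF this, of "Y n \<omega> / a" "P n \<omega> / a"]
      show "u (Suc n) \<omega> \<le> u n \<omega> + z \<omega> * (Y (Suc n) \<omega> - Y n \<omega>)"
        unfolding u_def z_def P_def by (simp add: add_divide_distrib diff_divide_distrib algebra_simps)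
    qed (use uint[OF n(2)] uint[OF Suc.prems] orth(1) in auto)
    also have "\<dots> = (\<integral>\<omega>. u n \<omega> \<partial>M)" using uint[OF n(2)] orth by simp
    finally show ?case using Suc by simp
  qed
  then have u0: "(\<integral>\<omega>. u N \<omega> \<partial>M) \<le> 0" by simp
  let ?A = "{\<omega>\<in>space M. \<bar>P N \<omega>\<bar> \<ge> a}"
  have [measurable]: "?A \<in> events" using PM[of N] by measurable
  have "prob ?A - 2 / a * (\<integral>\<omega>. \<bar>Y N \<omega>\<bar> \<partial>M) = (\<integral>\<omega>. indicator ?A \<omega> - 2 / a * \<bar>Y N \<omega>\<bar> \<partial>M)"
    using Yint[of N] by (subst Bochner_Integration.integral_diff) (auto simp: measure_def less_top[symmetric])
  also have "\<dots> \<le> (\<integral>\<omega>. u N \<omega> \<partial>M)"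
  proof (rule integral_mono)
    fix \<omega> assume w: "\<omega> \<in> space M"
    have "indicat_real ?A \<omega> = of_bool (\<bar>P N \<omega> / a\<bar> \<ge> 1)" using w a by (auto simp: indicator_def)
    then show "indicator ?A \<omega> - 2 / a * \<bar>Y N \<omega>\<bar> \<le> u N \<omega>"
      using burk_ge[of "P N \<omega> / a" "Y N \<omega> / a"] a unfolding u_def by simp
  qed (use uint[of N] Yint[of N] in \<open>auto simp: less_top[symmetric]\<close>)
  finally show ?thesis using u0 unfolding P_def by simp
qed

end

section \<open>Paths with left limits along partitions\<close>

text \<open>Compactness in the form of Bolzano's interval induction: the one-sided limits at a point
  give a neighbourhood where that point alone is exceptional, and finite exceptional sets can be
  joined. The half-open interval counts a jump at \<open>y\<close> but not one at \<open>x\<close>,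
  as right continuity suggests.\<close>

lemma cadlag_osc_partition:
  assumes f: "cadlag f" and e: "e > 0" and t: "0 \<le> t"
  obtains D \<delta> where "finite D" "D \<subseteq> {0<..t}" "\<delta> > 0"
    "\<And>x y. 0 \<le> x \<Longrightarrow> x \<le> y \<Longrightarrow> y \<le> t \<Longrightarrow> D \<inter> {x<..y} = {} \<Longrightarrow> \<bar>f y - f x\<bar> \<le> e"
    "\<And>x y. x \<in> D \<Longrightarrow> y \<in> D \<Longrightarrow> x < y \<Longrightarrow> \<delta> \<le> y - x"
proof -
  define Q where "Q D a b \<longleftrightarrow>
    (\<forall>x y. a \<le> x \<and> 0 \<le> x \<and> x \<le> y \<and> y \<le> b \<and> D \<inter> {x<..y} = {} \<longrightarrow> \<bar>f y - f x\<bar> \<le> e)" for D a b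
  define P where "P a b \<longleftrightarrow> (\<exists>D. finite D \<and> Q D a b)" for a b
  have "P 0 t"
  proof (rule Bolzano[OF t])
    fix a b c assume ab: "P a b" "P b c" "a \<le> b" "b \<le> c"
    then obtain D1 D2 where D: "finite D1" "finite D2" "Q D1 a b" "Q D2 b c"
      unfolding P_def by blast
    \<comment> \<open>An interval that reaches beyond \<open>b\<close> from its left contains
      \<open>b\<close>; making \<open>b\<close> exceptional leaves only intervals on one
      side.\<close>
    have "\<bar>f y - f x\<bar> \<le> e"
      if "a \<le> x" "0 \<le> x" "x \<le> y" "y \<le> c" "insert b (D1 \<union> D2) \<inter> {x<..y} = {}" for x y
    proof (cases "y \<le> b")
      case True
      have "D1 \<inter> {x<..y} = {}" using that(5) by blast
      with True that D(3) show ?thesis unfolding Q_def by blast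
    next
      case False
      have "D2 \<inter> {x<..y} = {}" "b \<le> x" using that False by auto
      with that D(4) show ?thesis unfolding Q_def by blast
    qed
    then have "Q (insert b (D1 \<union> D2)) a c" unfolding Q_def by blast
    moreover have "finite (insert b (D1 \<union> D2))" using D by simp
    ultimately show "P a c" unfolding P_def by blast
  next
    fix x assume x: "0 \<le> x" "x \<le> t"
    have "\<forall>\<^sub>F y in at_right x. dist (f y) (f x) < e / 2"
      using f x e unfolding cadlag_def by (intro tendstoD) auto
    then obtain b where b: "b > x" "\<And>y. x < y \<Longrightarrow> y < b \<Longrightarrow> \<bar>f y - f x\<bar> < e / 2"
      unfolding eventually_at_right_field by (auto simp: dist_real_def)
    have "\<exists>a<x. \<exists>l. \<forall>y. a < y \<and> 0 \<le> y \<and> y < x \<longrightarrow> \<bar>f y - l\<bar> < e / 2"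
    proof (cases "x > 0")
      case True
      then obtain l where "(f \<longlongrightarrow> l) (at_left x)" using f unfolding cadlag_def by blast
      then have "\<forall>\<^sub>F y in at_left x. dist (f y) l < e / 2" using e by (intro tendstoD) auto
      then show ?thesis unfolding eventually_at_left_field by (auto simp: dist_real_def)
    next
      case False
      then show ?thesis by (intro exI[of _ "x - 1"]) auto
    qed
    then obtain a l where a: "a < x" "\<And>y. a < y \<Longrightarrow> 0 \<le> y \<Longrightarrow> y < x \<Longrightarrow> \<bar>f y - l\<bar> < e / 2" by blast
    show "\<exists>d>0. \<forall>a b. a \<le> x \<and> x \<le> b \<and> b - a < d \<longrightarrow> P a b"
    proof (intro exI[of _ "min (b - x) (x - a)"] conjI allI impI)
      show "0 < min (b - x) (x - a)" using a b by simp
      fix a' b' assume ab': "a' \<le> x \<and> x \<le> b' \<and> b' - a' < min (b - x) (x - a)"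
      \<comment> \<open>Either both points lie left of \<open>x\<close>, or neither does. In each
        case both values are within \<open>e / 2\<close> of the same one-sided limit.\<close>
      have "\<bar>f v - f u\<bar> \<le> e" if uv: "a' \<le> u" "0 \<le> u" "u \<le> v" "v \<le> b'" "{x} \<inter> {u<..v} = {}" for u v
      proof -
        from uv(5) consider "v < x" | "x \<le> u" by (cases "x \<le> u") auto
        then show ?thesis
        proof cases
          case 1
          with a(2)[of u] a(2)[of v] uv ab' show ?thesis by linarith
        next
          case 2
          have "\<bar>f w - f x\<bar> < e / 2" if "x \<le> w" "w \<le> v" for w
            using b(2)[of w] that uv ab' e by (cases "w = x") auto
          from this[of u] this[of v] 2 uv show ?thesis by linarith
        qed
      qed
      then have "Q {x} a' b'" unfolding Q_def by blast
      then show "P a' b'" unfolding P_def by (intro exI[of _ "{x}"]) simp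
    qed
  qed
  then obtain D where D: "finite D" "Q D 0 t" unfolding P_def by blast
  define E where "E = D \<inter> {0<..t}"
  \<comment> \<open>The element 1 keeps the minimum defined when there are fewer than two
    exceptional points.\<close>
  define \<delta> where "\<delta> = Min (insert 1 ((\<lambda>(x, y). y - x) ` {(x, y) \<in> E \<times> E. x < y}))"
  have finE: "finite E" unfolding E_def using D by simp
  have fin: "finite {(x, y) \<in> E \<times> E. x < y}"
    by (rule finite_subset[of _ "E \<times> E"]) (use finE in auto)
  show ?thesis
  proof (rule that[of E \<delta>])
    show "\<delta> > 0" unfolding \<delta>_def using fin by (subst Min_gr_iff) auto
    show "\<delta> \<le> y - x" if "x \<in> E" "y \<in> E" "x < y" for x y
      unfolding \<delta>_def using fin that by (intro Min_le) (auto intro!: image_eqI[of _ _ "(x, y)"])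
    show "\<bar>f y - f x\<bar> \<le> e" if "0 \<le> x" "x \<le> y" "y \<le> t" "E \<inter> {x<..y} = {}" for x y
    proof -
      have "D \<inter> {x<..y} \<subseteq> E \<inter> {x<..y}" unfolding E_def using that by auto
      with that have "D \<inter> {x<..y} = {}" by blast
      with that D(2) show ?thesis unfolding Q_def by blast
    qed
  qed (use finE in \<open>auto simp: E_def\<close>)
qed

lemma cadlag_bounded:
  assumes "cadlag f" "0 \<le> t"
  obtains B where "0 < B" "\<And>x. 0 \<le> x \<Longrightarrow> x \<le> t \<Longrightarrow> \<bar>f x\<bar> \<le> B"
proof -
  obtain D where D: "finite D" "D \<subseteq> {0<..t}"
    "\<And>x y. 0 \<le> x \<Longrightarrow> x \<le> y \<Longrightarrow> y \<le> t \<Longrightarrow> D \<inter> {x<..y} = {} \<Longrightarrow> \<bar>f y - f x\<bar> \<le> 1"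
    using cadlag_osc_partition[OF assms(1) zero_less_one assms(2)] by metis
  let ?E = "insert 0 D"
  define B where "B = Max ((\<lambda>x. \<bar>f x\<bar>) ` ?E) + 1"
  have "\<bar>f x\<bar> \<le> B" if x: "0 \<le> x" "x \<le> t" for x
  proof -
    let ?S = "{d \<in> ?E. d \<le> x}"
    have fin: "finite ?S" "?S \<noteq> {}" using D x by auto
    define d where "d = Max ?S"
    have d: "d \<in> ?E" "d \<le> x" using Max_in[OF fin] unfolding d_def by auto
    have "0 \<le> d" using d D by auto
    have "D \<inter> {d<..x} = {}"
    proof safe
      fix y assume "y \<in> D" "y \<in> {d<..x}"
      then have "y \<le> d" unfolding d_def using fin by (intro Max_ge) auto
      with \<open>y \<in> {d<..x}\<close> show "y \<in> {}" by simp
    qed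
    with D(3)[OF \<open>0 \<le> d\<close> d(2) x(2)] have "\<bar>f x - f d\<bar> \<le> 1" by simp
    moreover have "\<bar>f d\<bar> \<le> Max ((\<lambda>x. \<bar>f x\<bar>) ` ?E)" using D d by (intro Max_ge) auto
    ultimately show ?thesis unfolding B_def by linarith
  qed
  moreover have "0 < B"
  proof -
    have "\<bar>f 0\<bar> \<le> Max ((\<lambda>x. \<bar>f x\<bar>) ` ?E)" using D by (intro Max_ge) auto
    then show ?thesis unfolding B_def by linarith
  qed
  ultimately show ?thesis using that by blast
qed

text \<open>Summation by parts: the partial sums of \<open>s\<close> and the variation of
  \<open>c\<close> are what counts, so cancellation among the terms of \<open>s\<close> is not
  lost.\<close>

lemma abel_bound:
  fixes c s :: "nat \<Rightarrow> real"
  assumes "\<And>j. j \<le> n \<Longrightarrow> \<bar>\<Sum>m<j. s m\<bar> \<le> E"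
  shows "\<bar>\<Sum>m<n. c m * s m\<bar> \<le> E * (\<bar>c n\<bar> + (\<Sum>m<n. \<bar>c (Suc m) - c m\<bar>))"
proof -
  define S where "S j = (\<Sum>m<j. s m)" for j
  have eq: "(\<Sum>m<j. c m * s m) = c j * S j - (\<Sum>m<j. (c (Suc m) - c m) * S (Suc m))" for j
    by (induction j) (simp_all add: S_def algebra_simps)
  have S: "\<bar>S j\<bar> \<le> E" if "j \<le> n" for j using assms[OF that] unfolding S_def .
  have "\<bar>\<Sum>m<n. c m * s m\<bar> \<le> \<bar>c n * S n\<bar> + \<bar>\<Sum>m<n. (c (Suc m) - c m) * S (Suc m)\<bar>"
    unfolding eq by linarith
  also have "\<bar>c n * S n\<bar> \<le> \<bar>c n\<bar> * E" unfolding abs_mult using S[of n] by (intro mult_left_mono) auto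
  also have "\<bar>\<Sum>m<n. (c (Suc m) - c m) * S (Suc m)\<bar> \<le> (\<Sum>m<n. \<bar>c (Suc m) - c m\<bar> * E)"
    by (rule order_trans[OF sum_abs]) (use S in \<open>auto simp: abs_mult intro!: sum_mono mult_left_mono\<close>)
  finally show ?thesis by (simp add: sum_distrib_left algebra_simps)
qed

text \<open>The window is imposed on \<open>s\<close>, extended by 0, and not on \<open>c\<close>:
  cutting \<open>c\<close> would add jumps to its variation. The factor on the right is therefore
  the same for all windows.\<close>

lemma abel_bound_window:
  fixes c s :: "nat \<Rightarrow> real"
  assumes part: "\<And>j. a \<le> j \<Longrightarrow> j \<le> b \<Longrightarrow> \<bar>\<Sum>m=a..<j. s m\<bar> \<le> E"
    and "a \<le> b" "b \<le> n"
  shows "\<bar>\<Sum>m=a..<b. c m * s m\<bar> \<le> E * (\<bar>c n\<bar> + (\<Sum>m<n. \<bar>c (Suc m) - c m\<bar>))"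
proof -
  define s' where "s' m = (if m \<in> {a..<b} then s m else 0)" for m
  have "(\<Sum>m=a..<b. c m * s m) = (\<Sum>m<n. c m * s' m)"
    using assms(2,3) by (intro sum.mono_neutral_cong_left) (auto simp: s'_def)
  also have "\<bar>\<dots>\<bar> \<le> E * (\<bar>c n\<bar> + (\<Sum>m<n. \<bar>c (Suc m) - c m\<bar>))"
  proof (rule abel_bound)
    fix j
    have "(\<Sum>m<j. s' m) = (\<Sum>m=a..<max a (min j b). s m)"
      by (intro sum.mono_neutral_cong_right) (auto simp: s'_def)
    with part[of "max a (min j b)"] assms show "\<bar>\<Sum>m<j. s' m\<bar> \<le> E" by simp
  qed
  finally show ?thesis .
qed

section \<open>Partitions of an interval and oscillation of a path along them\<close>

definition is_partition :: "real \<Rightarrow> (nat \<Rightarrow> real) \<Rightarrow> nat \<Rightarrow> bool" where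
  "is_partition t \<tau> N \<longleftrightarrow> \<tau> 0 = 0 \<and> \<tau> N = t \<and> (\<forall>i<N. \<tau> i \<le> \<tau> (Suc i))"

lemma is_partition_mono:
  assumes "is_partition t \<tau> N" "i \<le> j" "j \<le> N"
  shows "\<tau> i \<le> \<tau> j"
  using assms(2,3)
proof (induction j rule: dec_induct)
  case (step n)
  then have "\<tau> n \<le> \<tau> (Suc n)" using assms(1) unfolding is_partition_def by auto
  with step show ?case by simp
qed simp

lemma is_partition_bounds:
  assumes "is_partition t \<tau> N" "i \<le> N"
  shows "0 \<le> \<tau> i" "\<tau> i \<le> t"
  using is_partition_mono[OF assms(1) _ assms(2), of 0] is_partition_mono[OF assms(1) assms(2) order_refl] assms(1)
  unfolding is_partition_def by auto

lemma straddling_index: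
  fixes \<tau> :: "nat \<Rightarrow> real"
  assumes "a \<le> j" "\<tau> a < d" "d \<le> \<tau> j"
  obtains m where "a \<le> m" "m < j" "\<tau> m < d" "d \<le> \<tau> (Suc m)"
  using assms
proof (induction j arbitrary: thesis rule: dec_induct)
  case (step n)
  show ?case
  proof (cases "d \<le> \<tau> n")
    case True
    with step obtain m where "a \<le> m" "m < n" "\<tau> m < d" "d \<le> \<tau> (Suc m)" by metis
    then show ?thesis by (intro step.prems(1)[of m]) auto
  next
    case False
    with step show ?thesis by (intro step.prems(1)[of n]) auto
  qed
qed simp

lemma telescope_interval:
  fixes F :: "nat \<Rightarrow> real"
  assumes "a \<le> b"
  shows "(\<Sum>m=a..<b. F (Suc m) - F m) = F b - F a"
  using assms by (simp add: sum_Suc_diff')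

context
  fixes f :: "real \<Rightarrow> real" and t e \<delta> :: real and D :: "real set" and \<tau> :: "nat \<Rightarrow> real" and N :: nat
  assumes part: "is_partition t \<tau> N" and e: "0 < e"
    and finD: "finite D"
    and osc: "\<And>x y. 0 \<le> x \<Longrightarrow> x \<le> y \<Longrightarrow> y \<le> t \<Longrightarrow> D \<inter> {x<..y} = {} \<Longrightarrow> \<bar>f y - f x\<bar> \<le> e"
    and gap: "\<And>x y. x \<in> D \<Longrightarrow> y \<in> D \<Longrightarrow> x < y \<Longrightarrow> \<delta> \<le> y - x"
begin

lemma partition_osc:
  assumes "a \<le> j" "j \<le> N" "D \<inter> {\<tau> a<..\<tau> j} = {}"
  shows "\<bar>f (\<tau> j) - f (\<tau> a)\<bar> \<le> e"
  using assms is_partition_bounds[OF part] is_partition_mono[OF part] by (intro osc) auto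

text \<open>Every big increment spans a point of \<open>D\<close>, and the half-open intervals are
  disjoint. The bound does not depend on the partition.\<close>

lemma card_big_increments:
  "card {m. m < N \<and> \<bar>f (\<tau> (Suc m)) - f (\<tau> m)\<bar> > e} \<le> card D"
proof -
  let ?S = "{m. m < N \<and> \<bar>f (\<tau> (Suc m)) - f (\<tau> m)\<bar> > e}"
  have "\<exists>d. d \<in> D \<inter> {\<tau> m<..\<tau> (Suc m)}" if "m \<in> ?S" for m
    using partition_osc[of m "Suc m"] that by fastforce
  then obtain d where d: "\<And>m. m \<in> ?S \<Longrightarrow> d m \<in> D \<inter> {\<tau> m<..\<tau> (Suc m)}" by metis
  have less: "d i < d j" if "i \<in> ?S" "j \<in> ?S" "i < j" for i j
  proof -
    have "d i \<le> \<tau> (Suc i)" using d[OF that(1)] by simp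
    also have "\<dots> \<le> \<tau> j" using that by (intro is_partition_mono[OF part]) auto
    also have "\<dots> < d j" using d[OF that(2)] by simp
    finally show ?thesis .
  qed
  have "inj_on d ?S"
  proof (rule inj_onI)
    fix x y assume "x \<in> ?S" "y \<in> ?S" "d x = d y"
    with less[of x y] less[of y x] show "x = y" by (metis less_irrefl linorder_neqE_nat)
  qed
  then show ?thesis using d by (intro card_inj_on_le[OF _ _ finD]) auto
qed

text \<open>The big increment has used up one point of \<open>D\<close>. A further oscillation above
  \<open>e\<close> would need a second one at distance less than \<open>\<delta>\<close>.\<close>

lemma osc_after_big_increment:
  assumes "m < j" "j \<le> N" "\<tau> j - \<tau> m < \<delta>" "\<bar>f (\<tau> (Suc m)) - f (\<tau> m)\<bar> > e"
  shows "\<bar>f (\<tau> j) - f (\<tau> (Suc m))\<bar> \<le> e"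
proof (rule ccontr)
  assume "\<not> ?thesis"
  then obtain y where y: "y \<in> D" "\<tau> (Suc m) < y" "y \<le> \<tau> j"
    using partition_osc[of "Suc m" j] assms by force
  obtain x where x: "x \<in> D" "\<tau> m < x" "x \<le> \<tau> (Suc m)"
    using partition_osc[of m "Suc m"] assms by force
  from gap[OF x(1) y(1)] x y assms(3) show False by linarith
qed

lemma small_increments_no_jump:
  assumes "a \<le> j" "j \<le> N" "D \<inter> {\<tau> a<..\<tau> j} = {}"
  shows "\<bar>\<Sum>m=a..<j. let x = f (\<tau> (Suc m)) - f (\<tau> m) in if \<bar>x\<bar> \<le> e then x else 0\<bar> \<le> e"
proof -
  have "\<bar>f (\<tau> (Suc m)) - f (\<tau> m)\<bar> \<le> e" if m: "m \<in> {a..<j}" for m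
  proof (rule partition_osc)
    have "{\<tau> m<..\<tau> (Suc m)} \<subseteq> {\<tau> a<..\<tau> j}"
      using m assms is_partition_mono[OF part, of a m] is_partition_mono[OF part, of "Suc m" j] by auto
    with assms(3) show "D \<inter> {\<tau> m<..\<tau> (Suc m)} = {}" by blast
  qed (use m assms in auto)
  then have "(\<Sum>m=a..<j. let x = f (\<tau> (Suc m)) - f (\<tau> m) in if \<bar>x\<bar> \<le> e then x else 0)
      = (\<Sum>m=a..<j. f (\<tau> (Suc m)) - f (\<tau> m))"
    by (intro sum.cong) (auto simp: Let_def)
  also have "\<dots> = f (\<tau> j) - f (\<tau> a)"
    using telescope_interval[OF assms(1), of "\<lambda>m. f (\<tau> m)"] .
  finally show ?thesis using partition_osc[OF assms] by simp
qed

text \<open>In a short window at most one increment is large, and it is left out of the sum.\<close>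

lemma small_increments_window:
  assumes "a \<le> j" "j \<le> N" "\<tau> j - \<tau> a < \<delta>"
  shows "\<bar>\<Sum>m=a..<j. let x = f (\<tau> (Suc m)) - f (\<tau> m) in if \<bar>x\<bar> \<le> e then x else 0\<bar> \<le> 3 * e"
proof (cases "D \<inter> {\<tau> a<..\<tau> j} = {}")
  case True
  with small_increments_no_jump[OF assms(1,2)] e show ?thesis by simp
next
  case False
  then obtain d where d: "d \<in> D" "\<tau> a < d" "d \<le> \<tau> j" by auto
  from straddling_index[where \<tau> = \<tau>, OF assms(1) d(2,3)]
  obtain m0 where m0: "a \<le> m0" "m0 < j" "\<tau> m0 < d" "d \<le> \<tau> (Suc m0)" .
  have uniq: "d' = d" if "d' \<in> D" "\<tau> a < d'" "d' \<le> \<tau> j" for d'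
    using gap[OF d(1) that(1)] gap[OF that(1) d(1)] that d assms(3) by linarith
  define s where "s m = (let x = f (\<tau> (Suc m)) - f (\<tau> m) in if \<bar>x\<bar> \<le> e then x else 0)" for m
  have mono: "\<tau> (Suc m0) \<le> \<tau> j" "\<tau> a \<le> \<tau> m0" "\<tau> m0 \<le> \<tau> (Suc m0)"
    using m0 assms by (auto intro!: is_partition_mono[OF part])
  have "D \<inter> {\<tau> a<..\<tau> m0} = {}" "D \<inter> {\<tau> (Suc m0)<..\<tau> j} = {}"
    using uniq m0 mono by force+
  then have "\<bar>\<Sum>m=a..<m0. s m\<bar> \<le> e" "\<bar>\<Sum>m=Suc m0..<j. s m\<bar> \<le> e"
    using small_increments_no_jump[of a m0] small_increments_no_jump[of "Suc m0" j] m0 assms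
    unfolding s_def by auto
  moreover have "\<bar>s m0\<bar> \<le> e" using e by (auto simp: s_def Let_def)
  \<comment> \<open>The factor 3 counts the stretch before the exceptional point, the increment
    across it, which is either cut out or at most \<open>e\<close>, and the stretch after
    it.\<close>
  moreover have "(\<Sum>m=a..<j. s m) = (\<Sum>m=a..<m0. s m) + s m0 + (\<Sum>m=Suc m0..<j. s m)"
    using m0 sum.atLeastLessThan_concat[of a m0 j s] sum.atLeast_Suc_lessThan[of m0 j s] by simp
  ultimately show ?thesis unfolding s_def by linarith
qed

end

section \<open>Tightness of transforms of a semimartingale\<close>

abbreviation transform ::
    "(nat \<Rightarrow> 'a \<Rightarrow> real) \<Rightarrow> (real \<Rightarrow> 'a \<Rightarrow> real) \<Rightarrow> (nat \<Rightarrow> real) \<Rightarrow> nat \<Rightarrow> 'a \<Rightarrow> real" where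
  "transform h Y \<tau> N \<omega> \<equiv> \<Sum>i<N. h i \<omega> * (Y (\<tau> (Suc i)) \<omega> - Y (\<tau> i) \<omega>)"

abbreviation unit_predictable ::
    "'a measure \<Rightarrow> (real \<Rightarrow> 'a measure) \<Rightarrow> (nat \<Rightarrow> real) \<Rightarrow> nat \<Rightarrow> (nat \<Rightarrow> 'a \<Rightarrow> real) \<Rightarrow> bool" where
  "unit_predictable M F \<tau> N h \<equiv>
     \<forall>i<N. h i \<in> borel_measurable (F (\<tau> i)) \<and> (\<forall>\<omega>\<in>space M. \<bar>h i \<omega>\<bar> \<le> 1)"

abbreviation transform_le ::
    "'a measure \<Rightarrow> (real \<Rightarrow> 'a measure) \<Rightarrow> (real \<Rightarrow> 'a \<Rightarrow> real) \<Rightarrow> (nat \<Rightarrow> real) \<Rightarrow> nat \<Rightarrow> real \<Rightarrow> real \<Rightarrow> bool" where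
  "transform_le M F Y \<tau> N B \<delta> \<equiv> \<forall>h. unit_predictable M F \<tau> N h \<longrightarrow>
     measure M {\<omega>\<in>space M. \<bar>transform h Y \<tau> N \<omega>\<bar> > B} \<le> \<delta>"

text \<open>Predictable uniform tightness (the P-UT property) along a sequence of partitions: one
  bound \<open>B\<close> serves all unit predictable integrands.\<close>

definition transform_tight ::
    "'a measure \<Rightarrow> (real \<Rightarrow> 'a measure) \<Rightarrow> (real \<Rightarrow> 'a \<Rightarrow> real) \<Rightarrow> (nat \<Rightarrow> nat \<Rightarrow> real) \<Rightarrow> (nat \<Rightarrow> nat) \<Rightarrow> bool" where
  "transform_tight M F Y \<tau> N \<longleftrightarrow>
     (\<forall>\<delta>>0. \<exists>B>0. \<forall>\<^sub>F n in sequentially. transform_le M F Y (\<tau> n) (N n) B \<delta>)"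

text \<open>Turns a property that each path has from a path-dependent index on into a bound for
  probabilities: the indicators tend to 0 almost surely, hence in probability.\<close>

lemma (in prob_space) prob_eventually_not_null:
  assumes [measurable]: "\<And>n. E n \<in> events" and "AE \<omega> in M. \<forall>\<^sub>F n in sequentially. \<omega> \<notin> E n"
    and "0 < \<delta>"
  shows "\<forall>\<^sub>F n in sequentially. prob (E n) \<le> \<delta>"
proof -
  have "conv_in_prob M (\<lambda>n \<omega>. indicator (E n) \<omega>) (\<lambda>_. 0)"
  proof (rule conv_in_prob_AE)
    show "AE \<omega> in M. (\<lambda>n. indicat_real (E n) \<omega>) \<longlonglongrightarrow> 0"
      using assms(2)
    proof eventually_elim
      case (elim \<omega>)
      then have "\<forall>\<^sub>F n in sequentially. indicat_real (E n) \<omega> = 0" by eventually_elim simp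
      then show ?case by (simp add: tendsto_eventually)
    qed
  qed auto
  from conv_in_probD[OF this, of "1 / 2", OF _ assms(3)]
  have "\<forall>\<^sub>F n in sequentially. prob {\<omega> \<in> space M. 1 / 2 < \<bar>indicat_real (E n) \<omega> - 0\<bar>} \<le> \<delta>" by simp
  moreover have "{\<omega> \<in> space M. 1 / 2 < \<bar>indicat_real (E n) \<omega> - 0\<bar>} = E n" for n
    using sets.sets_into_space[OF assms(1)[of n]] by (auto simp: indicator_def split: if_splits)
  ultimately show ?thesis by simp
qed

locale filtered = prob_space M for M :: "'a measure" +
  fixes F :: "real \<Rightarrow> 'a measure"
  assumes filtF: "filtration (space M) F" and subF: "\<And>t. subalgebra M (F t)"
begin

lemma sub_mono: "s \<le> t \<Longrightarrow> subalgebra (F t) (F s)"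
  using filtF unfolding subalgebra_def filtration_def by auto

lemma adapted_meas_F: "adapted F Y \<Longrightarrow> 0 \<le> s \<Longrightarrow> s \<le> t \<Longrightarrow> Y s \<in> borel_measurable (F t)"
  using measurable_from_subalg[OF sub_mono] unfolding adapted_def by blast

lemma adapted_meas: "adapted F Y \<Longrightarrow> 0 \<le> s \<Longrightarrow> Y s \<in> borel_measurable M"
  using measurable_from_subalg[OF subF] unfolding adapted_def by blast

lemma adapted_part_meas:
  "adapted F Y \<Longrightarrow> is_partition t \<tau> N \<Longrightarrow> i \<le> N \<Longrightarrow> Y (\<tau> i) \<in> borel_measurable M"
  using adapted_meas is_partition_bounds(1) by blast

lemma transform_measurable:
  assumes "adapted F Y" "is_partition t \<tau> N" and h: "\<And>i. i < N \<Longrightarrow> h i \<in> borel_measurable (F (\<tau> i))"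
  shows "(\<lambda>\<omega>. transform h Y \<tau> N \<omega>) \<in> borel_measurable M"
proof (rule borel_measurable_sum)
  fix i assume "i \<in> {..<N}"
  then have [measurable]: "Y (\<tau> (Suc i)) \<in> borel_measurable M" "Y (\<tau> i) \<in> borel_measurable M"
    "h i \<in> borel_measurable M"
    using adapted_part_meas[OF assms(1,2)] measurable_from_subalg[OF subF h] by simp_all
  show "(\<lambda>\<omega>. h i \<omega> * (Y (\<tau> (Suc i)) \<omega> - Y (\<tau> i) \<omega>)) \<in> borel_measurable M" by measurable
qed

text \<open>A transform is at most the variation along the partition, which on each path is bounded
  independently of the partition.\<close>

lemma transform_tight_finite_variation:
  assumes ad: "adapted F A" and fv: "\<And>\<omega>. \<omega> \<in> space M \<Longrightarrow> finite_variation (\<lambda>t. A t \<omega>)"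
    and part: "\<And>n. is_partition t (\<tau> n) (N n)" and t: "0 \<le> t"
  shows "transform_tight M F A \<tau> N"
  unfolding transform_tight_def
proof (intro allI impI)
  fix \<delta> :: real assume d: "0 < \<delta>"
  define V where "V n \<omega> = (\<Sum>i<N n. \<bar>A (\<tau> n (Suc i)) \<omega> - A (\<tau> n i) \<omega>\<bar>)" for n \<omega>
  have Vmeas: "V n \<in> borel_measurable M" for n
    unfolding V_def using adapted_part_meas[OF ad part]
    by (intro borel_measurable_sum borel_measurable_abs borel_measurable_diff) auto
  have "prob_tight M V"
  proof (rule prob_tight_AE_bounded[OF Vmeas], rule AE_I2)
    fix \<omega> assume "\<omega> \<in> space M"
    from fv[OF this] t obtain B where
      B: "\<And>m r. mono_on {..m} r \<Longrightarrow> r ` {..m} \<subseteq> {0..t} \<Longrightarrow> (\<Sum>i<m. \<bar>A (r (Suc i)) \<omega> - A (r i) \<omega>\<bar>) \<le> B"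
      unfolding finite_variation_def by meson
    have "V n \<omega> \<le> B" for n
      unfolding V_def
    proof (rule B)
      show "mono_on {..N n} (\<tau> n)" by (rule mono_onI) (use is_partition_mono[OF part] in auto)
      show "\<tau> n ` {..N n} \<subseteq> {0..t}" using is_partition_bounds[OF part] by auto
    qed
    moreover have "0 \<le> V n \<omega>" for n unfolding V_def by (simp add: sum_nonneg)
    ultimately show "\<exists>B. \<forall>n. \<bar>V n \<omega>\<bar> \<le> B" by (intro exI[of _ B]) simp
  qed
  from prob_tightD[OF this d] obtain B where B: "B > 0"
    "\<forall>\<^sub>F n in sequentially. prob {\<omega>\<in>space M. \<bar>V n \<omega>\<bar> > B} \<le> \<delta>" .
  from B(2) have "\<forall>\<^sub>F n in sequentially. transform_le M F A (\<tau> n) (N n) B \<delta>"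
  proof (eventually_elim, intro allI impI)
    fix n and h :: "nat \<Rightarrow> 'a \<Rightarrow> real"
    assume le: "prob {\<omega>\<in>space M. \<bar>V n \<omega>\<bar> > B} \<le> \<delta>"
      and h: "unit_predictable M F (\<tau> n) (N n) h"
    have "prob {\<omega>\<in>space M. \<bar>transform h A (\<tau> n) (N n) \<omega>\<bar> > B}
        \<le> prob {\<omega>\<in>space M. \<bar>V n \<omega>\<bar> > B}"
    proof (rule finite_measure_mono)
      show "{\<omega>\<in>space M. \<bar>V n \<omega>\<bar> > B} \<in> events" using Vmeas[of n] by measurable
      show "{\<omega>\<in>space M. \<bar>transform h A (\<tau> n) (N n) \<omega>\<bar> > B}
          \<subseteq> {\<omega>\<in>space M. \<bar>V n \<omega>\<bar> > B}"
      proof safe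
        fix \<omega> assume w: "\<omega> \<in> space M" and gt: "B < \<bar>transform h A (\<tau> n) (N n) \<omega>\<bar>"
        have "\<bar>transform h A (\<tau> n) (N n) \<omega>\<bar> \<le> V n \<omega>"
          unfolding V_def
          by (rule order_trans[OF sum_abs sum_mono]) (use h w in \<open>simp add: abs_mult mult_left_le_one_le\<close>)
        with gt show "B < \<bar>V n \<omega>\<bar>" by linarith
      qed
    qed
    with le show "prob {\<omega>\<in>space M. \<bar>transform h A (\<tau> n) (N n) \<omega>\<bar> > B} \<le> \<delta>"
      by linarith
  qed
  with B(1) show "\<exists>B>0. \<forall>\<^sub>F n in sequentially. transform_le M F A (\<tau> n) (N n) B \<delta>"
    by blast
qed

text \<open>A single localizing time, beyond \<open>t\<close> with probability close to 1, replaces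
  \<open>L\<close> by a martingale. The weak-type bound involves only its absolute moment at
  \<open>t\<close>, the common endpoint of all partitions.\<close>

lemma transform_tight_local_martingale:
  assumes L: "local_martingale M F L"
    and part: "\<And>n. is_partition t (\<tau> n) (N n)" and t: "0 \<le> t"
  shows "transform_tight M F L \<tau> N"
  unfolding transform_tight_def
proof (intro allI impI)
  fix \<delta> :: real assume d: "0 < \<delta>"
  have ad: "adapted F L" using L unfolding local_martingale_def by simp
  from L obtain T :: "nat \<Rightarrow> 'a \<Rightarrow> real" where
    T: "\<And>n. stopping_time F (T n)"
      "AE \<omega> in M. incseq (\<lambda>n. T n \<omega>) \<and> filterlim (\<lambda>n. T n \<omega>) at_top sequentially"
      "\<And>n. martingale M F (\<lambda>t \<omega>. L (min t (T n \<omega>)) \<omega>)"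
    unfolding local_martingale_def by blast
  define E where "E m = {\<omega>\<in>space M. T m \<omega> \<le> t}" for m
  have E: "E m \<in> events" for m
  proof -
    have "{\<omega>\<in>space (F t). T m \<omega> \<le> t} \<in> sets (F t)"
      using stopping_timeD[OF T(1)] unfolding Measurable.pred_def by simp
    then show ?thesis using subF[of t] unfolding subalgebra_def E_def by auto
  qed
  have "\<forall>\<^sub>F m in sequentially. prob (E m) \<le> \<delta> / 2"
  proof (rule prob_eventually_not_null[OF E])
    show "AE \<omega> in M. \<forall>\<^sub>F m in sequentially. \<omega> \<notin> E m"
      using T(2)
    proof eventually_elim
      case (elim \<omega>)
      then have "\<forall>\<^sub>F m in sequentially. t < T m \<omega>" by (auto simp: filterlim_at_top_dense)
      then show ?case by eventually_elim (simp add: E_def)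
    qed
  qed (use d in simp)
  then obtain m where m: "prob (E m) \<le> \<delta> / 2" unfolding eventually_sequentially by blast
  define Y where "Y s \<omega> = L (min s (T m \<omega>)) \<omega>" for s \<omega>
  have Y: "adapted F Y" "\<And>s. 0 \<le> s \<Longrightarrow> integrable M (Y s)"
    "\<And>s r. 0 \<le> s \<Longrightarrow> s \<le> r \<Longrightarrow> AE \<omega> in M. real_cond_exp M (F s) (Y r) \<omega> = Y s \<omega>"
    using T(3)[of m] unfolding martingale_def Y_def by auto
  define C where "C = (\<integral>\<omega>. \<bar>Y t \<omega>\<bar> \<partial>M)"
  have C: "0 \<le> C" unfolding C_def by simp
  \<comment> \<open>Chosen so that \<open>2 / B * C\<close> is at most \<open>\<delta> / 2\<close>;
    the summand 1 keeps it positive when \<open>C = 0\<close>.\<close>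
  define B where "B = 4 * C / \<delta> + 1"
  have B: "0 < B" unfolding B_def using C d by (simp add: add_nonneg_pos)
  have BC: "2 / B * C \<le> \<delta> / 2"
  proof -
    have "4 * C \<le> \<delta> * B" unfolding B_def using d by (simp add: distrib_left)
    then show ?thesis using B by (simp add: field_simps)
  qed
  have main: "prob {\<omega>\<in>space M. \<bar>transform h L (\<tau> n) (N n) \<omega>\<bar> > B} \<le> \<delta>"
    if h: "unit_predictable M F (\<tau> n) (N n) h" for n h
  proof -
    note b = is_partition_bounds[OF part, of _ n]
    have 1: "prob {\<omega>\<in>space M. \<bar>transform h Y (\<tau> n) (N n) \<omega>\<bar> \<ge> B}
        \<le> 2 / B * (\<integral>\<omega>. \<bar>Y (\<tau> n (N n)) \<omega>\<bar> \<partial>M)"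
    proof (rule martingale_transform_weak_type[where G = "\<lambda>i. F (\<tau> n i)"])
      show "Y (\<tau> n i) \<in> borel_measurable (F (\<tau> n i))" if "i \<le> N n" for i
        using Y(1) b[OF that] unfolding adapted_def by blast
      show "AE \<omega> in M. real_cond_exp M (F (\<tau> n i)) (Y (\<tau> n (Suc i))) \<omega> = Y (\<tau> n i) \<omega>" if "i < N n" for i
        using that b[of i] is_partition_mono[OF part, of i "Suc i" n] by (intro Y(3)) auto
      show "subalgebra (F (\<tau> n (Suc i))) (F (\<tau> n i))" if "i < N n" for i
        using that by (intro sub_mono is_partition_mono[OF part]) auto
    qed (use subF Y(2) b h B in auto)
    have "\<tau> n (N n) = t" using part[of n] unfolding is_partition_def by simp
    with 1 BC have 2: "prob {\<omega>\<in>space M. \<bar>transform h Y (\<tau> n) (N n) \<omega>\<bar> \<ge> B} \<le> \<delta> / 2"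
      unfolding C_def by simp
    have m': "prob {\<omega>\<in>space M. T m \<omega> \<le> t} \<le> \<delta> / 2" "{\<omega>\<in>space M. T m \<omega> \<le> t} \<in> events"
      using m E[of m] unfolding E_def by auto
    have meas: "{\<omega>\<in>space M. \<bar>transform h Y (\<tau> n) (N n) \<omega>\<bar> \<ge> B} \<in> events"
    proof -
      have "(\<lambda>\<omega>. transform h Y (\<tau> n) (N n) \<omega>) \<in> borel_measurable M"
        using h by (intro transform_measurable[OF Y(1) part]) simp
      then show ?thesis by measurable
    qed
    have "prob {\<omega>\<in>space M. \<bar>transform h L (\<tau> n) (N n) \<omega>\<bar> > B} \<le> \<delta> / 2 + \<delta> / 2"
    proof (rule prob_le_add[OF _ m'(2) meas m'(1) 2])
      fix \<omega> assume w: "\<omega> \<in> space M" and gt: "\<bar>transform h L (\<tau> n) (N n) \<omega>\<bar> > B"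
      show "T m \<omega> \<le> t \<or> \<bar>transform h Y (\<tau> n) (N n) \<omega>\<bar> \<ge> B"
      proof (rule disjCI)
        assume "\<not> B \<le> \<bar>transform h Y (\<tau> n) (N n) \<omega>\<bar>"
        then have ngt: "\<bar>transform h Y (\<tau> n) (N n) \<omega>\<bar> < B" by simp
        \<comment> \<open>No partition point exceeds \<open>t\<close>, so stopping after
          \<open>t\<close> changes nothing.\<close>
        have eq: "(transform h Y (\<tau> n) (N n) \<omega>)
            = (transform h L (\<tau> n) (N n) \<omega>)" if "t < T m \<omega>"
        proof (rule sum.cong[OF refl])
          fix i assume "i \<in> {..<N n}"
          then show "h i \<omega> * (Y (\<tau> n (Suc i)) \<omega> - Y (\<tau> n i) \<omega>) = h i \<omega> * (L (\<tau> n (Suc i)) \<omega> - L (\<tau> n i) \<omega>)"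
            using b(2)[of i] b(2)[of "Suc i"] that unfolding Y_def by (simp add: min_def)
        qed
        show "T m \<omega> \<le> t"
        proof (rule ccontr)
          assume "\<not> T m \<omega> \<le> t"
          then have "t < T m \<omega>" by simp
          from eq[OF this] ngt gt show False by linarith
        qed
      qed
    qed
    then show ?thesis by simp
  qed
  show "\<exists>B>0. \<forall>\<^sub>F n in sequentially. transform_le M F L (\<tau> n) (N n) B \<delta>"
  proof (intro exI[of _ B] conjI always_eventually allI impI)
  qed (use B main in simp_all)
qed

text \<open>The initial value drops out of the increments. The decomposition holds almost surely for
  all times at once, so it can be used at every partition point.\<close>

theorem transform_tight_semimartingale:
  assumes X: "semimartingale M F X"
    and part: "\<And>n. is_partition t (\<tau> n) (N n)" and t: "0 \<le> t"
  shows "transform_tight M F X \<tau> N"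
  unfolding transform_tight_def
proof (intro allI impI)
  fix \<delta> :: real assume d: "0 < \<delta>"
  from X obtain L A where LA: "local_martingale M F L" "adapted F A"
    "\<forall>\<omega>\<in>space M. finite_variation (\<lambda>t. A t \<omega>)"
    and eq: "AE \<omega> in M. \<forall>t\<ge>0. X t \<omega> = X 0 \<omega> + L t \<omega> + A t \<omega>"
    unfolding semimartingale_def by blast
  have adX: "adapted F X" and adL: "adapted F L"
    using X LA unfolding semimartingale_def local_martingale_def by auto
  have "0 < \<delta> / 2" using d by simp
  with transform_tight_local_martingale[OF LA(1) part t] obtain B1 where B1: "B1 > 0"
    "\<forall>\<^sub>F n in sequentially. transform_le M F L (\<tau> n) (N n) B1 (\<delta> / 2)"
    unfolding transform_tight_def by meson
  have "transform_tight M F A \<tau> N"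
    using LA by (intro transform_tight_finite_variation[OF _ _ part t]) auto
  with \<open>0 < \<delta> / 2\<close> obtain B2 where B2: "B2 > 0"
    "\<forall>\<^sub>F n in sequentially. transform_le M F A (\<tau> n) (N n) B2 (\<delta> / 2)"
    unfolding transform_tight_def by meson
  from B1(2) B2(2)
  have "\<forall>\<^sub>F n in sequentially. transform_le M F X (\<tau> n) (N n) (B1 + B2) \<delta>"
  proof (eventually_elim, intro allI impI)
    fix n and h :: "nat \<Rightarrow> 'a \<Rightarrow> real"
    let ?S = "\<lambda>Z \<omega>. transform h Z (\<tau> n) (N n) \<omega>"
    assume 1: "transform_le M F L (\<tau> n) (N n) B1 (\<delta> / 2)"
      and 2: "transform_le M F A (\<tau> n) (N n) B2 (\<delta> / 2)"
      and h: "unit_predictable M F (\<tau> n) (N n) h"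
    have meas: "?S Z \<in> borel_measurable M" if "adapted F Z" for Z
      using h by (intro transform_measurable[OF that part]) simp
    note [measurable] = meas[OF adX] meas[OF adL] meas[OF LA(2)]
    have "AE \<omega> in M. ?S X \<omega> = ?S L \<omega> + ?S A \<omega>"
      using eq
    proof eventually_elim
      case (elim \<omega>)
      have "X (\<tau> n i) \<omega> = X 0 \<omega> + L (\<tau> n i) \<omega> + A (\<tau> n i) \<omega>" if "i \<le> N n" for i
        using elim is_partition_bounds(1)[OF part that] by blast
      then have "?S X \<omega> = (\<Sum>i<N n. h i \<omega> * (L (\<tau> n (Suc i)) \<omega> - L (\<tau> n i) \<omega>)
          + h i \<omega> * (A (\<tau> n (Suc i)) \<omega> - A (\<tau> n i) \<omega>))"
        by (intro sum.cong) (auto simp: algebra_simps)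
      then show ?case by (simp add: sum.distrib)
    qed
    then have "prob {\<omega>\<in>space M. \<bar>?S X \<omega>\<bar> > B1 + B2} = prob {\<omega>\<in>space M. \<bar>?S L \<omega> + ?S A \<omega>\<bar> > B1 + B2}"
      by (intro measure_eq_AE) auto
    also have "\<dots> \<le> \<delta> / 2 + \<delta> / 2"
      by (rule prob_le_add[OF _ _ _ mp[OF spec[OF 1] h] mp[OF spec[OF 2] h]]) (arith, measurable, measurable)
    finally show "prob {\<omega>\<in>space M. \<bar>?S X \<omega>\<bar> > B1 + B2} \<le> \<delta>" by simp
  qed
  moreover have "B1 + B2 > 0" using B1 B2 by simp
  ultimately show "\<exists>B>0. \<forall>\<^sub>F n in sequentially. transform_le M F X (\<tau> n) (N n) B \<delta>"
    by blast
qed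

end

section \<open>Off-diagonal quadratic forms of the increments\<close>

definition incr :: "(real \<Rightarrow> real) \<Rightarrow> (nat \<Rightarrow> real) \<Rightarrow> nat \<Rightarrow> real" where
  "incr f \<tau> m = f (\<tau> (Suc m)) - f (\<tau> m)"

definition small_part :: "real \<Rightarrow> real \<Rightarrow> real" where
  "small_part e x = (if \<bar>x\<bar> \<le> e then x else 0)"

definition offdiag :: "(nat \<Rightarrow> nat \<Rightarrow> real) \<Rightarrow> (real \<Rightarrow> real) \<Rightarrow> (nat \<Rightarrow> real) \<Rightarrow> nat \<Rightarrow> real" where
  "offdiag c f \<tau> N = (\<Sum>l<N. \<Sum>m<l. c l m * incr f \<tau> m * incr f \<tau> l)"

lemma small_part_measurable [measurable]: "small_part e \<in> borel_measurable borel"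
  unfolding small_part_def by measurable

text \<open>Only the earlier factor is split. With its small part the later index stays outside, so
  the inner sum is an integrand known at time \<open>\<tau> l\<close>. With its large part the order
  is exchanged, so each large increment multiplies a sum of later ones.\<close>

lemma offdiag_split:
  "offdiag c f \<tau> N = (\<Sum>l<N. (\<Sum>m<l. c l m * small_part e (incr f \<tau> m)) * incr f \<tau> l)
     + (\<Sum>m<N. (incr f \<tau> m - small_part e (incr f \<tau> m)) * (\<Sum>l=Suc m..<N. c l m * incr f \<tau> l))"
proof -
  let ?b = "\<lambda>m. incr f \<tau> m - small_part e (incr f \<tau> m)"
  have "offdiag c f \<tau> N = (\<Sum>l<N. (\<Sum>m<l. c l m * small_part e (incr f \<tau> m)) * incr f \<tau> l)
      + (\<Sum>l<N. \<Sum>m<l. c l m * ?b m * incr f \<tau> l)"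
    unfolding offdiag_def sum.distrib[symmetric] sum_distrib_right
    by (intro sum.cong refl) (simp add: algebra_simps)
  also have "(\<Sum>l<N. \<Sum>m<l. c l m * ?b m * incr f \<tau> l)
      = (\<Sum>l<N. \<Sum>m<N. if m < l then c l m * ?b m * incr f \<tau> l else 0)"
    by (intro sum.cong[OF refl] sum.mono_neutral_cong_left) auto
  also have "\<dots> = (\<Sum>m<N. \<Sum>l<N. if m < l then c l m * ?b m * incr f \<tau> l else 0)"
    by (rule sum.swap)
  also have "\<dots> = (\<Sum>m<N. \<Sum>l=Suc m..<N. c l m * ?b m * incr f \<tau> l)"
    by (intro sum.cong[OF refl] sum.mono_neutral_cong_right) auto
  also have "\<dots> = (\<Sum>m<N. ?b m * (\<Sum>l=Suc m..<N. c l m * incr f \<tau> l))"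
    by (intro sum.cong refl) (simp add: sum_distrib_left algebra_simps)
  finally show ?thesis .
qed

section \<open>Path estimates for the two parts of an off-diagonal form\<close>

context
  fixes \<tau> :: "nat \<Rightarrow> nat \<Rightarrow> real" and N :: "nat \<Rightarrow> nat" and c :: "nat \<Rightarrow> nat \<Rightarrow> nat \<Rightarrow> real" and t K :: real
  assumes part: "\<And>n. is_partition t (\<tau> n) (N n)" and t: "0 \<le> t"
    and csym: "\<And>n l m. c n l m = c n m l"
    and cvar: "\<And>n l. l < N n \<Longrightarrow> \<bar>c n l (N n)\<bar> + (\<Sum>m<N n. \<bar>c n l (Suc m) - c n l m\<bar>) \<le> K"
    and cloc: "\<And>\<delta>. 0 < \<delta> \<Longrightarrow> \<forall>\<^sub>F n in sequentially. \<forall>l<N n. \<forall>m<l. c n l m \<noteq> 0 \<longrightarrow> \<tau> n (Suc l) - \<tau> n m < \<delta>"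
begin

text \<open>Locality confines the sum to a window shorter than the gaps of \<open>D\<close>, where
  partial sums of the small increments stay below \<open>3 * e\<close>; Abel summation supplies the
  factor \<open>K\<close>.\<close>

lemma offdiag_small_path:
  assumes f: "cadlag f" and e: "0 < e"
  shows "\<forall>\<^sub>F n in sequentially. \<forall>l<N n. \<bar>\<Sum>m<l. c n l m * small_part e (incr f (\<tau> n) m)\<bar> \<le> 3 * e * K"
proof -
  from cadlag_osc_partition[OF f e t] obtain D \<delta> where D: "finite D" "\<delta> > 0"
    "\<And>x y. 0 \<le> x \<Longrightarrow> x \<le> y \<Longrightarrow> y \<le> t \<Longrightarrow> D \<inter> {x<..y} = {} \<Longrightarrow> \<bar>f y - f x\<bar> \<le> e"
    "\<And>x y. x \<in> D \<Longrightarrow> y \<in> D \<Longrightarrow> x < y \<Longrightarrow> \<delta> \<le> y - x" by metis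
  from cloc[OF D(2)] show ?thesis
  proof (eventually_elim, intro allI impI)
    fix n l
    assume loc: "\<forall>l<N n. \<forall>m<l. c n l m \<noteq> 0 \<longrightarrow> \<tau> n (Suc l) - \<tau> n m < \<delta>" and l: "l < N n"
    \<comment> \<open>The first index of the short window that ends with increment \<open>l\<close>.
      The alternative \<open>m = l\<close> covers the case that this increment alone is too
      long.\<close>
    define a where "a = (LEAST m. m = l \<or> \<tau> n (Suc l) - \<tau> n m < \<delta>)"
    have al: "a \<le> l" unfolding a_def by (rule Least_le) simp
    have a: "a = l \<or> \<tau> n (Suc l) - \<tau> n a < \<delta>" unfolding a_def by (rule LeastI[of _ l]) simp
    have before: "c n l m = 0" if "m < a" for m
    proof -
      have "\<not> \<tau> n (Suc l) - \<tau> n m < \<delta>" using not_less_Least[OF that[unfolded a_def]] by blast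
      moreover have "m < l" using that al by simp
      ultimately show ?thesis using loc l by blast
    qed
    have "(\<Sum>m<l. c n l m * small_part e (incr f (\<tau> n) m)) = (\<Sum>m=a..<l. c n l m * small_part e (incr f (\<tau> n) m))"
      using before by (intro sum.mono_neutral_right) (auto simp: not_le)
    also have "\<bar>\<dots>\<bar> \<le> 3 * e * (\<bar>c n l (N n)\<bar> + (\<Sum>m<N n. \<bar>c n l (Suc m) - c n l m\<bar>))"
    proof (rule abel_bound_window[OF _ al less_imp_le[OF l]])
      fix j assume j: "a \<le> j" "j \<le> l"
      show "\<bar>\<Sum>m=a..<j. small_part e (incr f (\<tau> n) m)\<bar> \<le> 3 * e"
      proof (cases "a = l")
        case True with j e show ?thesis by simp
      next
        case False
        have "\<tau> n j \<le> \<tau> n (Suc l)" using j l by (intro is_partition_mono[OF part]) auto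
        with False a have "\<tau> n j - \<tau> n a < \<delta>" by linarith
        from small_increments_window[OF part e D(1,3,4) j(1) _ this] j l
        show ?thesis by (simp add: small_part_def incr_def Let_def)
      qed
    qed
    also have "\<dots> \<le> 3 * e * K" using cvar[OF l] e by (intro mult_left_mono) auto
    finally show "\<bar>\<Sum>m<l. c n l m * small_part e (incr f (\<tau> n) m)\<bar> \<le> 3 * e * K" .
  qed
qed

text \<open>Two scales are at work: \<open>e\<close> fixes the number of big increments once and for
  all, while the oscillation of the path after each of them can be pushed below any
  \<open>e'\<close> by shrinking the windows.\<close>

lemma offdiag_big_path:
  assumes f: "cadlag f" and e: "0 < e" and K: "0 < K"
  shows "(\<lambda>n. \<Sum>m<N n. (incr f (\<tau> n) m - small_part e (incr f (\<tau> n) m)) *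
     (\<Sum>l=Suc m..<N n. c n l m * incr f (\<tau> n) l)) \<longlonglongrightarrow> 0"
proof (rule tendstoI)
  fix \<epsilon> :: real assume eps: "0 < \<epsilon>"
  from cadlag_osc_partition[OF f e t] obtain D0 \<delta>0 where D0: "finite D0"
    "\<And>x y. 0 \<le> x \<Longrightarrow> x \<le> y \<Longrightarrow> y \<le> t \<Longrightarrow> D0 \<inter> {x<..y} = {} \<Longrightarrow> \<bar>f y - f x\<bar> \<le> e"
    "\<And>x y. x \<in> D0 \<Longrightarrow> y \<in> D0 \<Longrightarrow> x < y \<Longrightarrow> \<delta>0 \<le> y - x" by metis
  from cadlag_bounded[OF f t] obtain B where B: "0 < B" "\<And>x. 0 \<le> x \<Longrightarrow> x \<le> t \<Longrightarrow> \<bar>f x\<bar> \<le> B" by blast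
  \<comment> \<open>Number of big increments times their maximal size \<open>2 * B\<close> times the
    coefficient bound; the summand 1 makes it positive.\<close>
  define Q where "Q = (real (card D0) + 1) * (2 * B * K)"
  have Q: "0 < Q" unfolding Q_def using B K by (simp add: add_nonneg_pos)
  \<comment> \<open>The minimum with \<open>e\<close> ensures that an increment above
    \<open>e\<close> is also above \<open>e'\<close>, as \<open>osc_after_big_increment\<close>
    requires at the finer scale.\<close>
  define e' where "e' = min e (\<epsilon> / (2 * Q))"
  have e': "0 < e'" "e' \<le> e" "e' * Q < \<epsilon>"
  proof -
    show "0 < e'" "e' \<le> e" unfolding e'_def using e eps Q by auto
    have "e' * Q \<le> \<epsilon> / (2 * Q) * Q" unfolding e'_def using Q by (intro mult_right_mono) auto
    also have "\<dots> < \<epsilon>" using Q eps by simp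
    finally show "e' * Q < \<epsilon>" .
  qed
  from cadlag_osc_partition[OF f e'(1) t] obtain D \<delta> where D: "finite D" "\<delta> > 0"
    "\<And>x y. 0 \<le> x \<Longrightarrow> x \<le> y \<Longrightarrow> y \<le> t \<Longrightarrow> D \<inter> {x<..y} = {} \<Longrightarrow> \<bar>f y - f x\<bar> \<le> e'"
    "\<And>x y. x \<in> D \<Longrightarrow> y \<in> D \<Longrightarrow> x < y \<Longrightarrow> \<delta> \<le> y - x" by metis
  from cloc[OF D(2)]
  show "\<forall>\<^sub>F n in sequentially. dist (\<Sum>m<N n. (incr f (\<tau> n) m - small_part e (incr f (\<tau> n) m)) *
     (\<Sum>l=Suc m..<N n. c n l m * incr f (\<tau> n) l)) 0 < \<epsilon>"
  proof eventually_elim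
    fix n
    assume loc: "\<forall>l<N n. \<forall>m<l. c n l m \<noteq> 0 \<longrightarrow> \<tau> n (Suc l) - \<tau> n m < \<delta>"
    let ?b = "\<lambda>m. incr f (\<tau> n) m - small_part e (incr f (\<tau> n) m)"
    let ?r = "\<lambda>m. \<Sum>l=Suc m..<N n. c n l m * incr f (\<tau> n) l"
    let ?S = "{m. m < N n \<and> \<bar>f (\<tau> n (Suc m)) - f (\<tau> n m)\<bar> > e}"
    have r: "\<bar>?r m\<bar> \<le> e' * K" if m: "m \<in> ?S" for m
    proof -
      \<comment> \<open>The first index beyond the short window that starts with increment
        \<open>m\<close>, or the end of the partition.\<close>
      define b where "b = (LEAST b. m < b \<and> (b = N n \<or> \<not> \<tau> n (Suc b) - \<tau> n m < \<delta>))"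
      have mN: "m < N n" using m by simp
      have b: "m < b" "b = N n \<or> \<not> \<tau> n (Suc b) - \<tau> n m < \<delta>"
        using LeastI[of "\<lambda>b. m < b \<and> (b = N n \<or> \<not> \<tau> n (Suc b) - \<tau> n m < \<delta>)" "N n"] mN unfolding b_def by auto
      have bN: "b \<le> N n" unfolding b_def using mN by (intro Least_le) simp
      have win: "\<tau> n (Suc l) - \<tau> n m < \<delta>" if "m < l" "l < b" for l
        using not_less_Least[OF that(2)[unfolded b_def]] that by simp
      have after: "c n l m = 0" if "b \<le> l" "l < N n" for l
      proof -
        have "\<tau> n (Suc b) \<le> \<tau> n (Suc l)" using that by (intro is_partition_mono[OF part]) auto
        with b that have "\<not> \<tau> n (Suc l) - \<tau> n m < \<delta>" by auto
        moreover have "m < l" using that b by simp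
        ultimately show ?thesis using loc that(2) by blast
      qed
      have "?r m = (\<Sum>l=Suc m..<b. c n l m * incr f (\<tau> n) l)"
        using after bN by (intro sum.mono_neutral_right) (auto simp: not_less)
      also have "\<dots> = (\<Sum>l=Suc m..<b. c n m l * incr f (\<tau> n) l)"
        using csym[of n m] by simp
      also have "\<bar>\<dots>\<bar> \<le> e' * (\<bar>c n m (N n)\<bar> + (\<Sum>l<N n. \<bar>c n m (Suc l) - c n m l\<bar>))"
      proof (rule abel_bound_window[OF _ _ bN])
        show "Suc m \<le> b" using b by simp
        fix j assume j: "Suc m \<le> j" "j \<le> b"
        have "(\<Sum>l=Suc m..<j. incr f (\<tau> n) l) = f (\<tau> n j) - f (\<tau> n (Suc m))"
          unfolding incr_def using telescope_interval[OF j(1), of "\<lambda>l. f (\<tau> n l)"] .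
        moreover have "\<bar>f (\<tau> n j) - f (\<tau> n (Suc m))\<bar> \<le> e'"
        proof (cases "j = Suc m")
          case True then show ?thesis using e' by simp
        next
          case False
          with j win[of "j - 1"] have "\<tau> n j - \<tau> n m < \<delta>" by simp
          moreover have "\<bar>f (\<tau> n (Suc m)) - f (\<tau> n m)\<bar> > e'" using m e' by simp
          ultimately show ?thesis
            using j bN by (intro osc_after_big_increment[OF part e'(1) D(1,3,4)]) auto
        qed
        ultimately show "\<bar>\<Sum>l=Suc m..<j. incr f (\<tau> n) l\<bar> \<le> e'" by simp
      qed
      also have "\<dots> \<le> e' * K" using cvar[OF mN] e' by (intro mult_left_mono) auto
      finally show ?thesis .
    qed
    have "\<bar>\<Sum>m<N n. ?b m * ?r m\<bar> = \<bar>\<Sum>m\<in>?S. ?b m * ?r m\<bar>"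
      by (intro arg_cong[where f = abs] sum.mono_neutral_right) (auto simp: small_part_def incr_def)
    also have "\<dots> \<le> (\<Sum>m\<in>?S. 2 * B * (e' * K))"
    proof (rule order_trans[OF sum_abs sum_mono])
      fix m assume m: "m \<in> ?S"
      have "?b m = incr f (\<tau> n) m" using m by (simp add: small_part_def incr_def)
      also have "\<bar>\<dots>\<bar> \<le> 2 * B"
        unfolding incr_def using B(2)[of "\<tau> n m"] B(2)[of "\<tau> n (Suc m)"] m
          is_partition_bounds[OF part, of m n] is_partition_bounds[OF part, of "Suc m" n] by auto
      finally show "\<bar>?b m * ?r m\<bar> \<le> 2 * B * (e' * K)"
        unfolding abs_mult using r[OF m] by (intro mult_mono) auto
    qed
    also have "\<dots> = real (card ?S) * (2 * B * (e' * K))" by simp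
    also have "\<dots> \<le> (real (card D0) + 1) * (2 * B * (e' * K))"
    proof (rule mult_right_mono)
      have "card ?S \<le> card D0" using card_big_increments[OF part e D0] .
      then show "real (card ?S) \<le> real (card D0) + 1" by simp
    qed (use B K e' in simp)
    also have "\<dots> = e' * Q" unfolding Q_def by simp
    also have "\<dots> < \<epsilon>" by (rule e')
    finally show "dist (\<Sum>m<N n. ?b m * ?r m) 0 < \<epsilon>" by simp
  qed
qed

end

text \<open>The tightness bound \<open>B\<close> is fixed first and the threshold \<open>e\<close>
  afterwards in terms of it. This order is possible because \<open>B\<close> serves all integrands,
  including those that depend on \<open>e\<close>.\<close>

lemma (in filtered) offdiag_null:
  assumes ad: "adapted F X" and cad: "cadlag_process M X" and tight: "transform_tight M F X \<tau> N"
    and part: "\<And>n. is_partition t (\<tau> n) (N n)" and t: "0 \<le> t" and K: "0 < K"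
    and csym: "\<And>n l m. c n l m = c n m l"
    and cvar: "\<And>n l. l < N n \<Longrightarrow> \<bar>c n l (N n)\<bar> + (\<Sum>m<N n. \<bar>c n l (Suc m) - c n l m\<bar>) \<le> K"
    and cloc: "\<And>\<delta>. 0 < \<delta> \<Longrightarrow> \<forall>\<^sub>F n in sequentially. \<forall>l<N n. \<forall>m<l. c n l m \<noteq> 0 \<longrightarrow> \<tau> n (Suc l) - \<tau> n m < \<delta>"
  shows "conv_in_prob M (\<lambda>n \<omega>. offdiag (c n) (\<lambda>s. X s \<omega>) (\<tau> n) (N n)) (\<lambda>_. 0)"
proof (rule conv_in_probI)
  have cadX: "cadlag (\<lambda>s. X s \<omega>)" if "\<omega> \<in> space M" for \<omega>
    using cad that unfolding cadlag_process_def by blast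
  have incrF: "(\<lambda>\<omega>. incr (\<lambda>s. X s \<omega>) (\<tau> n) m) \<in> borel_measurable (F (\<tau> n l))" if "m < l" "l \<le> N n" for n m l
  proof -
    have [measurable]: "X (\<tau> n (Suc m)) \<in> borel_measurable (F (\<tau> n l))" "X (\<tau> n m) \<in> borel_measurable (F (\<tau> n l))"
      using that is_partition_bounds[OF part, of _ n]
      by (auto intro!: adapted_meas_F[OF ad] is_partition_mono[OF part])
    show ?thesis unfolding incr_def by measurable
  qed
  have incrM: "(\<lambda>\<omega>. incr (\<lambda>s. X s \<omega>) (\<tau> n) m) \<in> borel_measurable M" if "m < N n" for n m
    using measurable_from_subalg[OF subF incrF[OF that order_refl]] .
  show meas: "(\<lambda>\<omega>. offdiag (c n) (\<lambda>s. X s \<omega>) (\<tau> n) (N n)) \<in> borel_measurable M" for n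
    unfolding offdiag_def
    by (intro borel_measurable_sum borel_measurable_times borel_measurable_const incrM) auto
  fix \<epsilon> \<eta> :: real assume eps: "0 < \<epsilon>" and eta: "0 < \<eta>"
  then have eta3: "0 < \<eta> / 3" by simp
  with tight obtain B where B: "0 < B" and tB: "\<forall>\<^sub>F n in sequentially. transform_le M F X (\<tau> n) (N n) B (\<eta> / 3)"
    unfolding transform_tight_def by meson
  \<comment> \<open>The integrand will be at most \<open>q = 3 * e * K\<close>, so that a transform
    bounded by \<open>B\<close> contributes at most \<open>q * B = \<epsilon> / 2\<close>.\<close>
  define q where "q = \<epsilon> / (2 * B)"
  define e where "e = q / (3 * K)"
  have q: "0 < q" and e: "0 < e" and qe: "3 * e * K = q" and qB: "q * B = \<epsilon> / 2"
    unfolding q_def e_def using B K eps by auto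
  define h where "h n l \<omega> = (\<Sum>m<l. c n l m * small_part e (incr (\<lambda>s. X s \<omega>) (\<tau> n) m))" for n l \<omega>
  define R where "R n \<omega> = (\<Sum>m<N n. (incr (\<lambda>s. X s \<omega>) (\<tau> n) m - small_part e (incr (\<lambda>s. X s \<omega>) (\<tau> n) m)) *
     (\<Sum>l=Suc m..<N n. c n l m * incr (\<lambda>s. X s \<omega>) (\<tau> n) l))" for n \<omega>
  \<comment> \<open>The path estimate holds only eventually, and not uniformly over paths.
    Truncation gives a unit predictable integrand on every path, and it differs from the rescaled
    \<open>h\<close> only on the rare event \<open>E n\<close>.\<close>
  define h' where "h' n l \<omega> = (if \<bar>h n l \<omega>\<bar> \<le> q then h n l \<omega> / q else 0)" for n l \<omega>
  have split: "offdiag (c n) (\<lambda>s. X s \<omega>) (\<tau> n) (N n) = (\<Sum>l<N n. h n l \<omega> * incr (\<lambda>s. X s \<omega>) (\<tau> n) l) + R n \<omega>" for n \<omega>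
    unfolding h_def R_def by (rule offdiag_split)
  have hF: "h n l \<in> borel_measurable (F (\<tau> n l))" if "l \<le> N n" for n l
    unfolding h_def using incrF[OF _ that]
    by (intro borel_measurable_sum borel_measurable_times borel_measurable_const
        measurable_compose[OF _ small_part_measurable]) auto
  have hM: "h n l \<in> borel_measurable M" if "l \<le> N n" for n l
    using measurable_from_subalg[OF subF hF[OF that]] .
  have h'F: "h' n l \<in> borel_measurable (F (\<tau> n l))" if "l \<le> N n" for n l
    using hF[OF that] unfolding h'_def by measurable
  have h'1: "\<bar>h' n l \<omega>\<bar> \<le> 1" for n l \<omega> using q unfolding h'_def by simp
  define E where "E n = {\<omega>\<in>space M. \<exists>l\<in>{..<N n}. \<bar>h n l \<omega>\<bar> > q}" for n
  have E: "E n \<in> events" for n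
  proof -
    have "E n = (\<Union>l\<in>{..<N n}. {\<omega>\<in>space M. \<bar>h n l \<omega>\<bar> > q})" unfolding E_def by auto
    moreover have "{\<omega>\<in>space M. \<bar>h n l \<omega>\<bar> > q} \<in> events" if "l \<in> {..<N n}" for l
    proof -
      have [measurable]: "h n l \<in> borel_measurable M" using hM[of l n] that by simp
      show ?thesis by measurable
    qed
    ultimately show ?thesis by auto
  qed
  have 1: "\<forall>\<^sub>F n in sequentially. prob (E n) \<le> \<eta> / 3"
  proof (rule prob_eventually_not_null[OF E _ eta3], rule AE_I2)
    fix \<omega> assume "\<omega> \<in> space M"
    then have "\<forall>\<^sub>F n in sequentially. \<forall>l<N n.
        \<bar>\<Sum>m<l. c n l m * small_part e (incr (\<lambda>s. X s \<omega>) (\<tau> n) m)\<bar> \<le> 3 * e * K"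
      by (intro offdiag_small_path[OF part t csym cvar cloc cadX e])
    then show "\<forall>\<^sub>F n in sequentially. \<omega> \<notin> E n"
      by eventually_elim (auto simp: E_def h_def qe not_less)
  qed
  have R: "conv_in_prob M R (\<lambda>_. 0)"
  proof (rule conv_in_prob_AE[OF _ _ AE_I2])
    show "R n \<in> borel_measurable M" for n
      unfolding R_def
    proof (rule borel_measurable_sum)
      fix m assume m: "m \<in> {..<N n}"
      have [measurable]: "(\<lambda>\<omega>. incr (\<lambda>s. X s \<omega>) (\<tau> n) m) \<in> borel_measurable M"
        using incrM[of m n] m by simp
      have [measurable]: "(\<lambda>\<omega>. \<Sum>l=Suc m..<N n. c n l m * incr (\<lambda>s. X s \<omega>) (\<tau> n) l) \<in> borel_measurable M"
        by (intro borel_measurable_sum borel_measurable_times borel_measurable_const incrM) simp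
      show "(\<lambda>\<omega>. (incr (\<lambda>s. X s \<omega>) (\<tau> n) m - small_part e (incr (\<lambda>s. X s \<omega>) (\<tau> n) m)) *
          (\<Sum>l=Suc m..<N n. c n l m * incr (\<lambda>s. X s \<omega>) (\<tau> n) l)) \<in> borel_measurable M"
        by measurable
    qed
    show "(\<lambda>n. R n \<omega>) \<longlonglongrightarrow> 0" if "\<omega> \<in> space M" for \<omega>
      unfolding R_def using that by (intro offdiag_big_path[OF part t csym cvar cloc cadX e K])
  qed simp
  have Rm: "R n \<in> borel_measurable M" for n using conv_in_prob_measurable[OF R] by blast
  have "0 < \<epsilon> / 2" using eps by simp
  from conv_in_probD[OF R this eta3] 1 tB
  show "\<forall>\<^sub>F n in sequentially. prob {\<omega>\<in>space M. \<bar>offdiag (c n) (\<lambda>s. X s \<omega>) (\<tau> n) (N n) - 0\<bar> > \<epsilon>} \<le> \<eta>"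
  proof eventually_elim
    case (elim n)
    let ?T = "\<lambda>\<omega>. transform (h' n) X (\<tau> n) (N n) \<omega>"
    have T: "prob {\<omega>\<in>space M. \<bar>?T \<omega>\<bar> > B} \<le> \<eta> / 3"
      using elim(3) h'F h'1 by auto
    have [measurable]: "?T \<in> borel_measurable M"
      by (rule transform_measurable[OF ad part]) (use h'F in auto)
    note [measurable] = Rm E
    have TE: "prob {\<omega>\<in>space M. \<omega> \<in> E n \<or> \<bar>?T \<omega>\<bar> > B} \<le> \<eta> / 3 + \<eta> / 3"
    proof (rule prob_le_add[OF _ _ _ _ T])
      have "{\<omega>\<in>space M. \<omega> \<in> E n} = E n" unfolding E_def by auto
      then show "prob {\<omega>\<in>space M. \<omega> \<in> E n} \<le> \<eta> / 3" using elim(2) by simp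
    qed (auto)
    have "prob {\<omega>\<in>space M. \<bar>offdiag (c n) (\<lambda>s. X s \<omega>) (\<tau> n) (N n) - 0\<bar> > \<epsilon>} \<le> \<eta> / 3 + (\<eta> / 3 + \<eta> / 3)"
    proof (rule prob_le_add[OF _ _ _ elim(1) TE])
      fix \<omega> assume w: "\<omega> \<in> space M" and gt: "\<bar>offdiag (c n) (\<lambda>s. X s \<omega>) (\<tau> n) (N n) - 0\<bar> > \<epsilon>"
      show "\<epsilon> / 2 < \<bar>R n \<omega> - 0\<bar> \<or> (\<omega> \<in> E n \<or> \<bar>?T \<omega>\<bar> > B)"
      proof (rule ccontr)
        assume neg: "\<not> ?thesis"
        then have "\<omega> \<notin> E n" by blast
        then have "\<bar>h n l \<omega>\<bar> \<le> q" if "l < N n" for l using w that unfolding E_def by (auto simp: not_less)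
        then have "(\<Sum>l<N n. h n l \<omega> * incr (\<lambda>s. X s \<omega>) (\<tau> n) l) = q * ?T \<omega>"
          unfolding sum_distrib_left using q by (intro sum.cong) (auto simp: h'_def incr_def)
        also have "\<bar>\<dots>\<bar> \<le> q * B" unfolding abs_mult using q neg by (intro mult_mono) auto
        finally show False using gt neg unfolding split qB by linarith
      qed
    qed (measurable)
    then show ?case by simp
  qed
qed simp

section \<open>Quadratic variation\<close>

lemma sum_blocks:
  fixes x :: "nat \<Rightarrow> real"
  assumes "\<And>i. i < N \<Longrightarrow> idx i \<le> idx (Suc i)"
  shows "(\<Sum>i<N. \<Sum>m=idx i..<idx (Suc i). x m) = (\<Sum>m=idx 0..<idx N. x m) \<and> idx 0 \<le> idx N"
  using assms
proof (induction N)
  case (Suc N)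
  then have "(\<Sum>i<N. \<Sum>m=idx i..<idx (Suc i). x m) = (\<Sum>m=idx 0..<idx N. x m)" "idx 0 \<le> idx N"
    "idx N \<le> idx (Suc N)" by auto
  then show ?case by (simp add: sum.atLeastLessThan_concat)
qed simp

lemma square_of_sum:
  fixes x :: "nat \<Rightarrow> real"
  assumes "a \<le> b"
  shows "(\<Sum>m=a..<b. x m)\<^sup>2 = (\<Sum>m=a..<b. (x m)\<^sup>2) + 2 * (\<Sum>l=a..<b. \<Sum>m=a..<l. x m * x l)"
  using assms
proof (induction b rule: dec_induct)
  case (step n)
  then show ?case by (simp add: power2_sum algebra_simps sum_distrib_left sum_distrib_right)
qed simp

lemma indicator_variation:
  "(\<Sum>m<n. \<bar>of_bool (a \<le> Suc m \<and> Suc m < b) - of_bool (a \<le> m \<and> m < (b::nat))\<bar> :: real) \<le> 2"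
proof -
  have one: "(\<Sum>m<n. of_bool (Suc m = k) :: real) \<le> 1" for k
  proof -
    have "(\<Sum>m<n. of_bool (Suc m = k) :: real) = real (card {m. m < n \<and> Suc m = k})"
      by (simp add: Int_def)
    also have "card {m. m < n \<and> Suc m = k} \<le> card {k - 1}" by (intro card_mono) auto
    finally show ?thesis by simp
  qed
  have "(\<Sum>m<n. \<bar>of_bool (a \<le> Suc m \<and> Suc m < b) - of_bool (a \<le> m \<and> m < b)\<bar> :: real)
      \<le> (\<Sum>m<n. of_bool (Suc m = a) + of_bool (Suc m = b))"
    by (intro sum_mono) (auto split: if_splits)
  also have "\<dots> \<le> 1 + 1" unfolding sum.distrib by (intro add_mono one)
  finally show ?thesis by simp
qed

text \<open>Cross terms of the fine increments that survive when coarse increments are squared. The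
  use of \<open>min\<close> and \<open>max\<close> makes the coefficients symmetric.\<close>

definition same_block :: "(nat \<Rightarrow> nat) \<Rightarrow> nat \<Rightarrow> nat \<Rightarrow> nat \<Rightarrow> real" where
  "same_block idx N l m = of_bool (\<exists>i<N. idx i \<le> min l m \<and> max l m < idx (Suc i))"

lemma same_block_sym: "same_block idx N l m = same_block idx N m l"
  unfolding same_block_def by (simp add: min.commute max.commute)

context
  fixes idx :: "nat \<Rightarrow> nat" and N :: nat
  assumes idx_step: "\<And>i. i < N \<Longrightarrow> idx i \<le> idx (Suc i)"
begin

lemma idx_mono: "i \<le> j \<Longrightarrow> j \<le> N \<Longrightarrow> idx i \<le> idx j"
proof (induction j rule: dec_induct)
  case (step n)
  with idx_step[of n] show ?case by simp
qed simp

lemma same_block_in_block: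
  assumes i: "i < N" and l: "idx i \<le> l" "l < idx (Suc i)"
  shows "same_block idx N l m = of_bool (idx i \<le> m \<and> m < idx (Suc i))"
proof -
  \<comment> \<open>Blocks may be empty, since the coarse partition may repeat points, but distinct
    blocks never share an index.\<close>
  have uniq: "j = i" if "j < N" "idx j \<le> l" "l < idx (Suc j)" for j
    using idx_mono[of "Suc j" i] idx_mono[of "Suc i" j] that i l by (cases j i rule: linorder_cases) auto
  show ?thesis
  proof (cases "idx i \<le> m \<and> m < idx (Suc i)")
    case True
    with i l show ?thesis unfolding same_block_def by auto
  next
    case False
    then have eq1: "(idx i \<le> m \<and> m < idx (Suc i)) = False" by blast
    have "\<not> (\<exists>j<N. idx j \<le> min l m \<and> max l m < idx (Suc j))"
    proof
      assume "\<exists>j<N. idx j \<le> min l m \<and> max l m < idx (Suc j)"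
      then obtain j where j: "j < N" "idx j \<le> min l m" "max l m < idx (Suc j)" by blast
      with uniq[of j] have "j = i" by simp
      with j False show False by simp
    qed
    then have eq2: "(\<exists>j<N. idx j \<le> min l m \<and> max l m < idx (Suc j)) = False" by blast
    show ?thesis unfolding same_block_def eq1 eq2 ..
  qed
qed

text \<open>The row of \<open>l\<close> is the indicator of the block of \<open>l\<close>: it is at
  most 1 and changes value at most twice.\<close>

lemma same_block_variation:
  assumes "idx 0 = 0" "l < idx N"
  shows "\<bar>same_block idx N l n\<bar> + (\<Sum>m<n. \<bar>same_block idx N l (Suc m) - same_block idx N l m\<bar>) \<le> 3"
proof -
  have "\<exists>i<N. idx i \<le> l \<and> l < idx (Suc i)"
  proof (rule ccontr)
    assume neg: "\<not> ?thesis"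
    have "i \<le> N \<Longrightarrow> idx i \<le> l" for i
    proof (induction i)
      case (Suc i)
      with neg show ?case by (metis Suc_le_lessD less_imp_le not_le)
    qed (simp add: assms)
    with assms show False by (meson not_le order_refl)
  qed
  then obtain i where i: "i < N" "idx i \<le> l" "l < idx (Suc i)" by blast
  have "(\<Sum>m<n. \<bar>same_block idx N l (Suc m) - same_block idx N l m\<bar>) \<le> 2"
    unfolding same_block_in_block[OF i] by (rule indicator_variation)
  moreover have "\<bar>same_block idx N l n\<bar> \<le> 1" unfolding same_block_def by simp
  ultimately show ?thesis by linarith
qed

text \<open>Each coarse increment is the sum of the fine ones in its block, and squaring it leaves
  their squares plus twice the cross terms of that block.\<close>

lemma coarse_squares:
  assumes idx0: "idx 0 = 0" and coarse: "\<And>i. i \<le> N \<Longrightarrow> \<tau> i = \<rho> (idx i)"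
  shows "(\<Sum>i<N. (incr f \<tau> i)\<^sup>2) = (\<Sum>m<idx N. (incr f \<rho> m)\<^sup>2) + 2 * offdiag (same_block idx N) f \<rho> (idx N)"
proof -
  let ?x = "incr f \<rho>"
  have b: "(incr f \<tau> i)\<^sup>2 = (\<Sum>m=idx i..<idx (Suc i). (?x m)\<^sup>2)
      + 2 * (\<Sum>l=idx i..<idx (Suc i). \<Sum>m<l. same_block idx N l m * ?x m * ?x l)" if i: "i < N" for i
  proof -
    have "incr f \<tau> i = (\<Sum>m=idx i..<idx (Suc i). ?x m)"
      unfolding incr_def using telescope_interval[OF idx_step[OF i], of "\<lambda>m. f (\<rho> m)"] i by (simp add: coarse)
    then have "(incr f \<tau> i)\<^sup>2 = (\<Sum>m=idx i..<idx (Suc i). (?x m)\<^sup>2)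
        + 2 * (\<Sum>l=idx i..<idx (Suc i). \<Sum>m=idx i..<l. ?x m * ?x l)"
      using square_of_sum[OF idx_step[OF i], of ?x] by simp
    also have "(\<Sum>l=idx i..<idx (Suc i). \<Sum>m=idx i..<l. ?x m * ?x l)
        = (\<Sum>l=idx i..<idx (Suc i). \<Sum>m<l. same_block idx N l m * ?x m * ?x l)"
    proof (rule sum.cong[OF refl])
      fix l assume l: "l \<in> {idx i..<idx (Suc i)}"
      show "(\<Sum>m=idx i..<l. ?x m * ?x l) = (\<Sum>m<l. same_block idx N l m * ?x m * ?x l)"
        using l by (intro sum.mono_neutral_cong_left) (auto simp: same_block_in_block[OF i])
    qed
    finally show ?thesis .
  qed
  have "(\<Sum>i<N. (incr f \<tau> i)\<^sup>2) = (\<Sum>i<N. \<Sum>m=idx i..<idx (Suc i). (?x m)\<^sup>2)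
      + 2 * (\<Sum>i<N. \<Sum>l=idx i..<idx (Suc i). \<Sum>m<l. same_block idx N l m * ?x m * ?x l)"
    using b by (simp add: sum.distrib sum_distrib_left)
  then show ?thesis
    using sum_blocks[where idx = idx and N = N, OF idx_step]
    unfolding offdiag_def by (simp add: idx0 atLeast0LessThan)
qed

end

text \<open>Sorting a finite set of points merges repetitions, so \<open>idx\<close> is only weakly
  increasing. The set \<open>S\<close> will be the union of the points of two partitions.\<close>

lemma partition_refines:
  assumes S: "finite S" "S \<subseteq> {0..t}" and part: "is_partition t \<tau> N" and sub: "\<tau> ` {..N} \<subseteq> S"
  defines "xs \<equiv> sorted_list_of_set S"
  shows "is_partition t ((!) xs) (length xs - 1)"
    "\<exists>idx. idx 0 = 0 \<and> idx N = length xs - 1 \<and> (\<forall>i<N. idx i \<le> idx (Suc i)) \<and> (\<forall>i\<le>N. \<tau> i = xs ! idx i)"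
proof -
  have set: "set xs = S" and sorted: "sorted_wrt (<) xs" unfolding xs_def using S by auto
  have "\<tau> 0 \<in> S" "\<tau> N \<in> S" using sub by auto
  then have end0: "0 \<in> S" "t \<in> S" using part unfolding is_partition_def by auto
  then have len: "length xs > 0" using set by (metis length_pos_if_in_set)
  have less: "xs ! i < xs ! j" if "i < j" "j < length xs" for i j
    using sorted_wrt_nth_less[OF sorted that] .
  have "\<exists>idx. \<forall>i\<le>N. idx i < length xs \<and> xs ! idx i = \<tau> i"
  proof -
    have "\<exists>j. i \<le> N \<longrightarrow> j < length xs \<and> xs ! j = \<tau> i" for i
      using sub set by (metis atMost_iff image_subset_iff in_set_conv_nth)
    then show ?thesis by metis
  qed
  then obtain idx where idx: "\<And>i. i \<le> N \<Longrightarrow> idx i < length xs \<and> xs ! idx i = \<tau> i" by blast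
  have in_S: "xs ! j \<in> {0..t}" if "j < length xs" for j using that set S(2) nth_mem by blast
  have i0: "idx 0 = 0"
  proof (rule ccontr)
    assume "idx 0 \<noteq> 0"
    then have "xs ! 0 < \<tau> 0" using less[of 0 "idx 0"] idx[of 0] by auto
    then show False using in_S[OF len] part unfolding is_partition_def by auto
  qed
  have iN: "idx N = length xs - 1"
  proof (rule ccontr)
    assume "idx N \<noteq> length xs - 1"
    then have "\<tau> N < xs ! (length xs - 1)" using less[of "idx N" "length xs - 1"] idx[of N] len by auto
    then show False using in_S[of "length xs - 1"] len part unfolding is_partition_def by auto
  qed
  have mono: "idx i \<le> idx (Suc i)" if "i < N" for i
  proof (rule ccontr)
    assume "\<not> ?thesis"
    then have "\<tau> (Suc i) < \<tau> i" using less[of "idx (Suc i)" "idx i"] idx[of i] idx[of "Suc i"] that by auto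
    then show False using part that unfolding is_partition_def by (meson not_le)
  qed
  show "\<exists>idx. idx 0 = 0 \<and> idx N = length xs - 1 \<and> (\<forall>i<N. idx i \<le> idx (Suc i)) \<and> (\<forall>i\<le>N. \<tau> i = xs ! idx i)"
    using i0 iN mono idx by (intro exI[of _ idx]) auto
  show "is_partition t ((!) xs) (length xs - 1)"
    unfolding is_partition_def
    using i0 iN idx[of 0] idx[of N] part less unfolding is_partition_def by (auto intro: less_imp_le)
qed

lemma partition_seq_part: "partition_seq t \<tau> N \<Longrightarrow> is_partition t (\<tau> n) (N n)"
  unfolding partition_seq_def is_partition_def by blast

section \<open>Comparison of partitions and existence of the quadratic variation\<close>

context filtered
begin

text \<open>The difference is twice an off-diagonal form whose coefficients live inside the coarse
  blocks, so the mesh of the coarse partition controls its locality.\<close>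

lemma refinement_null:
  assumes X: "semimartingale M F X" and t: "0 \<le> t"
    and seq: "partition_seq t \<tau> N" and fine: "\<And>n. is_partition t (\<rho> n) (R n)"
    and idx: "\<And>n. idx n 0 = 0 \<and> idx n (N n) = R n \<and> (\<forall>i<N n. idx n i \<le> idx n (Suc i)) \<and> (\<forall>i\<le>N n. \<tau> n i = \<rho> n (idx n i))"
  shows "conv_in_prob M (\<lambda>n \<omega>. (\<Sum>i<N n. (incr (\<lambda>s. X s \<omega>) (\<tau> n) i)\<^sup>2) - (\<Sum>i<R n. (incr (\<lambda>s. X s \<omega>) (\<rho> n) i)\<^sup>2)) (\<lambda>_. 0)"
proof -
  have ad: "adapted F X" and cad: "cadlag_process M X" using X unfolding semimartingale_def by auto
  have step: "i < N n \<Longrightarrow> idx n i \<le> idx n (Suc i)" for n i using idx by blast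
  have "conv_in_prob M (\<lambda>n \<omega>. offdiag (same_block (idx n) (N n)) (\<lambda>s. X s \<omega>) (\<rho> n) (R n)) (\<lambda>_. 0)"
  proof (rule offdiag_null[OF ad cad transform_tight_semimartingale[OF X fine t] fine t, where K = 3])
    show "\<bar>same_block (idx n) (N n) l (R n)\<bar> + (\<Sum>m<R n. \<bar>same_block (idx n) (N n) l (Suc m) - same_block (idx n) (N n) l m\<bar>) \<le> 3"
      if "l < R n" for n l
      using that idx[of n] by (intro same_block_variation[where idx = "idx n" and N = "N n", OF step]) auto
    fix \<delta> :: real assume "0 < \<delta>"
    with seq have "\<forall>\<^sub>F n in sequentially. \<forall>i<N n. \<tau> n (Suc i) - \<tau> n i < \<delta>"
      unfolding partition_seq_def by blast
    then show "\<forall>\<^sub>F n in sequentially. \<forall>l<R n. \<forall>m<l. same_block (idx n) (N n) l m \<noteq> 0 \<longrightarrow> \<rho> n (Suc l) - \<rho> n m < \<delta>"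
    proof (eventually_elim, intro allI impI)
      fix n l m
      assume mesh: "\<forall>i<N n. \<tau> n (Suc i) - \<tau> n i < \<delta>" and lm: "l < R n" "m < l"
        and "same_block (idx n) (N n) l m \<noteq> 0"
      then obtain i where i: "i < N n" "idx n i \<le> m" "l < idx n (Suc i)"
        unfolding same_block_def by (auto simp: min_def max_def split: if_splits)
      have "idx n (Suc i) \<le> R n" using idx_mono[where idx = "idx n" and N = "N n", OF step, of "Suc i" "N n"] idx[of n] i by simp
      then have "\<rho> n (Suc l) \<le> \<tau> n (Suc i)"
        using is_partition_mono[OF fine, of "Suc l" "idx n (Suc i)" n] i idx[of n] by simp
      moreover have "\<tau> n i \<le> \<rho> n m"
        using is_partition_mono[OF fine, of "idx n i" m n] i idx[of n] lm by simp
      ultimately show "\<rho> n (Suc l) - \<rho> n m < \<delta>" using mesh i(1) by fastforce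
    qed
  qed (use same_block_sym in auto)
  from conv_in_prob_mult_seq[OF this tendsto_const[of 2]]
  have "conv_in_prob M (\<lambda>n \<omega>. 2 * offdiag (same_block (idx n) (N n)) (\<lambda>s. X s \<omega>) (\<rho> n) (R n)) (\<lambda>_. 0)" by simp
  moreover have "(\<Sum>i<N n. (incr f (\<tau> n) i)\<^sup>2) - (\<Sum>i<R n. (incr f (\<rho> n) i)\<^sup>2)
      = 2 * offdiag (same_block (idx n) (N n)) f (\<rho> n) (R n)" for n f
    using coarse_squares[where idx = "idx n" and N = "N n", OF step, of "\<tau> n" "\<rho> n" f] idx[of n] by simp
  ultimately show ?thesis by simp
qed

text \<open>Both sums are compared with the one over the common refinement.\<close>

lemma partition_squares_diff_null:
  assumes X: "semimartingale M F X" and t: "0 \<le> t"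
    and seq: "partition_seq t \<tau> N" and seq': "partition_seq t \<tau>' N'"
  shows "conv_in_prob M (\<lambda>n \<omega>. (\<Sum>i<N n. (incr (\<lambda>s. X s \<omega>) (\<tau> n) i)\<^sup>2) - (\<Sum>i<N' n. (incr (\<lambda>s. X s \<omega>) (\<tau>' n) i)\<^sup>2)) (\<lambda>_. 0)"
proof -
  define S where "S n = \<tau> n ` {..N n} \<union> \<tau>' n ` {..N' n}" for n
  define \<rho> where "\<rho> n = (!) (sorted_list_of_set (S n))" for n
  define R where "R n = length (sorted_list_of_set (S n)) - 1" for n
  have S: "finite (S n)" "S n \<subseteq> {0..t}" "\<tau> n ` {..N n} \<subseteq> S n" "\<tau>' n ` {..N' n} \<subseteq> S n" for n
    unfolding S_def using is_partition_bounds[OF partition_seq_part[OF seq]]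
      is_partition_bounds[OF partition_seq_part[OF seq']] by auto
  note r = partition_refines[OF S(1,2) partition_seq_part[OF seq] S(3), folded \<rho>_def R_def]
  note r' = partition_refines[OF S(1,2) partition_seq_part[OF seq'] S(4), folded \<rho>_def R_def]
  from r(2) obtain idx where idx: "\<And>n. idx n 0 = 0 \<and> idx n (N n) = R n \<and> (\<forall>i<N n. idx n i \<le> idx n (Suc i)) \<and> (\<forall>i\<le>N n. \<tau> n i = \<rho> n (idx n i))"
    by metis
  from r'(2) obtain idx' where idx': "\<And>n. idx' n 0 = 0 \<and> idx' n (N' n) = R n \<and> (\<forall>i<N' n. idx' n i \<le> idx' n (Suc i)) \<and> (\<forall>i\<le>N' n. \<tau>' n i = \<rho> n (idx' n i))"
    by metis
  from conv_in_prob_diff[OF refinement_null[OF X t seq r(1) idx] refinement_null[OF X t seq' r(1) idx']]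
  show ?thesis by simp
qed

text \<open>The sums over uniform partitions are Cauchy in probability: otherwise two sequences of
  ever finer partitions would have sums that stay apart, against the comparison of arbitrary
  partition sequences. The same comparison identifies the limit along any other sequence.\<close>

theorem quadratic_variation_exists:
  assumes X: "semimartingale M F X" and t: "0 \<le> t"
  shows "is_quadratic_variation M X t (quadratic_variation M X t)"
proof -
  define \<pi> where "\<pi> n i = t * (real i / real (Suc n))" for n i :: nat
  \<comment> \<open>Index sequences \<open>a\<close> that merely dominate \<open>n\<close> are
    allowed, because the Cauchy argument selects indices without any monotonicity.\<close>
  have base: "partition_seq t (\<lambda>n. \<pi> (a n)) (\<lambda>n. Suc (a n))" if a: "\<And>n. n \<le> a n" for a
    unfolding partition_seq_def
  proof (intro conjI allI impI)
    show "\<pi> (a n) 0 = 0" "\<pi> (a n) (Suc (a n)) = t" for n by (simp_all add: \<pi>_def del: of_nat_Suc)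
    show "\<pi> (a n) i \<le> \<pi> (a n) (Suc i)" for n i
      unfolding \<pi>_def using t by (intro mult_left_mono divide_right_mono) auto
    fix \<epsilon> :: real assume e: "0 < \<epsilon>"
    have "(\<lambda>n. t * (1 / real (Suc n))) \<longlonglongrightarrow> t * 0" by (intro tendsto_intros LIMSEQ_Suc[OF lim_1_over_n])
    then have "\<forall>\<^sub>F n in sequentially. t * (1 / real (Suc n)) < \<epsilon>" using e by (intro order_tendstoD) auto
    then show "\<forall>\<^sub>F n in sequentially. \<forall>i<Suc (a n). \<pi> (a n) (Suc i) - \<pi> (a n) i < \<epsilon>"
    proof (eventually_elim, intro allI impI)
      fix n i assume *: "t * (1 / real (Suc n)) < \<epsilon>"
      have "\<pi> (a n) (Suc i) - \<pi> (a n) i = t * (1 / real (Suc (a n)))"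
        unfolding \<pi>_def by (simp add: right_diff_distrib[symmetric] diff_divide_distrib[symmetric] )
      also have "\<dots> \<le> t * (1 / real (Suc n))" using a[of n] t by (intro mult_left_mono divide_left_mono) auto
      finally show "\<pi> (a n) (Suc i) - \<pi> (a n) i < \<epsilon>" using * by linarith
    qed
  qed
  define QS where "QS n \<omega> = (\<Sum>i<Suc n. (incr (\<lambda>s. X s \<omega>) (\<pi> n) i)\<^sup>2)" for n \<omega>
  have diff: "conv_in_prob M (\<lambda>n \<omega>. QS (a n) \<omega> - QS (b n) \<omega>) (\<lambda>_. 0)"
    if "\<And>n. n \<le> a n" "\<And>n. n \<le> b n" for a b
    unfolding QS_def by (rule partition_squares_diff_null[OF X t base[OF that(1)] base[OF that(2)]])
  have ad: "adapted F X" using X unfolding semimartingale_def by auto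
  have meas: "(\<lambda>\<omega>. \<Sum>i<N. (incr (\<lambda>s. X s \<omega>) \<tau> i)\<^sup>2) \<in> borel_measurable M" if "is_partition t \<tau> N" for \<tau> N
  proof (rule borel_measurable_sum)
    fix i assume "i \<in> {..<N}"
    then have [measurable]: "X (\<tau> (Suc i)) \<in> borel_measurable M" "X (\<tau> i) \<in> borel_measurable M"
      using adapted_part_meas[OF ad that] by simp_all
    show "(\<lambda>\<omega>. (incr (\<lambda>s. X s \<omega>) \<tau> i)\<^sup>2) \<in> borel_measurable M" unfolding incr_def by measurable
  qed
  have QSm: "QS n \<in> borel_measurable M" for n
    unfolding QS_def using meas[OF partition_seq_part[OF base[of "\<lambda>n. n"]]] by simp
  have cauchy: "\<exists>N. \<forall>m\<ge>N. \<forall>n\<ge>N. prob {\<omega>\<in>space M. \<bar>QS m \<omega> - QS n \<omega>\<bar> > \<epsilon>} \<le> \<delta>"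
    if "0 < \<epsilon>" "0 < \<delta>" for \<epsilon> \<delta>
  proof (rule ccontr)
    assume "\<not> ?thesis"
    then have "\<forall>N. \<exists>m n. m \<ge> N \<and> n \<ge> N \<and> prob {\<omega>\<in>space M. \<bar>QS m \<omega> - QS n \<omega>\<bar> > \<epsilon>} > \<delta>"
      by (auto simp: not_le)
    then obtain a b where ab: "\<And>N. N \<le> a N" "\<And>N. N \<le> b N"
      "\<And>N. prob {\<omega>\<in>space M. \<bar>QS (a N) \<omega> - QS (b N) \<omega>\<bar> > \<epsilon>} > \<delta>" by metis
    from conv_in_probD[OF diff[OF ab(1,2)] that] have "\<forall>\<^sub>F N in sequentially. False"
      by eventually_elim (use ab(3) in \<open>auto simp: not_le[symmetric]\<close>)
    then show False by simp
  qed
  from conv_in_prob_complete[OF QSm cauchy] obtain Q where Q: "conv_in_prob M QS Q" by blast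
  have "is_quadratic_variation M X t Q"
    unfolding is_quadratic_variation_def
  proof (intro allI impI)
    fix \<tau> N assume seq: "partition_seq t \<tau> N"
    from conv_in_prob_add[OF partition_squares_diff_null[OF X t seq base[of "\<lambda>n. n", simplified]] Q]
    show "conv_in_prob M (\<lambda>n \<omega>. \<Sum>i<N n. (X (\<tau> n (Suc i)) \<omega> - X (\<tau> n i) \<omega>)\<^sup>2) Q"
      unfolding QS_def incr_def by simp
  qed
  then show ?thesis unfolding quadratic_variation_def
    by (rule someI[of "is_quadratic_variation M X t" Q])
qed

end

section \<open>Weight functions\<close>

text \<open>On each piece the derivative differs from its value at the midpoint by at most the
  common Lipschitz constant, and there are finitely many midpoints. A bounded derivative off a
  finite set, together with continuity, gives a Lipschitz bound across the breakpoints as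
  well.\<close>

lemma weight_function_Lipschitz:
  assumes g: "weight_function g"
  obtains C where "0 < C" "\<And>x y. \<bar>g x - g y\<bar> \<le> C * \<bar>x - y\<bar>"
proof -
  from g obtain D C0 where cont: "continuous_on {0..1} g" and D: "finite D" "{0, 1} \<subseteq> D"
    and C1: "g C1_differentiable_on ({0..1} - D)"
    and lip: "\<And>a b. {a<..<b} \<subseteq> {0..1} - D \<Longrightarrow> C0-lipschitz_on {a<..<b} (deriv g)"
    and g01: "g 0 = 0" "g 1 = 0" and out: "\<And>s. s \<notin> {0..1} \<Longrightarrow> g s = 0"
    unfolding weight_function_def by auto
  define B where "B = Max ((\<lambda>(a, b). \<bar>deriv g ((a + b) / 2)\<bar>) ` (D \<times> D)) + \<bar>C0\<bar>"
  have fin: "finite ((\<lambda>(a, b). \<bar>deriv g ((a + b) / 2)\<bar>) ` (D \<times> D))" using D by simp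
  have bound: "\<bar>deriv g z\<bar> \<le> B" if z: "z \<in> {0..1} - D" for z
  proof -
    have z01: "0 < z" "z < 1"
    proof -
      have "z \<noteq> 0" "z \<noteq> 1" using z D by auto
      with z show "0 < z" "z < 1" by auto
    qed
    let ?L = "{d \<in> D. d < z}" and ?R = "{d \<in> D. z < d}"
    have L: "finite ?L" "?L \<noteq> {}" and R: "finite ?R" "?R \<noteq> {}" using D z01 by auto
    define a where "a = Max ?L"
    define b where "b = Min ?R"
    have a: "a \<in> D" "a < z" and b: "b \<in> D" "z < b"
      using Max_in[OF L] Min_in[OF R] unfolding a_def b_def by auto
    have a0: "0 \<le> a" unfolding a_def using D z01 by (intro Max_ge[OF L(1)]) auto
    have b1: "b \<le> 1" unfolding b_def using D z01 by (intro Min_le[OF R(1)]) auto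
    have sub: "{a<..<b} \<subseteq> {0..1} - D"
    proof
      fix x assume x: "x \<in> {a<..<b}"
      have "x \<notin> D"
      proof
        assume xD: "x \<in> D"
        have "x \<noteq> z" using z xD by auto
        then consider "x < z" | "z < x" by linarith
        then show False
        proof cases
          case 1
          then have "x \<le> a" unfolding a_def using xD by (intro Max_ge[OF L(1)]) auto
          with x show False by simp
        next
          case 2
          then have "b \<le> x" unfolding b_def using xD by (intro Min_le[OF R(1)]) auto
          with x show False by simp
        qed
      qed
      with x a0 b1 show "x \<in> {0..1} - D" by simp
    qed
    let ?m = "(a + b) / 2"
    have m: "?m \<in> {a<..<b}" and zab: "z \<in> {a<..<b}" using a b by auto
    have "dist (deriv g z) (deriv g ?m) \<le> C0 * dist z ?m" using lipschitz_onD[OF lip[OF sub] zab m] .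
    also have "\<dots> \<le> \<bar>C0\<bar> * 1"
    proof (rule mult_mono)
      have "a < ?m" "?m < b" using m by auto
      with zab a0 b1 show "dist z ?m \<le> 1" unfolding dist_real_def greaterThanLessThan_iff by arith
    qed auto
    finally have "\<bar>deriv g z\<bar> \<le> \<bar>deriv g ?m\<bar> + \<bar>C0\<bar>" unfolding dist_real_def by linarith
    moreover have "\<bar>deriv g ?m\<bar> \<le> Max ((\<lambda>(a, b). \<bar>deriv g ((a + b) / 2)\<bar>) ` (D \<times> D))"
      using a b by (intro Max_ge[OF fin]) force
    ultimately show ?thesis unfolding B_def by linarith
  qed
  have B0: "0 \<le> B"
  proof -
    have "\<bar>deriv g ((0 + 0) / 2)\<bar> \<le> Max ((\<lambda>(a, b). \<bar>deriv g ((a + b) / 2)\<bar>) ` (D \<times> D))"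
      using D by (intro Max_ge[OF fin]) force
    then show ?thesis unfolding B_def by linarith
  qed
  have deriv: "(g has_vector_derivative deriv g x) (at x)" if x: "x \<in> {0..1} - D" for x
  proof -
    from C1 x obtain g' where "(g has_vector_derivative g' x) (at x)"
      unfolding C1_differentiable_on_def by blast
    then have "(g has_field_derivative g' x) (at x)" by (simp add: has_real_derivative_iff_has_vector_derivative)
    then have "(g has_field_derivative deriv g x) (at x)" by (metis DERIV_imp_deriv)
    then show ?thesis by (simp add: has_real_derivative_iff_has_vector_derivative)
  qed
  have inner: "\<bar>g y - g x\<bar> \<le> B * (y - x)" if xy: "0 \<le> x" "x \<le> y" "y \<le> 1" for x y
  proof -
    have "(deriv g has_integral g y - g x) {x..y}"
    proof (rule fundamental_theorem_of_calculus_interior_strong[OF D(1) xy(2)])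
      show "(g has_vector_derivative deriv g z) (at z)" if "z \<in> {x<..<y} - D" for z
        using that xy by (intro deriv) auto
      show "continuous_on {x..y} g" using cont xy by (rule_tac continuous_on_subset) auto
    qed
    from has_integral_bound_real[OF B0 D(1) this] bound xy
    have "norm (g y - g x) \<le> B * measure lborel {x..y}" by auto
    then show ?thesis using xy by simp
  qed
  \<comment> \<open>Projection onto \<open>[0,1]\<close>. As \<open>g\<close> vanishes at both
    endpoints and outside, composing with it changes nothing, and it does not increase
    distances.\<close>
  define cl where "cl x = max 0 (min 1 x)" for x :: real
  have gcl: "g x = g (cl x)" for x
    using g01 out[of x] by (cases "x < 0"; cases "x > 1") (auto simp: cl_def)
  have lip': "\<bar>g x - g y\<bar> \<le> B * \<bar>x - y\<bar>" for x y
  proof -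
    have *: "\<bar>g (cl y) - g (cl x)\<bar> \<le> B * (y - x)" if "x \<le> y" for x y
    proof -
      have "\<bar>g (cl y) - g (cl x)\<bar> \<le> B * (cl y - cl x)" using that by (intro inner) (auto simp: cl_def)
      also have "\<dots> \<le> B * (y - x)" using that B0 by (intro mult_left_mono) (auto simp: cl_def)
      finally show ?thesis .
    qed
    show ?thesis
    proof (cases "x \<le> y")
      case True
      with *[OF True] show ?thesis by (simp add: gcl[symmetric] abs_minus_commute)
    next
      case False
      with *[of y x] show ?thesis by (simp add: gcl[symmetric])
    qed
  qed
  show ?thesis
  proof (rule that[of "B + 1"])
    show "\<bar>g x - g y\<bar> \<le> (B + 1) * \<bar>x - y\<bar>" for x y
      using lip'[of x y] by (simp add: distrib_right)
  qed (use B0 in simp)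
qed

locale weight =
  fixes g :: "real \<Rightarrow> real" and C :: real
  assumes weight: "weight_function g" and C_pos: "0 < C"
    and g_Lipschitz: "\<And>x y. \<bar>g x - g y\<bar> \<le> C * \<bar>x - y\<bar>"
begin

lemma g_outside: "x \<le> 0 \<or> 1 \<le> x \<Longrightarrow> g x = 0"
  using weight unfolding weight_function_def by (cases "x = 0 \<or> x = 1") auto

lemma g_nonzero: "g x \<noteq> 0 \<Longrightarrow> 0 \<le> x" "g x \<noteq> 0 \<Longrightarrow> x \<le> 1"
  using g_outside[of x] by linarith+

lemma g_bound: "\<bar>g x\<bar> \<le> C"
proof (cases "0 \<le> x \<and> x \<le> 1")
  case True
  have "\<bar>g x\<bar> \<le> C * \<bar>x\<bar>" using g_Lipschitz[of x 0] g_outside[of 0] by simp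
  also have "\<dots> \<le> C * 1" using True C_pos by (intro mult_left_mono) auto
  finally show ?thesis by simp
qed (use g_outside[of x] C_pos in auto)

lemma g_continuous: "continuous_on S g"
proof -
  have "C-lipschitz_on UNIV g"
    unfolding lipschitz_on_def dist_real_def using g_Lipschitz C_pos by auto
  then show ?thesis by (rule continuous_on_subset[OF lipschitz_on_continuous_on]) simp
qed

lemma powr_continuous: "0 < p \<Longrightarrow> continuous_on S (\<lambda>s. \<bar>g s\<bar> powr p)"
  by (intro continuous_on_powr' continuous_on_rabs g_continuous continuous_on_const) auto

lemma gbar_eq_integral:
  assumes "0 < p"
  shows "gbar g p = integral {0..1} (\<lambda>s. \<bar>g s\<bar> powr p)"
proof -
  have "gbar g p = (LINT s:{0..1}|lborel. \<bar>g s\<bar> powr p)"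
    unfolding gbar_def set_lebesgue_integral_def
    by (intro Bochner_Integration.integral_cong) (auto simp: indicator_def dest: g_nonzero)
  also have "\<dots> = integral {0..1} (\<lambda>s. \<bar>g s\<bar> powr p)"
    by (intro set_borel_integral_eq_integral(2) borel_integrable_atLeastAtMost' powr_continuous assms)
  finally show ?thesis .
qed

end

lemma riemann_sum_tendsto:
  fixes \<phi> :: "real \<Rightarrow> real"
  assumes cont: "continuous_on {0..1} \<phi>" and k: "filterlim k at_top sequentially"
  shows "(\<lambda>n. (\<Sum>j<k n. \<phi> (real j / real (k n))) / real (k n)) \<longlonglongrightarrow> integral {0..1} \<phi>"
proof (rule tendstoI)
  fix e :: real assume e: "0 < e"
  have "uniformly_continuous_on {0..1} \<phi>" using cont by (intro compact_uniformly_continuous) auto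
  then obtain d where d: "0 < d"
    "\<And>x y. x \<in> {0..1} \<Longrightarrow> y \<in> {0..1} \<Longrightarrow> dist y x < d \<Longrightarrow> dist (\<phi> y) (\<phi> x) < e / 2"
    unfolding uniformly_continuous_on_def using e half_gt_zero by meson
  obtain K :: nat where K: "1 / d < real K" using reals_Archimedean2 by blast
  from k have "\<forall>\<^sub>F n in sequentially. max 1 K \<le> k n" unfolding filterlim_at_top by blast
  then show "\<forall>\<^sub>F n in sequentially. dist ((\<Sum>j<k n. \<phi> (real j / real (k n))) / real (k n)) (integral {0..1} \<phi>) < e"
  proof eventually_elim
    case (elim n)
    define r where "r = k n"
    have r: "0 < r" "1 / real r < d"
    proof -
      show "0 < r" using elim unfolding r_def by simp
      have "1 / d < real r" using K elim unfolding r_def by simp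
      then show "1 / real r < d" using d(1) \<open>0 < r\<close> by (simp add: field_simps)
    qed
    define x where "x j = real j / real r" for j
    have x: "x j \<in> {0..1}" if "j \<le> r" for j using that r unfolding x_def by simp
    have xs: "x (Suc j) = x j + 1 / real r" for j unfolding x_def by (simp add: add_divide_distrib)
    have int: "\<phi> integrable_on {a..b}" if "0 \<le> a" "b \<le> 1" for a b
      using that by (intro integrable_continuous_real continuous_on_subset[OF cont]) auto
    \<comment> \<open>Node by node the error grows by at most \<open>e / 2\<close> times the length
      covered; at the last node this length is 1.\<close>
    have main: "\<bar>integral {0..x j} \<phi> - (\<Sum>i<j. \<phi> (x i)) / real r\<bar> \<le> e / 2 * x j" if "j \<le> r" for j
      using that
    proof (induction j)
      case 0 then show ?case by (simp add: x_def)
    next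
      case (Suc j)
      have xj: "0 \<le> x j" "x j \<le> x (Suc j)" "x (Suc j) \<le> 1"
        using x[of j] x[of "Suc j"] Suc.prems xs[of j] by auto
      have comb: "integral {0..x j} \<phi> + integral {x j..x (Suc j)} \<phi> = integral {0..x (Suc j)} \<phi>"
        using xj by (intro Henstock_Kurzweil_Integration.integral_combine int) auto
      have "((\<lambda>y. \<phi> y - \<phi> (x j)) has_integral (integral {x j..x (Suc j)} \<phi> - \<phi> (x j) * (x (Suc j) - x j))) {x j..x (Suc j)}"
        using has_integral_diff[OF integrable_integral[OF int[OF xj(1) xj(3)]] has_integral_const_real[of "\<phi> (x j)" "x j" "x (Suc j)"]] xj
        by (simp add: mult.commute)
      from has_integral_bound_real[OF _ finite.emptyI this, of "e / 2"]
      have "norm (integral {x j..x (Suc j)} \<phi> - \<phi> (x j) * (x (Suc j) - x j)) \<le> e / 2 * measure lborel {x j..x (Suc j)}"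
      proof -
        have "norm (\<phi> y - \<phi> (x j)) \<le> e / 2" if y: "y \<in> {x j..x (Suc j)} - {}" for y
        proof -
          have "dist (\<phi> y) (\<phi> (x j)) < e / 2"
            using y xj xs[of j] r by (intro d(2)) (auto simp: dist_real_def)
          then show ?thesis by (simp add: dist_real_def)
        qed
        with has_integral_bound_real[OF _ finite.emptyI \<open>(_ has_integral _) _\<close>, of "e / 2"] e show ?thesis by simp
      qed
      then have "\<bar>integral {x j..x (Suc j)} \<phi> - \<phi> (x j) / real r\<bar> \<le> e / 2 * (x (Suc j) - x j)"
        using xj xs[of j] by simp
      moreover have "\<bar>integral {0..x j} \<phi> - (\<Sum>i<j. \<phi> (x i)) / real r\<bar> \<le> e / 2 * x j" using Suc by simp
      ultimately show ?case unfolding comb[symmetric] sum.lessThan_Suc add_divide_distrib right_diff_distrib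
        by linarith
    qed
    have "x r = 1" unfolding x_def using r by simp
    with main[of r] have "\<bar>integral {0..1} \<phi> - (\<Sum>i<r. \<phi> (x i)) / real r\<bar> \<le> e / 2" by simp
    with e show ?case unfolding r_def[symmetric] x_def[symmetric] dist_real_def by linarith
  qed
qed

section \<open>Pre-averages as linear forms of the grid increments\<close>

text \<open>Capping at \<open>t\<close> turns the multiples of \<open>d\<close> into a partition of
  \<open>[0,t]\<close>, whose last step may be short or even degenerate.\<close>

definition grid :: "real \<Rightarrow> real \<Rightarrow> nat \<Rightarrow> real" where
  "grid d t i = min (real i * d) t"

definition grid_size :: "real \<Rightarrow> real \<Rightarrow> nat" where
  "grid_size d t = Suc (nat \<lfloor>t / d\<rfloor>)"

lemma grid_size_gt: "0 < d \<Longrightarrow> 0 \<le> t \<Longrightarrow> t < real (grid_size d t) * d"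
proof -
  assume d: "0 < d" "0 \<le> t"
  then have "t / d < real (grid_size d t)" unfolding grid_size_def by linarith
  with d show ?thesis by (simp add: divide_less_eq)
qed

lemma grid_eq: "0 < d \<Longrightarrow> 0 \<le> t \<Longrightarrow> i < grid_size d t \<Longrightarrow> grid d t i = real i * d"
proof -
  assume d: "0 < d" "0 \<le> t" and i: "i < grid_size d t"
  then have "i \<le> nat \<lfloor>t / d\<rfloor>" unfolding grid_size_def by simp
  with d have "int i \<le> \<lfloor>t / d\<rfloor>" by (simp add: le_nat_iff)
  then have "real i \<le> t / d" by (simp add: le_floor_iff)
  with d show ?thesis unfolding grid_def by (simp add: le_divide_eq min_def)
qed

lemma grid_partition: "0 < d \<Longrightarrow> 0 \<le> t \<Longrightarrow> is_partition t (grid d t) (grid_size d t)"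
  unfolding is_partition_def
proof (intro conjI allI impI)
  assume d: "0 < d" "0 \<le> t"
  show "grid d t 0 = 0" unfolding grid_def using d by simp
  show "grid d t (grid_size d t) = t" unfolding grid_def using grid_size_gt[OF d] by simp
  show "grid d t i \<le> grid d t (Suc i)" for i
    unfolding grid_def using d by (intro min.mono mult_right_mono) auto
qed

lemma grid_diff_le: "0 < d \<Longrightarrow> i \<le> j \<Longrightarrow> grid d t j - grid d t i \<le> real (j - i) * d"
proof -
  assume d: "0 < d" and ij: "i \<le> j"
  have "real j * d - real i * d = real (j - i) * d" using ij by (simp add: left_diff_distrib)
  moreover have "0 \<le> real (j - i) * d" using d by simp
  ultimately show ?thesis unfolding grid_def by linarith
qed

lemma sum_le_card_mult:
  fixes f :: "nat \<Rightarrow> real"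
  assumes "finite A" "finite S" "0 \<le> B" "\<And>x. x \<in> S \<Longrightarrow> f x \<le> B" "\<And>x. x \<in> S \<Longrightarrow> x \<notin> A \<Longrightarrow> f x = 0"
  shows "sum f S \<le> real (card A) * B"
proof -
  have "sum f S = sum f (S \<inter> A)" using assms by (intro sum.mono_neutral_right) auto
  also have "\<dots> \<le> (\<Sum>x\<in>S \<inter> A. B)" using assms by (intro sum_mono) auto
  also have "\<dots> = real (card (S \<inter> A)) * B" by simp
  also have "\<dots> \<le> real (card A) * B" using assms by (intro mult_right_mono) (auto intro: card_mono)
  finally show ?thesis .
qed

section \<open>Weights of the increments within a window and their Gram matrix\<close>

context weight
begin

text \<open>The increment with index \<open>m\<close> ends at grid point \<open>m + 1\<close>, hence
  enters window \<open>i\<close> at position \<open>j = m + 1 - i\<close>. Subtracting in the reals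
  makes the weight Lipschitz in \<open>m\<close> for all pairs and lets it vanish by itself outside
  the window.\<close>

definition wt :: "nat \<Rightarrow> nat \<Rightarrow> nat \<Rightarrow> real" where
  "wt k m i = g ((real (Suc m) - real i) / real k)"

lemma wt_bound: "\<bar>wt k m i\<bar> \<le> C"
  unfolding wt_def by (rule g_bound)

lemma wt_step: "0 < k \<Longrightarrow> \<bar>wt k (Suc m) i - wt k m i\<bar> \<le> C / real k"
  using g_Lipschitz[of "(real (Suc (Suc m)) - real i) / real k" "(real (Suc m) - real i) / real k"]
  unfolding wt_def by (simp add: diff_divide_distrib add_divide_distrib)

lemma wt_nonzero: "0 < k \<Longrightarrow> wt k m i \<noteq> 0 \<Longrightarrow> i \<le> m \<and> Suc m < i + k"
proof (rule ccontr)
  assume k: "0 < k" and nz: "wt k m i \<noteq> 0" and neg: "\<not> (i \<le> m \<and> Suc m < i + k)"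
  have "(real (Suc m) - real i) / real k \<le> 0 \<or> 1 \<le> (real (Suc m) - real i) / real k"
  proof (cases "i \<le> m")
    case True
    with neg have "real i + real k \<le> real (Suc m)" by (metis not_le of_nat_add of_nat_le_iff)
    then show ?thesis using k by (simp add: le_divide_eq)
  next
    case False
    then have "real (Suc m) \<le> real i" by simp
    then show ?thesis by (simp add: divide_nonpos_nonneg)
  qed
  with g_outside nz show False unfolding wt_def by blast
qed

lemma wt_variation:
  assumes "0 < k"
  shows "(\<Sum>m<n. \<bar>wt k (Suc m) i - wt k m i\<bar>) \<le> 2 * C"
proof -
  \<comment> \<open>A step is nonzero only if \<open>m\<close> or \<open>Suc m\<close> lies in the
    window, which adds the index \<open>i - 1\<close>. There are at most \<open>k + 1\<close>, hence
    at most \<open>2 * k\<close>, such steps, each of size at most \<open>C / k\<close>.\<close>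
  have "(\<Sum>m<n. \<bar>wt k (Suc m) i - wt k m i\<bar>) \<le> real (card {i - 1..<i + k}) * (C / real k)"
  proof (rule sum_le_card_mult)
    fix m assume "m \<notin> {i - 1..<i + k}"
    then have "wt k (Suc m) i = 0" "wt k m i = 0"
      using wt_nonzero[OF assms, of "Suc m" i] wt_nonzero[OF assms, of m i] by force+
    then show "\<bar>wt k (Suc m) i - wt k m i\<bar> = 0" by simp
  qed (use assms C_pos wt_step in auto)
  also have "\<dots> \<le> (2 * real k) * (C / real k)"
    using assms C_pos by (intro mult_right_mono) auto
  finally show ?thesis using assms by simp
qed

lemma wt_sum_le: "0 < k \<Longrightarrow> (\<Sum>i<n. \<bar>wt k m i\<bar>) \<le> real k * C"
proof -
  assume k: "0 < k"
  have "(\<Sum>i<n. \<bar>wt k m i\<bar>) \<le> real (card {Suc m - k..<Suc m}) * C"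
  proof (rule sum_le_card_mult)
    fix i assume "i \<notin> {Suc m - k..<Suc m}"
    then show "\<bar>wt k m i\<bar> = 0" using wt_nonzero[OF k, of m i] by force
  qed (use C_pos wt_bound in auto)
  also have "\<dots> \<le> real k * C" using C_pos by (intro mult_right_mono) auto
  finally show ?thesis .
qed

text \<open>The last grid point used has index \<open>i + k - 1\<close>, below the capped endpoint,
  so all increments involved are those of the regular grid.\<close>

lemma preaverage_eq:
  assumes d: "0 < d" and t: "0 \<le> t" and k: "0 < k" and i: "i + k < Suc (grid_size d t)"
  shows "preaverage g k d f (int i) = (\<Sum>m<grid_size d t. wt k m i * incr f (grid d t) m)"
proof -
  let ?R = "grid_size d t"
  have "preaverage g k d f (int i) = (\<Sum>j=1..k-1. wt k (i + j - 1) i * incr f (grid d t) (i + j - 1))"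
    unfolding preaverage_def
  proof (rule sum.cong[OF refl])
    fix j assume j: "j \<in> {1..k-1}"
    then have lt: "Suc (i + j - 1) < ?R" "i + j - 1 < ?R" using i by auto
    have "increment d f (int i + int j) = incr f (grid d t) (i + j - 1)"
      unfolding increment_def incr_def grid_eq[OF d t lt(1)] grid_eq[OF d t lt(2)] using j by simp
    moreover have "real (Suc (i + j - 1)) - real i = real j" using j by simp
    ultimately show "g (real j / real k) * increment d f (int i + int j)
        = wt k (i + j - 1) i * incr f (grid d t) (i + j - 1)"
      unfolding wt_def by simp
  qed
  also have "\<dots> = (\<Sum>m\<in>{i..<i + k - 1}. wt k m i * incr f (grid d t) m)"
    by (rule sum.reindex_bij_witness[of _ "\<lambda>m. Suc m - i" "\<lambda>j. i + j - 1"]) auto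
  also have "\<dots> = (\<Sum>m<?R. wt k m i * incr f (grid d t) m)"
  proof (rule sum.mono_neutral_left)
    show "{i..<i + k - 1} \<subseteq> {..<?R}" using i by auto
    show "\<forall>m\<in>{..<?R} - {i..<i + k - 1}. wt k m i * incr f (grid d t) m = 0"
      using wt_nonzero[OF k, of _ i] by force
  qed simp
  finally show ?thesis .
qed

lemma power_variation_eq:
  assumes d: "0 < d" and t: "0 \<le> t" and k: "0 < k"
  shows "power_variation g p k d f t =
    (\<Sum>i<grid_size d t - k. \<bar>\<Sum>m<grid_size d t. wt k m i * incr f (grid d t) m\<bar> powr p)"
proof -
  let ?R = "grid_size d t"
  \<comment> \<open>Thus the integer range up to \<open>\<lfloor>t / d\<rfloor> - k\<close> is
    \<open>i < ?R - k\<close>. If \<open>?R\<close> is at most \<open>k\<close>, both ranges are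
    empty, the latter by truncated subtraction.\<close>
  have fl: "\<lfloor>t / d\<rfloor> = int ?R - 1" using d t unfolding grid_size_def by (simp add: divide_nonneg_pos)
  have "power_variation g p k d f t = (\<Sum>i<?R - k. \<bar>preaverage g k d f (int i)\<bar> powr p)"
    unfolding power_variation_def fl
    by (rule sum.reindex_bij_witness[of _ int nat]) auto
  also have "\<dots> = (\<Sum>i<?R - k. \<bar>\<Sum>m<?R. wt k m i * incr f (grid d t) m\<bar> powr p)"
    by (intro sum.cong refl) (simp add: preaverage_eq[OF d t k])
  finally show ?thesis .
qed

text \<open>Normalized Gram matrix of the weights, with \<open>Q\<close> windows: the coefficients
  of the averaged squared pre-averages as a quadratic form in the increments.\<close>

definition cov :: "nat \<Rightarrow> nat \<Rightarrow> nat \<Rightarrow> nat \<Rightarrow> real" where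
  "cov k Q l m = (\<Sum>i<Q. wt k l i * wt k m i) / real k"

lemma cov_sym: "cov k Q l m = cov k Q m l"
  unfolding cov_def by (simp add: mult.commute)

lemma cov_bound: assumes "0 < k" shows "\<bar>cov k Q l m\<bar> \<le> C\<^sup>2"
proof -
  have "\<bar>\<Sum>i<Q. wt k l i * wt k m i\<bar> \<le> (\<Sum>i<Q. \<bar>wt k l i\<bar> * C)"
    by (rule order_trans[OF sum_abs sum_mono]) (auto simp: abs_mult wt_bound intro!: mult_left_mono)
  also have "\<dots> = (\<Sum>i<Q. \<bar>wt k l i\<bar>) * C" by (simp add: sum_distrib_right)
  also have "\<dots> \<le> real k * C * C" using wt_sum_le[OF assms] C_pos by (intro mult_right_mono) auto
  finally show ?thesis unfolding cov_def using assms by (simp add: power2_eq_square divide_le_eq mult_ac)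
qed

text \<open>Each window contributes its weight at \<open>l\<close> times a variation of at most
  \<open>2 * C\<close>. The weights at \<open>l\<close> sum to at most \<open>k * C\<close>, so
  division by \<open>k\<close> leaves 2 C^2, to which the end value adds C^2.\<close>

lemma cov_variation:
  assumes k: "0 < k"
  shows "\<bar>cov k Q l n\<bar> + (\<Sum>m<n. \<bar>cov k Q l (Suc m) - cov k Q l m\<bar>) \<le> 3 * C\<^sup>2"
proof -
  have "(\<Sum>m<n. \<bar>cov k Q l (Suc m) - cov k Q l m\<bar>)
      \<le> (\<Sum>m<n. (\<Sum>i<Q. \<bar>wt k l i\<bar> * \<bar>wt k (Suc m) i - wt k m i\<bar>) / real k)"
  proof (rule sum_mono)
    fix m
    have "cov k Q l (Suc m) - cov k Q l m = (\<Sum>i<Q. wt k l i * (wt k (Suc m) i - wt k m i)) / real k"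
      unfolding cov_def by (simp add: diff_divide_distrib[symmetric] sum_subtractf[symmetric] right_diff_distrib)
    also have "\<bar>\<dots>\<bar> \<le> (\<Sum>i<Q. \<bar>wt k l i\<bar> * \<bar>wt k (Suc m) i - wt k m i\<bar>) / real k"
      unfolding abs_divide abs_of_nat
      by (intro divide_right_mono order_trans[OF sum_abs]) (simp_all add: abs_mult)
    finally show "\<bar>cov k Q l (Suc m) - cov k Q l m\<bar> \<le> (\<Sum>i<Q. \<bar>wt k l i\<bar> * \<bar>wt k (Suc m) i - wt k m i\<bar>) / real k" .
  qed
  also have "\<dots> = (\<Sum>m<n. \<Sum>i<Q. \<bar>wt k l i\<bar> * \<bar>wt k (Suc m) i - wt k m i\<bar>) / real k"
    by (simp add: sum_divide_distrib)
  also have "(\<Sum>m<n. \<Sum>i<Q. \<bar>wt k l i\<bar> * \<bar>wt k (Suc m) i - wt k m i\<bar>)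
      = (\<Sum>i<Q. \<bar>wt k l i\<bar> * (\<Sum>m<n. \<bar>wt k (Suc m) i - wt k m i\<bar>))"
    by (subst sum.swap) (simp add: sum_distrib_left)
  also have "\<dots> \<le> (\<Sum>i<Q. \<bar>wt k l i\<bar> * (2 * C))"
    by (intro sum_mono mult_left_mono wt_variation[OF k]) auto
  also have "\<dots> = (\<Sum>i<Q. \<bar>wt k l i\<bar>) * (2 * C)" by (simp add: sum_distrib_right)
  also have "\<dots> \<le> real k * C * (2 * C)" using wt_sum_le[OF k] C_pos by (intro mult_right_mono) auto
  finally have "(\<Sum>m<n. \<bar>cov k Q l (Suc m) - cov k Q l m\<bar>) \<le> real k * C * (2 * C) / real k"
    using k by (simp add: divide_right_mono)
  with cov_bound[OF k, of Q l n] k show ?thesis by (simp add: power2_eq_square)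
qed

lemma cov_nonzero:
  assumes k: "0 < k" and nz: "cov k Q l m \<noteq> 0" and "m < l"
  shows "Suc l \<le> m + k"
proof -
  from nz obtain i where "wt k l i * wt k m i \<noteq> 0" unfolding cov_def by (auto elim: sum.not_neutral_contains_not_neutral)
  then have "wt k l i \<noteq> 0" "wt k m i \<noteq> 0" by auto
  with wt_nonzero[OF k] have "Suc l < i + k" "i \<le> m" by auto
  then show ?thesis by simp
qed

text \<open>Riemann sum of the squared weight function on \<open>[0,1]\<close>.\<close>

definition wsq :: "nat \<Rightarrow> real" where
  "wsq k = (\<Sum>j<k. (g (real j / real k))\<^sup>2) / real k"

lemma wsq_bound: "0 < k \<Longrightarrow> \<bar>wsq k\<bar> \<le> C\<^sup>2"
proof -
  assume k: "0 < k"
  have "(\<Sum>j<k. (g (real j / real k))\<^sup>2) \<le> (\<Sum>j<k. C\<^sup>2)"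
    using power_mono[OF g_bound abs_ge_zero, of _ 2] by (intro sum_mono) simp
  moreover have "0 \<le> (\<Sum>j<k. (g (real j / real k))\<^sup>2)" by (intro sum_nonneg) simp
  ultimately show ?thesis unfolding wsq_def using k by (simp add: divide_le_eq mult.commute)
qed

text \<open>Away from both ends every window through increment \<open>m\<close> is available, so all
  positions \<open>j\<close> from 1 to \<open>k - 1\<close> occur exactly once.\<close>

lemma cov_diag:
  assumes k: "0 < k" and m: "k \<le> m" "m < Q"
  shows "cov k Q m m = wsq k"
proof -
  have "(\<Sum>i<Q. (wt k m i)\<^sup>2) = (\<Sum>i\<in>{Suc m - k<..m}. (wt k m i)\<^sup>2)"
  proof (rule sum.mono_neutral_right)
    show "\<forall>i\<in>{..<Q} - {Suc m - k<..m}. (wt k m i)\<^sup>2 = 0"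
    proof
      fix i assume "i \<in> {..<Q} - {Suc m - k<..m}"
      then have "\<not> (i \<le> m \<and> Suc m < i + k)" using m by auto
      with wt_nonzero[OF k] have "wt k m i = 0" by blast
      then show "(wt k m i)\<^sup>2 = 0" by simp
    qed
  qed (use m in auto)
  also have "\<dots> = (\<Sum>j\<in>{1..<k}. (g (real j / real k))\<^sup>2)"
    by (rule sum.reindex_bij_witness[of _ "\<lambda>j. Suc m - j" "\<lambda>i. Suc m - i"])
      (use m in \<open>auto simp: wt_def\<close>)
  also have "\<dots> = (\<Sum>j<k. (g (real j / real k))\<^sup>2)"
    using k by (intro sum.mono_neutral_left) (auto simp: g_outside Suc_le_eq)
  finally show ?thesis unfolding cov_def wsq_def by (simp add: power2_eq_square)
qed

lemma wsq_tendsto: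
  assumes "filterlim k at_top sequentially"
  shows "(\<lambda>n. wsq (k n)) \<longlonglongrightarrow> gbar g 2"
proof -
  have "gbar g 2 = integral {0..1} (\<lambda>s. (g s)\<^sup>2)" by (subst gbar_eq_integral) auto
  then show ?thesis
    unfolding wsq_def using riemann_sum_tendsto[of "\<lambda>s. (g s)\<^sup>2", OF _ assms]
    by (simp add: continuous_on_power g_continuous)
qed

text \<open>The diagonal is replaced by its interior value \<open>wsq k\<close>, so that the plain
  sum of squared increments factors out; the correction term sits at the two ends.\<close>

lemma quadratic_form:
  assumes k: "0 < k"
  shows "1 / real k * (\<Sum>i<Q. (\<Sum>m<R. wt k m i * x m)\<^sup>2) =
    wsq k * (\<Sum>m<R. (x m)\<^sup>2) - (\<Sum>m<R. (wsq k - cov k Q m m) * (x m)\<^sup>2)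
      + 2 * (\<Sum>l<R. \<Sum>m<l. cov k Q l m * x m * x l)"
proof -
  have kc: "real k * cov k Q l m = (\<Sum>i<Q. wt k l i * wt k m i)" for l m
    unfolding cov_def using k by simp
  have "(\<Sum>m<R. wt k m i * x m)\<^sup>2 = (\<Sum>m<R. (wt k m i * x m)\<^sup>2)
      + 2 * (\<Sum>l<R. \<Sum>m<l. (wt k m i * x m) * (wt k l i * x l))" for i
    using square_of_sum[of 0 R "\<lambda>m. wt k m i * x m"] by (simp add: atLeast0LessThan)
  then have "(\<Sum>i<Q. (\<Sum>m<R. wt k m i * x m)\<^sup>2) = (\<Sum>i<Q. \<Sum>m<R. (wt k m i * x m)\<^sup>2)
      + 2 * (\<Sum>i<Q. \<Sum>l<R. \<Sum>m<l. (wt k m i * x m) * (wt k l i * x l))"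
    by (simp add: sum.distrib sum_distrib_left)
  also have "(\<Sum>i<Q. \<Sum>m<R. (wt k m i * x m)\<^sup>2) = (\<Sum>m<R. real k * cov k Q m m * (x m)\<^sup>2)"
    by (subst sum.swap) (simp add: kc sum_distrib_left sum_distrib_right power_mult_distrib power2_eq_square mult_ac)
  also have "(\<Sum>i<Q. \<Sum>l<R. \<Sum>m<l. (wt k m i * x m) * (wt k l i * x l))
      = (\<Sum>l<R. \<Sum>i<Q. \<Sum>m<l. (wt k m i * x m) * (wt k l i * x l))" by (rule sum.swap)
  also have "\<dots> = (\<Sum>l<R. \<Sum>m<l. \<Sum>i<Q. (wt k m i * x m) * (wt k l i * x l))"
    by (intro sum.cong refl sum.swap)
  also have "\<dots> = (\<Sum>l<R. \<Sum>m<l. real k * cov k Q l m * x m * x l)"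
    by (intro sum.cong refl) (simp add: kc sum_distrib_left sum_distrib_right mult_ac)
  finally have "1 / real k * (\<Sum>i<Q. (\<Sum>m<R. wt k m i * x m)\<^sup>2) =
      (\<Sum>m<R. cov k Q m m * (x m)\<^sup>2) + 2 * (\<Sum>l<R. \<Sum>m<l. cov k Q l m * x m * x l)"
    using k by (simp add: distrib_left sum_distrib_left mult_ac)
  then show ?thesis by (simp add: left_diff_distrib sum_subtractf sum_distrib_left)
qed

end

section \<open>The case \<open>p = 2\<close>\<close>

lemma cadlag_left_limit:
  assumes "cadlag f" "0 < s"
  shows "(f \<longlongrightarrow> f s - jump f s) (at_left s)"
proof -
  from assms obtain l where l: "(f \<longlongrightarrow> l) (at_left s)" unfolding cadlag_def by blast
  then have "Lim (at_left s) f = l" by (intro tendsto_Lim) auto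
  with l assms show ?thesis unfolding jump_def by simp
qed

lemma cadlag_seq_left:
  assumes f: "cadlag f" and j: "jump f t = 0" and s: "s \<longlonglongrightarrow> t" "\<And>n. 0 \<le> s n" "\<And>n. s n \<le> t"
  shows "(\<lambda>n. f (s n)) \<longlonglongrightarrow> f t"
proof (cases "t > 0")
  case True
  have "continuous (at t within {..t}) f"
    using cadlag_left_limit[OF f True] j unfolding continuous_within at_within_Iic_at_left by simp
  from continuous_within_tendsto_compose[OF this _ s(1)] s(3) show ?thesis by simp
next
  case False
  with s(2,3) have "s n = t" for n by (meson antisym not_le order_trans)
  then show ?thesis by simp
qed

lemma cadlag_seq_right:
  assumes f: "cadlag f" and r: "0 \<le> r" and s: "s \<longlonglongrightarrow> r" "\<And>n. r \<le> s n"
  shows "(\<lambda>n. f (s n)) \<longlonglongrightarrow> f r"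
proof -
  have "continuous (at r within {r..}) f"
    using f r unfolding cadlag_def continuous_within at_within_Ici_at_right by simp
  from continuous_within_tendsto_compose[OF this _ s(1)] s(2) show ?thesis by simp
qed

context filtered
begin

lemma jump_measurable:
  assumes ad: "adapted F X" and cad: "cadlag_process M X"
  shows "(\<lambda>\<omega>. jump (\<lambda>r. X r \<omega>) s) \<in> borel_measurable M"
proof (cases "0 < s")
  case True
  define r where "r n = s - s / real (Suc n)" for n
  have r: "0 \<le> r n" "r n < s" for n unfolding r_def using True by (auto simp: divide_le_eq)
  have "(\<lambda>n. s - s * (1 / real (Suc n))) \<longlonglongrightarrow> s - s * 0" by (intro tendsto_intros LIMSEQ_Suc[OF lim_1_over_n])
  then have "r \<longlonglongrightarrow> s" unfolding r_def by simp
  then have rlim: "filterlim r (at_left s) sequentially"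
    by (rule tendsto_imp_filterlim_at_left) (use r(2) in simp)
  have lim: "(\<lambda>n. X s \<omega> - X (r n) \<omega>) \<longlonglongrightarrow> jump (\<lambda>r. X r \<omega>) s" if "\<omega> \<in> space M" for \<omega>
  proof -
    have "cadlag (\<lambda>r. X r \<omega>)" using cad that unfolding cadlag_process_def by blast
    from filterlim_compose[OF cadlag_left_limit[OF this True] rlim]
    have "(\<lambda>n. X s \<omega> - X (r n) \<omega>) \<longlonglongrightarrow> X s \<omega> - (X s \<omega> - jump (\<lambda>r. X r \<omega>) s)"
      by (intro tendsto_diff tendsto_const)
    then show ?thesis by simp
  qed
  show ?thesis
  proof (rule borel_measurable_LIMSEQ_real[OF lim])
    show "(\<lambda>\<omega>. X s \<omega> - X (r n) \<omega>) \<in> borel_measurable M" for n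
      using adapted_meas[OF ad, of s] adapted_meas[OF ad r(1)] True by simp
  qed
qed (simp add: jump_def)

lemma AE_no_jump:
  assumes "adapted F X" "cadlag_process M X" "\<not> fixed_time_of_discontinuity M X t"
  shows "AE \<omega> in M. jump (\<lambda>r. X r \<omega>) t = 0"
proof -
  note [measurable] = jump_measurable[OF assms(1,2)]
  have "prob {\<omega>\<in>space M. jump (\<lambda>s. X s \<omega>) t \<noteq> 0} = 0"
    using assms(3) measure_nonneg[of M "{\<omega>\<in>space M. jump (\<lambda>s. X s \<omega>) t \<noteq> 0}"]
    unfolding fixed_time_of_discontinuity_def by linarith
  then have "AE \<omega> in M. \<omega> \<notin> {\<omega>\<in>space M. jump (\<lambda>s. X s \<omega>) t \<noteq> 0}"
    by (subst (asm) prob_eq_0) auto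
  with AE_space show ?thesis by eventually_elim simp
qed

text \<open>Over a short stretch the squared increments sum to the square of the total increment
  minus twice an off-diagonal form with coefficients 1. The total increment vanishes by path
  regularity, the form by \<open>offdiag_null\<close>.\<close>

lemma edge_squares_null:
  assumes X: "semimartingale M F X" and t: "0 \<le> t" and part: "\<And>n. is_partition t (\<rho> n) (R n)"
    and ab: "\<And>n. a n \<le> b n" "\<And>n. b n \<le> R n"
    and short: "(\<lambda>n. \<rho> n (b n) - \<rho> n (a n)) \<longlonglongrightarrow> 0"
    and cont: "AE \<omega> in M. (\<lambda>n. X (\<rho> n (b n)) \<omega> - X (\<rho> n (a n)) \<omega>) \<longlonglongrightarrow> 0"
  shows "conv_in_prob M (\<lambda>n \<omega>. \<Sum>m=a n..<b n. (incr (\<lambda>s. X s \<omega>) (\<rho> n) m)\<^sup>2) (\<lambda>_. 0)"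
proof -
  have ad: "adapted F X" and cad: "cadlag_process M X" using X unfolding semimartingale_def by auto
  define c :: "nat \<Rightarrow> nat \<Rightarrow> nat \<Rightarrow> real"
    where "c n l m = of_bool (a n \<le> l \<and> l < b n) * of_bool (a n \<le> m \<and> m < b n)" for n l m
  have 1: "conv_in_prob M (\<lambda>n \<omega>. offdiag (c n) (\<lambda>s. X s \<omega>) (\<rho> n) (R n)) (\<lambda>_. 0)"
  proof (rule offdiag_null[OF ad cad transform_tight_semimartingale[OF X part t] part t, where K = 3])
    show "\<bar>c n l (R n)\<bar> + (\<Sum>m<R n. \<bar>c n l (Suc m) - c n l m\<bar>) \<le> 3" for n l
      using indicator_variation[of "a n" "b n" "R n"] by (cases "a n \<le> l \<and> l < b n") (auto simp: c_def)
    fix \<delta> :: real assume "0 < \<delta>"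
    from order_tendstoD(2)[OF short this]
    show "\<forall>\<^sub>F n in sequentially. \<forall>l<R n. \<forall>m<l. c n l m \<noteq> 0 \<longrightarrow> \<rho> n (Suc l) - \<rho> n m < \<delta>"
    proof (eventually_elim, intro allI impI)
      fix n l m assume le: "\<rho> n (b n) - \<rho> n (a n) < \<delta>" and lm: "l < R n" "m < l" and "c n l m \<noteq> 0"
      then have "a n \<le> m" "Suc l \<le> b n" by (auto simp: c_def split: if_splits)
      then have "\<rho> n (a n) \<le> \<rho> n m" "\<rho> n (Suc l) \<le> \<rho> n (b n)"
        using lm ab(2)[of n] by (auto intro!: is_partition_mono[OF part])
      with le show "\<rho> n (Suc l) - \<rho> n m < \<delta>" by linarith
    qed
  qed (auto simp: c_def)
  have 2: "conv_in_prob M (\<lambda>n \<omega>. (X (\<rho> n (b n)) \<omega> - X (\<rho> n (a n)) \<omega>)\<^sup>2) (\<lambda>_. 0)"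
  proof (rule conv_in_prob_AE)
    show "(\<lambda>\<omega>. (X (\<rho> n (b n)) \<omega> - X (\<rho> n (a n)) \<omega>)\<^sup>2) \<in> borel_measurable M" for n
    proof -
      have [measurable]: "X (\<rho> n (b n)) \<in> borel_measurable M" "X (\<rho> n (a n)) \<in> borel_measurable M"
        using ab[of n] by (auto intro!: adapted_part_meas[OF ad part])
      show ?thesis by measurable
    qed
    show "AE \<omega> in M. (\<lambda>n. (X (\<rho> n (b n)) \<omega> - X (\<rho> n (a n)) \<omega>)\<^sup>2) \<longlonglongrightarrow> 0"
      using cont by eventually_elim (use tendsto_power[of _ 0 _ 2] in force)
  qed simp
  have eq: "(\<Sum>m=a n..<b n. (incr f (\<rho> n) m)\<^sup>2) = (f (\<rho> n (b n)) - f (\<rho> n (a n)))\<^sup>2 - 2 * offdiag (c n) f (\<rho> n) (R n)" for n f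
  proof -
    have "f (\<rho> n (b n)) - f (\<rho> n (a n)) = (\<Sum>m=a n..<b n. incr f (\<rho> n) m)"
      unfolding incr_def using telescope_interval[OF ab(1), of "\<lambda>m. f (\<rho> n m)"] by simp
    then have "(f (\<rho> n (b n)) - f (\<rho> n (a n)))\<^sup>2 = (\<Sum>m=a n..<b n. (incr f (\<rho> n) m)\<^sup>2)
        + 2 * (\<Sum>l=a n..<b n. \<Sum>m=a n..<l. incr f (\<rho> n) m * incr f (\<rho> n) l)"
      using square_of_sum[OF ab(1), of "incr f (\<rho> n)"] by simp
    also have "(\<Sum>l=a n..<b n. \<Sum>m=a n..<l. incr f (\<rho> n) m * incr f (\<rho> n) l) = offdiag (c n) f (\<rho> n) (R n)"
      unfolding offdiag_def
    proof (rule sum.mono_neutral_cong_left)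
      show "{a n..<b n} \<subseteq> {..<R n}" using ab(2)[of n] by auto
      show "\<forall>l\<in>{..<R n} - {a n..<b n}. (\<Sum>m<l. c n l m * incr f (\<rho> n) m * incr f (\<rho> n) l) = 0"
        by (auto simp: c_def intro!: sum.neutral)
      fix l assume l: "l \<in> {a n..<b n}"
      show "(\<Sum>m=a n..<l. incr f (\<rho> n) m * incr f (\<rho> n) l) = (\<Sum>m<l. c n l m * incr f (\<rho> n) m * incr f (\<rho> n) l)"
        by (rule sum.mono_neutral_cong_left) (use l in \<open>auto simp: c_def\<close>)
    qed simp
    finally show ?thesis by simp
  qed
  show ?thesis
    unfolding eq using conv_in_prob_diff[OF 2 conv_in_prob_mult_seq[OF 1 tendsto_const[of 2]]] by simp
qed

end

section \<open>Pre-averages of the semimartingale along the shrinking grids\<close>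

locale preaverage_setup = filtered M F + weight g C
  for M :: "'a measure" and F :: "real \<Rightarrow> 'a measure" and g :: "real \<Rightarrow> real" and C :: real +
  fixes X :: "real \<Rightarrow> 'a \<Rightarrow> real" and \<Delta> :: "nat \<Rightarrow> real" and k :: "nat \<Rightarrow> nat" and t :: real
  assumes X: "semimartingale M F X"
    and \<Delta>_pos: "\<And>n. \<Delta> n > 0" and \<Delta>_lim: "\<Delta> \<longlonglongrightarrow> 0"
    and k_pos: "\<And>n. k n > 0" and k_lim: "filterlim k at_top sequentially"
    and u_lim: "(\<lambda>n. real (k n) * \<Delta> n) \<longlonglongrightarrow> 0"
    and t: "t \<ge> 0" and no_fixed: "\<not> fixed_time_of_discontinuity M X t"
begin

abbreviation "\<rho> n \<equiv> grid (\<Delta> n) t"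
abbreviation "R n \<equiv> grid_size (\<Delta> n) t"

lemma ad: "adapted F X" and cad: "cadlag_process M X"
  using X unfolding semimartingale_def by auto

lemma cadlag_path: "\<omega> \<in> space M \<Longrightarrow> cadlag (\<lambda>s. X s \<omega>)"
  using cad unfolding cadlag_process_def by blast

lemma part: "is_partition t (\<rho> n) (R n)"
  by (rule grid_partition[OF \<Delta>_pos t])

lemma part_seq: "partition_seq t \<rho> R"
proof -
  have "\<forall>\<^sub>F n in sequentially. \<forall>i<R n. \<rho> n (Suc i) - \<rho> n i < e" if "0 < e" for e
    using order_tendstoD(2)[OF \<Delta>_lim that]
  proof (eventually_elim, intro allI impI)
    fix n i assume "\<Delta> n < e"
    with grid_diff_le[OF \<Delta>_pos, of i "Suc i" n t] show "\<rho> n (Suc i) - \<rho> n i < e" by simp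
  qed
  with part show ?thesis unfolding partition_seq_def is_partition_def by blast
qed

lemma incr_measurable: "m < R n \<Longrightarrow> (\<lambda>\<omega>. incr (\<lambda>s. X s \<omega>) (\<rho> n) m) \<in> borel_measurable M"
proof -
  assume "m < R n"
  then have [measurable]: "X (\<rho> n (Suc m)) \<in> borel_measurable M" "X (\<rho> n m) \<in> borel_measurable M"
    by (auto intro!: adapted_part_meas[OF ad part])
  show ?thesis unfolding incr_def by measurable
qed

lemma squares_conv:
  "conv_in_prob M (\<lambda>n \<omega>. \<Sum>m<R n. (incr (\<lambda>s. X s \<omega>) (\<rho> n) m)\<^sup>2) (quadratic_variation M X t)"
  using quadratic_variation_exists[OF X t] part_seq unfolding is_quadratic_variation_def incr_def by blast

text \<open>Near 0 right continuity suffices. Near \<open>t\<close> the stretch approaches from the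
  left, so the path must almost surely not jump at \<open>t\<close>.\<close>

lemma edges_null:
  "conv_in_prob M (\<lambda>n \<omega>. \<Sum>m=0..<min (k n) (R n). (incr (\<lambda>s. X s \<omega>) (\<rho> n) m)\<^sup>2) (\<lambda>_. 0)"
  "conv_in_prob M (\<lambda>n \<omega>. \<Sum>m=R n - k n..<R n. (incr (\<lambda>s. X s \<omega>) (\<rho> n) m)\<^sup>2) (\<lambda>_. 0)"
proof -
  have b0: "0 \<le> \<rho> n (min (k n) (R n))" for n by (rule is_partition_bounds[OF part]) simp
  have r0: "\<rho> n 0 = 0" "\<rho> n (R n) = t" for n using part[of n] unfolding is_partition_def by auto
  have le: "\<rho> n (min (k n) (R n)) \<le> real (k n) * \<Delta> n" for n
  proof -
    have "\<rho> n (min (k n) (R n)) - \<rho> n 0 \<le> real (min (k n) (R n) - 0) * \<Delta> n"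
      by (rule grid_diff_le[OF \<Delta>_pos]) simp
    also have "\<dots> \<le> real (k n) * \<Delta> n" using \<Delta>_pos[of n] by (intro mult_right_mono) auto
    finally show ?thesis using r0 by simp
  qed
  have lim0: "(\<lambda>n. \<rho> n (min (k n) (R n))) \<longlonglongrightarrow> 0"
    by (rule tendsto_sandwich[OF _ _ tendsto_const u_lim]) (use b0 le in auto)
  show "conv_in_prob M (\<lambda>n \<omega>. \<Sum>m=0..<min (k n) (R n). (incr (\<lambda>s. X s \<omega>) (\<rho> n) m)\<^sup>2) (\<lambda>_. 0)"
  proof (rule edge_squares_null[OF X t part])
    show "AE \<omega> in M. (\<lambda>n. X (\<rho> n (min (k n) (R n))) \<omega> - X (\<rho> n 0) \<omega>) \<longlonglongrightarrow> 0"
    proof (rule AE_I2)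
      fix \<omega> assume "\<omega> \<in> space M"
      from cadlag_seq_right[OF cadlag_path[OF this] order_refl lim0 b0]
      show "(\<lambda>n. X (\<rho> n (min (k n) (R n))) \<omega> - X (\<rho> n 0) \<omega>) \<longlonglongrightarrow> 0"
        unfolding r0 by (simp add: LIM_zero)
    qed
  qed (use lim0 r0 in auto)
  have bt: "0 \<le> \<rho> n (R n - k n)" "\<rho> n (R n - k n) \<le> t" for n by (rule is_partition_bounds[OF part], simp)+
  have le': "t - \<rho> n (R n - k n) \<le> real (k n) * \<Delta> n" for n
  proof -
    have "\<rho> n (R n) - \<rho> n (R n - k n) \<le> real (R n - (R n - k n)) * \<Delta> n"
      by (rule grid_diff_le[OF \<Delta>_pos]) simp
    also have "\<dots> \<le> real (k n) * \<Delta> n" using \<Delta>_pos[of n] by (intro mult_right_mono) auto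
    finally show ?thesis using r0 by simp
  qed
  have lim1: "(\<lambda>n. t - \<rho> n (R n - k n)) \<longlonglongrightarrow> 0"
    by (rule tendsto_sandwich[OF _ _ tendsto_const u_lim]) (use bt le' in auto)
  then have lim1': "(\<lambda>n. \<rho> n (R n - k n)) \<longlonglongrightarrow> t"
    using tendsto_diff[OF tendsto_const[of t] lim1] by simp
  show "conv_in_prob M (\<lambda>n \<omega>. \<Sum>m=R n - k n..<R n. (incr (\<lambda>s. X s \<omega>) (\<rho> n) m)\<^sup>2) (\<lambda>_. 0)"
  proof (rule edge_squares_null[OF X t part])
    show "AE \<omega> in M. (\<lambda>n. X (\<rho> n (R n)) \<omega> - X (\<rho> n (R n - k n)) \<omega>) \<longlonglongrightarrow> 0"
      using AE_no_jump[OF ad cad no_fixed] AE_space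
    proof eventually_elim
      case (elim \<omega>)
      from cadlag_seq_left[OF cadlag_path[OF elim(2)] elim(1) lim1' bt]
      have "(\<lambda>n. X t \<omega> - X (\<rho> n (R n - k n)) \<omega>) \<longlonglongrightarrow> X t \<omega> - X t \<omega>" by (intro tendsto_intros)
      then show ?case unfolding r0 by simp
    qed
  qed (use lim1 r0 in auto)
qed

definition preav :: "(real \<Rightarrow> real) \<Rightarrow> nat \<Rightarrow> nat \<Rightarrow> real" where
  "preav f n i = (\<Sum>m<R n. wt (k n) m i * incr f (\<rho> n) m)"

lemma preav_measurable: "(\<lambda>\<omega>. preav (\<lambda>s. X s \<omega>) n i) \<in> borel_measurable M"
  unfolding preav_def
  by (intro borel_measurable_sum borel_measurable_times borel_measurable_const incr_measurable) simp

text \<open>Locality of the off-diagonal coefficients comes from the window length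
  \<open>k n * \<Delta> n\<close>, and the diagonal correction is dominated by the squares at the
  two ends.\<close>

theorem squares_preav_conv:
  "conv_in_prob M (\<lambda>n \<omega>. 1 / real (k n) * (\<Sum>i<R n - k n. (preav (\<lambda>s. X s \<omega>) n i)\<^sup>2))
     (\<lambda>\<omega>. gbar g 2 * quadratic_variation M X t \<omega>)"
proof -
  have off: "conv_in_prob M (\<lambda>n \<omega>. offdiag (cov (k n) (R n - k n)) (\<lambda>s. X s \<omega>) (\<rho> n) (R n)) (\<lambda>_. 0)"
  proof (rule offdiag_null[OF ad cad transform_tight_semimartingale[OF X part t] part t, where K = "3 * C\<^sup>2"])
    fix \<delta> :: real assume "0 < \<delta>"
    from order_tendstoD(2)[OF u_lim this]
    show "\<forall>\<^sub>F n in sequentially. \<forall>l<R n. \<forall>m<l. cov (k n) (R n - k n) l m \<noteq> 0 \<longrightarrow> \<rho> n (Suc l) - \<rho> n m < \<delta>"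
    proof (eventually_elim, intro allI impI)
      fix n l m assume u: "real (k n) * \<Delta> n < \<delta>" and lm: "l < R n" "m < l"
        and nz: "cov (k n) (R n - k n) l m \<noteq> 0"
      have "\<rho> n (Suc l) - \<rho> n m \<le> real (Suc l - m) * \<Delta> n"
        using lm by (intro grid_diff_le[OF \<Delta>_pos]) simp
      also have "\<dots> \<le> real (k n) * \<Delta> n"
        using cov_nonzero[OF k_pos nz lm(2)] \<Delta>_pos[of n] by (intro mult_right_mono) auto
      finally show "\<rho> n (Suc l) - \<rho> n m < \<delta>" using u by simp
    qed
  qed (use C_pos cov_variation[OF k_pos] cov_sym in auto)
  define E where "E n \<omega> = (\<Sum>m<R n. (wsq (k n) - cov (k n) (R n - k n) m m) * (incr (\<lambda>s. X s \<omega>) (\<rho> n) m)\<^sup>2)" for n \<omega>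
  have Enull: "conv_in_prob M E (\<lambda>_. 0)"
  proof (rule conv_in_prob_squeeze)
    show "conv_in_prob M (\<lambda>n \<omega>. 2 * C\<^sup>2 * ((\<Sum>m=0..<min (k n) (R n). (incr (\<lambda>s. X s \<omega>) (\<rho> n) m)\<^sup>2)
        + (\<Sum>m=R n - k n..<R n. (incr (\<lambda>s. X s \<omega>) (\<rho> n) m)\<^sup>2))) (\<lambda>_. 0)"
      using conv_in_prob_mult_seq[OF conv_in_prob_add[OF edges_null] tendsto_const[of "2 * C\<^sup>2"]] by simp
    show "E n \<in> borel_measurable M" for n
      unfolding E_def
      by (intro borel_measurable_sum borel_measurable_times borel_measurable_const borel_measurable_power incr_measurable) simp
    fix n \<omega>
    let ?x = "incr (\<lambda>s. X s \<omega>) (\<rho> n)"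
    \<comment> \<open>Two indicators are added instead of one for the union; the two ends may
      overlap for small \<open>n\<close>, which only enlarges the bound.\<close>
    have "\<bar>E n \<omega>\<bar> \<le> (\<Sum>m<R n. 2 * C\<^sup>2 * (of_bool (m < k n) * (?x m)\<^sup>2 + of_bool (R n - k n \<le> m) * (?x m)\<^sup>2))"
      unfolding E_def
    proof (rule order_trans[OF sum_abs sum_mono])
      fix m assume "m \<in> {..<R n}"
      have b: "\<bar>wsq (k n) - cov (k n) (R n - k n) m m\<bar> \<le> 2 * C\<^sup>2"
        using wsq_bound[OF k_pos, of n] cov_bound[OF k_pos, of n "R n - k n" m m] by linarith
      show "\<bar>(wsq (k n) - cov (k n) (R n - k n) m m) * (?x m)\<^sup>2\<bar>
          \<le> 2 * C\<^sup>2 * (of_bool (m < k n) * (?x m)\<^sup>2 + of_bool (R n - k n \<le> m) * (?x m)\<^sup>2)"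
      proof (cases "m < k n \<or> R n - k n \<le> m")
        case True
        have "\<bar>(wsq (k n) - cov (k n) (R n - k n) m m) * (?x m)\<^sup>2\<bar> \<le> 2 * C\<^sup>2 * (?x m)\<^sup>2"
          unfolding abs_mult using b by (simp add: mult_right_mono)
        also have "\<dots> \<le> 2 * C\<^sup>2 * (of_bool (m < k n) * (?x m)\<^sup>2 + of_bool (R n - k n \<le> m) * (?x m)\<^sup>2)"
          using True by (intro mult_left_mono) auto
        finally show ?thesis .
      next
        case False
        then show ?thesis by (simp add: cov_diag[OF k_pos])
      qed
    qed
    also have "\<dots> = 2 * C\<^sup>2 * ((\<Sum>m<R n. of_bool (m < k n) * (?x m)\<^sup>2) + (\<Sum>m<R n. of_bool (R n - k n \<le> m) * (?x m)\<^sup>2))"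
      by (simp add: sum_distrib_left[symmetric] sum.distrib)
    also have "(\<Sum>m<R n. of_bool (m < k n) * (?x m)\<^sup>2) = (\<Sum>m=0..<min (k n) (R n). (?x m)\<^sup>2)"
      by (rule sum.mono_neutral_cong_right) auto
    also have "(\<Sum>m<R n. of_bool (R n - k n \<le> m) * (?x m)\<^sup>2) = (\<Sum>m=R n - k n..<R n. (?x m)\<^sup>2)"
      by (rule sum.mono_neutral_cong_right) auto
    finally show "\<bar>E n \<omega>\<bar> \<le> 2 * C\<^sup>2 * ((\<Sum>m=0..<min (k n) (R n). (?x m)\<^sup>2) + (\<Sum>m=R n - k n..<R n. (?x m)\<^sup>2))" .
  qed
  have "1 / real (k n) * (\<Sum>i<R n - k n. (preav f n i)\<^sup>2) = wsq (k n) * (\<Sum>m<R n. (incr f (\<rho> n) m)\<^sup>2)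
      - (\<Sum>m<R n. (wsq (k n) - cov (k n) (R n - k n) m m) * (incr f (\<rho> n) m)\<^sup>2)
      + 2 * offdiag (cov (k n) (R n - k n)) f (\<rho> n) (R n)" for f n
    unfolding preav_def offdiag_def by (rule quadratic_form[OF k_pos])
  moreover have "conv_in_prob M (\<lambda>n \<omega>. wsq (k n) * (\<Sum>m<R n. (incr (\<lambda>s. X s \<omega>) (\<rho> n) m)\<^sup>2) - E n \<omega>
      + 2 * offdiag (cov (k n) (R n - k n)) (\<lambda>s. X s \<omega>) (\<rho> n) (R n)) (\<lambda>\<omega>. gbar g 2 * quadratic_variation M X t \<omega>)"
    using conv_in_prob_add[OF conv_in_prob_diff[OF conv_in_prob_mult_seq[OF squares_conv wsq_tendsto[OF k_lim]] Enull]
        conv_in_prob_mult_seq[OF off tendsto_const[of 2]]] by simp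
  ultimately show ?thesis unfolding E_def by simp
qed

lemma power_variation_preav:
  "power_variation g p (k n) (\<Delta> n) f t = (\<Sum>i<R n - k n. \<bar>preav f n i\<bar> powr p)"
  unfolding preav_def by (rule power_variation_eq[OF \<Delta>_pos t k_pos])

end

section \<open>Pathwise limits of functionals vanishing near zero\<close>

text \<open>Left of \<open>s\<close> and close to it, no point of the finite set \<open>D\<close>
  intervenes; the oscillation bound then passes to the left limit.\<close>

lemma cadlag_jump_le:
  assumes f: "cadlag f" and s: "0 < s" and D: "finite D" "s \<notin> D"
    and osc: "\<And>x. 0 \<le> x \<Longrightarrow> x \<le> s \<Longrightarrow> D \<inter> {x<..s} = {} \<Longrightarrow> \<bar>f s - f x\<bar> \<le> e"
  shows "\<bar>jump f s\<bar> \<le> e"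
proof -
  have "\<forall>\<^sub>F x in at_left s. \<forall>d\<in>D. d < s \<longrightarrow> d < x"
  proof (intro eventually_ball_finite D ballI)
    fix d
    show "\<forall>\<^sub>F x in at_left s. d < s \<longrightarrow> d < x"
    proof (cases "d < s")
      case True
      from eventually_at_left_real[OF this] show ?thesis by eventually_elim simp
    qed simp
  qed
  with eventually_at_left_real[OF s] have ev: "\<forall>\<^sub>F x in at_left s. \<bar>f s - f x\<bar> \<le> e"
  proof eventually_elim
    case (elim x)
    have "D \<inter> {x<..s} = {}"
    proof safe
      fix d assume "d \<in> D" "d \<in> {x<..s}"
      moreover from this D have "d \<noteq> s" by auto
      ultimately show "d \<in> {}" using elim(2) by force
    qed
    with elim(1) show ?case by (intro osc) auto
  qed
  have "((\<lambda>x. \<bar>f s - f x\<bar>) \<longlongrightarrow> \<bar>f s - (f s - jump f s)\<bar>) (at_left s)"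
    by (intro tendsto_intros cadlag_left_limit[OF f s])
  from tendsto_upperbound[OF this ev] show ?thesis by simp
qed

context preaverage_setup
begin

lemma rho_eq: "i < R n \<Longrightarrow> \<rho> n i = real i * \<Delta> n"
  by (rule grid_eq[OF \<Delta>_pos t])

lemma preav_window:
  assumes "i + k n < R n"
  shows "preav f n i = (\<Sum>m=i..<i + k n - 1. wt (k n) m i * incr f (\<rho> n) m)"
  unfolding preav_def
proof (rule sum.mono_neutral_right)
  show "\<forall>m\<in>{..<R n} - {i..<i + k n - 1}. wt (k n) m i * incr f (\<rho> n) m = 0"
    using wt_nonzero[OF k_pos, of n _ i] by force
qed (use assms in auto)

lemma wt_total: "\<bar>wt (k n) m i\<bar> + (\<Sum>m<m. \<bar>wt (k n) (Suc m) i - wt (k n) m i\<bar>) \<le> 3 * C"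
  using wt_variation[OF k_pos, of n i m] wt_bound[of "k n" m i] by linarith

text \<open>The window of the \<open>i\<close>-th pre-average is \<open>(\<rho> n i, \<rho> n (i + k n - 1)]\<close>, hence it does not reach \<open>t\<close>.\<close>

lemma preav_small:
  assumes i: "i + k n < R n" and E: "0 \<le> E"
    and osc: "\<And>j. i \<le> j \<Longrightarrow> j \<le> i + k n - 1 \<Longrightarrow> \<bar>f (\<rho> n j) - f (\<rho> n i)\<bar> \<le> E"
  shows "\<bar>preav f n i\<bar> \<le> 3 * C * E"
proof -
  have "\<bar>preav f n i\<bar> \<le> E * (\<bar>wt (k n) (R n) i\<bar> + (\<Sum>m<R n. \<bar>wt (k n) (Suc m) i - wt (k n) m i\<bar>))"
    unfolding preav_window[OF i]
  proof (rule abel_bound_window)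
    fix j assume j: "i \<le> j" "j \<le> i + k n - 1"
    have "(\<Sum>m=i..<j. incr f (\<rho> n) m) = f (\<rho> n j) - f (\<rho> n i)"
      unfolding incr_def using telescope_interval[OF j(1), of "\<lambda>m. f (\<rho> n m)"] .
    with osc[OF j] show "\<bar>\<Sum>m=i..<j. incr f (\<rho> n) m\<bar> \<le> E" by simp
  qed (use i k_pos[of n] in auto)
  also have "\<dots> \<le> E * (3 * C)" using wt_total E by (intro mult_left_mono) auto
  finally show ?thesis by (simp add: mult.commute)
qed

text \<open>Once \<open>J\<close> is removed from the increment across \<open>s\<close>, every
  partial sum compares two path values near the same one-sided limit or near matching ones, hence is
  at most \<open>2 * E\<close>. Abel summation with weight variation \<open>3 * C\<close> does the
  rest.\<close>

lemma preav_one_jump: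
  assumes i: "i + k n < R n" and \<mu>: "i \<le> \<mu>" "Suc \<mu> < i + k n"
    and s: "\<rho> n \<mu> < s" "s \<le> \<rho> n (Suc \<mu>)" and u: "real (k n) * \<Delta> n < u" and E: "0 \<le> E"
    and left: "\<And>x. 0 \<le> x \<Longrightarrow> s - u < x \<Longrightarrow> x < s \<Longrightarrow> \<bar>f x - (f s - J)\<bar> \<le> E"
    and right: "\<And>x. s \<le> x \<Longrightarrow> x < s + u \<Longrightarrow> \<bar>f x - f s\<bar> \<le> E"
  shows "\<bar>preav f n i - wt (k n) \<mu> i * J\<bar> \<le> 3 * C * (2 * E)"
proof -
  let ?y = "\<lambda>m. incr f (\<rho> n) m - of_bool (m = \<mu>) * J"
  have "preav f n i - wt (k n) \<mu> i * J
      = (\<Sum>m=i..<i + k n - 1. wt (k n) m i * incr f (\<rho> n) m) - (\<Sum>m=i..<i + k n - 1. if m = \<mu> then wt (k n) m i * J else 0)"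
    unfolding preav_window[OF i] using \<mu> by (subst sum.delta) auto
  also have "\<dots> = (\<Sum>m=i..<i + k n - 1. wt (k n) m i * ?y m)"
    unfolding sum_subtractf[symmetric] by (intro sum.cong) (auto simp: right_diff_distrib)
  also have "\<bar>\<dots>\<bar> \<le> (2 * E) * (\<bar>wt (k n) (R n) i\<bar> + (\<Sum>m<R n. \<bar>wt (k n) (Suc m) i - wt (k n) m i\<bar>))"
  proof (rule abel_bound_window)
    fix j assume j: "i \<le> j" "j \<le> i + k n - 1"
    have sum: "(\<Sum>m=i..<j. ?y m) = f (\<rho> n j) - f (\<rho> n i) - of_bool (\<mu> < j) * J"
    proof -
      have "(\<Sum>m=i..<j. incr f (\<rho> n) m) = f (\<rho> n j) - f (\<rho> n i)"
        unfolding incr_def using telescope_interval[OF j(1), of "\<lambda>m. f (\<rho> n m)"] .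
      moreover have "(\<Sum>m=i..<j. of_bool (m = \<mu>) * J) = (\<Sum>m=i..<j. if m = \<mu> then J else 0)"
        by (intro sum.cong) auto
      moreover have "\<dots> = of_bool (\<mu> < j) * J" using \<mu> by (subst sum.delta) auto
      ultimately show ?thesis by (simp add: sum_subtractf)
    qed
    have pos: "0 \<le> \<rho> n i" "0 \<le> \<rho> n j" using j i by (auto intro!: is_partition_bounds(1)[OF part])
    have im: "\<rho> n i \<le> \<rho> n \<mu>" using \<mu> i by (intro is_partition_mono[OF part]) auto
    have span: "\<rho> n (i + k n - 1) - \<rho> n i < u"
    proof -
      have "\<rho> n (i + k n - 1) - \<rho> n i \<le> real (i + k n - 1 - i) * \<Delta> n"
        by (rule grid_diff_le[OF \<Delta>_pos]) (use k_pos[of n] in simp)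
      also have "\<dots> \<le> real (k n) * \<Delta> n" using \<Delta>_pos[of n] by (intro mult_right_mono) auto
      finally show ?thesis using u by simp
    qed
    have je: "\<rho> n j \<le> \<rho> n (i + k n - 1)" "\<rho> n (Suc \<mu>) \<le> \<rho> n (i + k n - 1)"
      using j \<mu> i by (auto intro!: is_partition_mono[OF part])
    have Li: "\<bar>f (\<rho> n i) - (f s - J)\<bar> \<le> E"
      using pos im span je s by (intro left) auto
    show "\<bar>\<Sum>m=i..<j. ?y m\<bar> \<le> 2 * E"
    proof (cases "\<mu> < j")
      case True
      then have "\<rho> n (Suc \<mu>) \<le> \<rho> n j" using j i by (intro is_partition_mono[OF part]) auto
      with s span je im have "\<bar>f (\<rho> n j) - f s\<bar> \<le> E" by (intro right) auto
      with Li True show ?thesis unfolding sum by simp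
    next
      case False
      then have "\<rho> n j \<le> \<rho> n \<mu>" "\<rho> n i \<le> \<rho> n j" using j i \<mu> by (auto intro!: is_partition_mono[OF part])
      with s span je im pos have "\<bar>f (\<rho> n j) - (f s - J)\<bar> \<le> E" by (intro left) auto
      with Li False show ?thesis unfolding sum by simp
    qed
  qed (use i k_pos[of n] in auto)
  also have "\<dots> \<le> (2 * E) * (3 * C)" using wt_total E by (intro mult_left_mono) auto
  finally show ?thesis by (simp add: mult.commute)
qed

text \<open>Index of the half-open grid interval containing \<open>s\<close>. A jump at a grid point
  belongs to the increment ending there, whence ceiling minus one.\<close>

definition jidx :: "nat \<Rightarrow> real \<Rightarrow> nat" where
  "jidx n s = nat (\<lceil>s / \<Delta> n\<rceil> - 1)"

lemma jidx_bounds: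
  assumes "0 < s"
  shows "real (jidx n s) * \<Delta> n < s" "s \<le> real (Suc (jidx n s)) * \<Delta> n"
proof -
  have "0 < s / \<Delta> n" using assms \<Delta>_pos[of n] by simp
  then have "0 < \<lceil>s / \<Delta> n\<rceil>" by simp
  then have "real (jidx n s) < s / \<Delta> n" "s / \<Delta> n \<le> real (Suc (jidx n s))"
    unfolding jidx_def by linarith+
  then show "real (jidx n s) * \<Delta> n < s" "s \<le> real (Suc (jidx n s)) * \<Delta> n"
    using \<Delta>_pos[of n] by (simp_all add: less_divide_eq divide_le_eq)
qed

lemma in_window_iff:
  assumes s: "0 < s" and i: "i + k n < R n"
  shows "\<rho> n i < s \<and> s \<le> \<rho> n (i + k n - 1) \<longleftrightarrow> i \<le> jidx n s \<and> Suc (jidx n s) < i + k n"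
proof -
  note b = jidx_bounds[OF s, of n]
  have r: "\<rho> n i = real i * \<Delta> n" "\<rho> n (i + k n - 1) = real (i + k n - 1) * \<Delta> n"
    using i by (auto intro!: rho_eq)
  have d: "0 < \<Delta> n" by (rule \<Delta>_pos)
  have "real i * \<Delta> n < s \<longleftrightarrow> i \<le> jidx n s"
  proof
    assume "real i * \<Delta> n < s"
    with b have "real i * \<Delta> n < real (Suc (jidx n s)) * \<Delta> n" by simp
    with d show "i \<le> jidx n s" by (simp only: mult_less_cancel_right_pos of_nat_less_iff less_Suc_eq_le)
  next
    assume "i \<le> jidx n s"
    then have "real i * \<Delta> n \<le> real (jidx n s) * \<Delta> n" using d by (intro mult_right_mono) auto
    with b show "real i * \<Delta> n < s" by simp
  qed
  moreover have "s \<le> real (i + k n - 1) * \<Delta> n \<longleftrightarrow> Suc (jidx n s) < i + k n"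
  proof
    assume "s \<le> real (i + k n - 1) * \<Delta> n"
    with b have "real (jidx n s) * \<Delta> n < real (i + k n - 1) * \<Delta> n" by simp
    with d have "jidx n s < i + k n - 1" by (simp only: mult_less_cancel_right_pos of_nat_less_iff)
    then show "Suc (jidx n s) < i + k n" by simp
  next
    assume "Suc (jidx n s) < i + k n"
    then have "Suc (jidx n s) \<le> i + k n - 1" by simp
    then have "real (Suc (jidx n s)) * \<Delta> n \<le> real (i + k n - 1) * \<Delta> n" using d by (intro mult_right_mono) (auto simp del: of_nat_Suc)
    with b show "s \<le> real (i + k n - 1) * \<Delta> n" by simp
  qed
  ultimately show ?thesis unfolding r by simp
qed

text \<open>Keeps both edges away from the jump, so that windows through it occur at all
  positions.\<close>

lemma jidx_interior:
  assumes s: "0 < s" "s < t"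
  shows "\<forall>\<^sub>F n in sequentially. k n \<le> jidx n s \<and> jidx n s + k n < R n"
proof -
  have "(\<lambda>n. real (k n) * \<Delta> n + \<Delta> n) \<longlonglongrightarrow> 0 + 0" by (intro tendsto_add u_lim \<Delta>_lim)
  then have "\<forall>\<^sub>F n in sequentially. real (k n) * \<Delta> n + \<Delta> n < s" using s by (intro order_tendstoD) auto
  moreover have "\<forall>\<^sub>F n in sequentially. real (k n) * \<Delta> n < t - s" using s by (intro order_tendstoD[OF u_lim]) auto
  ultimately show ?thesis
  proof eventually_elim
    case (elim n)
    note b = jidx_bounds[OF s(1), of n]
    have d: "0 < \<Delta> n" by (rule \<Delta>_pos)
    have "real (k n) * \<Delta> n < real (jidx n s) * \<Delta> n"
      using elim(1) b(2) by (simp add: distrib_right)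
    then have "k n < jidx n s" using d by simp
    moreover have "real (jidx n s + k n) * \<Delta> n < real (R n) * \<Delta> n"
      using elim(2) b(1) grid_size_gt[OF d t] by (simp add: distrib_right)
    then have "jidx n s + k n < R n" using d by (simp only: mult_less_cancel_right_pos of_nat_less_iff)
    ultimately show ?case by simp
  qed
qed

text \<open>Successive windows see the jump with the weights \<open>g (j / k n)\<close> for
  successive \<open>j\<close>, so the average over the windows is nearly a Riemann sum in
  \<open>g\<close>.\<close>

lemma one_jump_tendsto:
  assumes f: "cadlag f" and s: "0 < s" "s < t" and \<psi>: "continuous_on UNIV \<psi>" and \<psi>0: "\<psi> 0 = 0"
  shows "(\<lambda>n. (\<Sum>i | i < R n - k n \<and> i \<le> jidx n s \<and> Suc (jidx n s) < i + k n. \<psi> (preav f n i)) / real (k n))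
    \<longlonglongrightarrow> integral {0..1} (\<lambda>x. \<psi> (g x * jump f s))"
proof -
  define J where "J = jump f s"
  define T where "T n = (\<Sum>j<k n. \<psi> (g (real j / real (k n)) * J)) / real (k n)" for n
  define S where "S n = (\<Sum>i | i < R n - k n \<and> i \<le> jidx n s \<and> Suc (jidx n s) < i + k n. \<psi> (preav f n i)) / real (k n)" for n
  have "continuous_on {0..1} (\<lambda>x. \<psi> (g x * J))"
    by (rule continuous_on_compose2[OF \<psi>]) (auto intro!: continuous_on_mult_right g_continuous)
  from riemann_sum_tendsto[OF this k_lim] have T: "T \<longlonglongrightarrow> integral {0..1} (\<lambda>x. \<psi> (g x * J))" unfolding T_def .
  have ST: "(\<lambda>n. S n - T n) \<longlonglongrightarrow> 0"
  proof (rule tendstoI)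
    fix \<epsilon> :: real assume eps: "0 < \<epsilon>"
    define B where "B = C * \<bar>J\<bar> + 1"
    have "uniformly_continuous_on {-B..B} \<psi>"
      by (intro compact_uniformly_continuous continuous_on_subset[OF \<psi>]) auto
    then obtain d where d: "0 < d" "\<And>x y. x \<in> {-B..B} \<Longrightarrow> y \<in> {-B..B} \<Longrightarrow> dist y x < d \<Longrightarrow> dist (\<psi> y) (\<psi> x) < \<epsilon> / 2"
      unfolding uniformly_continuous_on_def using eps half_gt_zero by meson
    \<comment> \<open>Makes \<open>3 * C * (2 * E)\<close> half of \<open>min d 1\<close>: small
      enough for the uniform continuity of \<open>\<psi>\<close>, and small enough to keep the
      pre-averages inside \<open>[-B, B]\<close>.\<close>
    define E where "E = min d 1 / (12 * C)"
    have E: "0 < E" "3 * C * (2 * E) < d" "3 * C * (2 * E) \<le> 1"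
      unfolding E_def using d(1) C_pos by (auto simp: min_def)
    have "\<forall>\<^sub>F x in at_left s. dist (f x) (f s - J) < E"
      using cadlag_left_limit[OF f s(1)] E(1) unfolding J_def by (intro tendstoD)
    then obtain a where a: "a < s" "\<And>x. a < x \<Longrightarrow> x < s \<Longrightarrow> \<bar>f x - (f s - J)\<bar> < E"
      unfolding eventually_at_left_field dist_real_def by blast
    have "(f \<longlongrightarrow> f s) (at_right s)" using f s unfolding cadlag_def by simp
    then have "\<forall>\<^sub>F x in at_right s. dist (f x) (f s) < E" using E(1) by (intro tendstoD)
    then obtain b where b: "s < b" "\<And>x. s < x \<Longrightarrow> x < b \<Longrightarrow> \<bar>f x - f s\<bar> < E"
      unfolding eventually_at_right_field dist_real_def by blast
    define u where "u = min (s - a) (b - s)"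
    have u: "0 < u" unfolding u_def using a b by simp
    have left: "\<bar>f x - (f s - J)\<bar> \<le> E" if "s - u < x" "x < s" for x
    proof -
      have "a < x" using that unfolding u_def by linarith
      from a(2)[OF this that(2)] show ?thesis by simp
    qed
    have right: "\<bar>f x - f s\<bar> \<le> E" if "s \<le> x" "x < s + u" for x
    proof (cases "x = s")
      case False
      with that have "s < x" "x < b" unfolding u_def by linarith+
      from b(2)[OF this] show ?thesis by simp
    qed (use E(1) in simp)
    from jidx_interior[OF s] order_tendstoD(2)[OF u_lim u]
    show "\<forall>\<^sub>F n in sequentially. dist (S n - T n) 0 < \<epsilon>"
    proof eventually_elim
      case (elim n)
      define \<mu> where "\<mu> = jidx n s"
      have \<mu>: "k n \<le> \<mu>" "\<mu> + k n < R n" using elim unfolding \<mu>_def by auto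
      have set: "{i. i < R n - k n \<and> i \<le> \<mu> \<and> Suc \<mu> < i + k n} = {Suc \<mu> - k n<..\<mu>}"
        using \<mu> by auto
      have "(\<Sum>i\<in>{Suc \<mu> - k n<..\<mu>}. \<psi> (wt (k n) \<mu> i * J)) = (\<Sum>j\<in>{1..<k n}. \<psi> (g (real j / real (k n)) * J))"
        by (rule sum.reindex_bij_witness[of _ "\<lambda>j. Suc \<mu> - j" "\<lambda>i. Suc \<mu> - i"])
          (use \<mu> in \<open>auto simp: wt_def\<close>)
      \<comment> \<open>Position \<open>j = 0\<close> is free, as \<open>g\<close> vanishes at 0 and
        so does \<open>\<psi>\<close>.\<close>
      also have "\<dots> = (\<Sum>j<k n. \<psi> (g (real j / real (k n)) * J))"
        using k_pos[of n] by (intro sum.mono_neutral_left) (auto simp: g_outside \<psi>0 Suc_le_eq)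
      finally have T': "T n = (\<Sum>i\<in>{Suc \<mu> - k n<..\<mu>}. \<psi> (wt (k n) \<mu> i * J)) / real (k n)"
        unfolding T_def by simp
      have "S n - T n = (\<Sum>i\<in>{Suc \<mu> - k n<..\<mu>}. \<psi> (preav f n i) - \<psi> (wt (k n) \<mu> i * J)) / real (k n)"
        unfolding S_def T' \<mu>_def[symmetric] set by (simp add: diff_divide_distrib sum_subtractf)
      also have "\<bar>\<dots>\<bar> \<le> (\<Sum>i\<in>{Suc \<mu> - k n<..\<mu>}. \<epsilon> / 2) / real (k n)"
        unfolding abs_divide abs_of_nat
      proof (intro divide_right_mono order_trans[OF sum_abs sum_mono])
        fix i assume "i \<in> {Suc \<mu> - k n<..\<mu>}"
        then have i: "i + k n < R n" "i \<le> \<mu>" "Suc \<mu> < i + k n" using \<mu> by auto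
        have "\<rho> n \<mu> < s" "s \<le> \<rho> n (Suc \<mu>)"
          using jidx_bounds[OF s(1), of n] \<mu> k_pos[of n] unfolding \<mu>_def[symmetric] by (simp_all add: rho_eq del: of_nat_Suc)
        from preav_one_jump[where E = E and f = f, OF i this elim(2) _ left right] E(1)
        have close: "\<bar>preav f n i - wt (k n) \<mu> i * J\<bar> \<le> 3 * C * (2 * E)" by simp
        have "\<bar>wt (k n) \<mu> i * J\<bar> \<le> C * \<bar>J\<bar>" unfolding abs_mult using wt_bound by (intro mult_right_mono) auto
        with close E have "preav f n i \<in> {-B..B}" "wt (k n) \<mu> i * J \<in> {-B..B}" unfolding B_def by auto
        then have "dist (\<psi> (preav f n i)) (\<psi> (wt (k n) \<mu> i * J)) < \<epsilon> / 2"
          using close E by (intro d(2)) (auto simp: dist_real_def)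
        then show "\<bar>\<psi> (preav f n i) - \<psi> (wt (k n) \<mu> i * J)\<bar> \<le> \<epsilon> / 2" by (simp add: dist_real_def)
      qed simp
      also have "\<dots> \<le> \<epsilon> / 2"
      proof -
        have "real (card {Suc \<mu> - k n<..\<mu>}) \<le> real (k n)" by simp
        then have "real (card {Suc \<mu> - k n<..\<mu>}) * (\<epsilon> / 2) \<le> real (k n) * (\<epsilon> / 2)"
          using eps by (intro mult_right_mono) auto
        then show ?thesis using k_pos[of n] by (simp add: divide_le_eq mult.commute)
      qed
      finally show ?case using eps by simp
    qed
  qed
  have "(\<lambda>n. (S n - T n) + T n) \<longlonglongrightarrow> 0 + integral {0..1} (\<lambda>x. \<psi> (g x * J))" by (intro tendsto_add ST T)
  then show ?thesis unfolding S_def J_def by simp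
qed

text \<open>Once windows are shorter than the gaps of \<open>D0\<close>, each contains at most one
  point of \<open>D\<close>. Windows without one give pre-averages below \<open>e\<close>, where
  \<open>\<psi>\<close> vanishes; the others are grouped by their point, and each group is a
  one-jump average.\<close>

theorem preav_functional_tendsto:
  assumes f: "cadlag f" and \<psi>: "continuous_on UNIV \<psi>" and e: "0 < e" and \<psi>0: "\<And>x. \<bar>x\<bar> \<le> e \<Longrightarrow> \<psi> x = 0"
  obtains D where "finite D" "D \<subseteq> {0<..<t}" "\<And>s. s \<in> {0<..<t} \<Longrightarrow> s \<notin> D \<Longrightarrow> C * \<bar>jump f s\<bar> \<le> e"
    "(\<lambda>n. (\<Sum>i<R n - k n. \<psi> (preav f n i)) / real (k n)) \<longlonglongrightarrow> (\<Sum>s\<in>D. integral {0..1} (\<lambda>x. \<psi> (g x * jump f s)))"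
proof -
  \<comment> \<open>By \<open>preav_small\<close> a window with oscillation \<open>e0\<close> has a
    pre-average of size at most \<open>3 * C * e0 = e\<close>.\<close>
  define e0 where "e0 = e / (3 * C)"
  have e0: "0 < e0" "3 * C * e0 = e" unfolding e0_def using e C_pos by auto
  from cadlag_osc_partition[OF f e0(1) t] obtain D0 \<delta> where D0: "finite D0" "\<delta> > 0"
    "\<And>x y. 0 \<le> x \<Longrightarrow> x \<le> y \<Longrightarrow> y \<le> t \<Longrightarrow> D0 \<inter> {x<..y} = {} \<Longrightarrow> \<bar>f y - f x\<bar> \<le> e0"
    "\<And>x y. x \<in> D0 \<Longrightarrow> y \<in> D0 \<Longrightarrow> x < y \<Longrightarrow> \<delta> \<le> y - x" by metis
  \<comment> \<open>The point \<open>t\<close> is discarded, because every window ends strictly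
    before it.\<close>
  define D where "D = D0 \<inter> {0<..<t}"
  have finD: "finite D" and Dsub: "D \<subseteq> {0<..<t}" unfolding D_def using D0 by auto
  have jumps: "C * \<bar>jump f s\<bar> \<le> e" if s: "s \<in> {0<..<t}" "s \<notin> D" for s
  proof -
    have "\<bar>jump f s\<bar> \<le> e0"
      by (rule cadlag_jump_le[OF f _ D0(1)]) (use s D0(3) in \<open>auto simp: D_def\<close>)
    then have "C * \<bar>jump f s\<bar> \<le> C * e0" using C_pos by (intro mult_left_mono) auto
    also have "\<dots> \<le> 3 * C * e0" using mult_pos_pos[OF C_pos e0(1)] by simp
    finally show ?thesis unfolding e0(2) .
  qed
  let ?W = "\<lambda>n s. {i. i < R n - k n \<and> i \<le> jidx n s \<and> Suc (jidx n s) < i + k n}"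
  have "(\<lambda>n. \<Sum>s\<in>D. (\<Sum>i\<in>?W n s. \<psi> (preav f n i)) / real (k n))
      \<longlonglongrightarrow> (\<Sum>s\<in>D. integral {0..1} (\<lambda>x. \<psi> (g x * jump f s)))"
    using Dsub e by (intro tendsto_sum one_jump_tendsto[OF f _ _ \<psi>] \<psi>0) auto
  moreover have "\<forall>\<^sub>F n in sequentially. (\<Sum>s\<in>D. (\<Sum>i\<in>?W n s. \<psi> (preav f n i)) / real (k n))
      = (\<Sum>i<R n - k n. \<psi> (preav f n i)) / real (k n)"
    using order_tendstoD(2)[OF u_lim D0(2)]
  proof eventually_elim
    case (elim n)
    have each: "\<psi> (preav f n i) = (\<Sum>s\<in>D. if i \<in> ?W n s then \<psi> (preav f n i) else 0)" if i: "i < R n - k n" for i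
    proof -
      have i': "i + k n < R n" using i by simp
      have r: "\<rho> n i = real i * \<Delta> n" "\<rho> n (i + k n - 1) = real (i + k n - 1) * \<Delta> n" "\<rho> n (i + k n) = real (i + k n) * \<Delta> n"
        by (rule rho_eq, use i' in simp)+
      have lt: "\<rho> n (i + k n - 1) < t" "0 \<le> \<rho> n i"
      proof -
        have "real (i + k n - 1) * \<Delta> n < real (i + k n) * \<Delta> n" using \<Delta>_pos[of n] k_pos[of n] by simp
        also have "\<dots> = \<rho> n (i + k n)" by (simp only: r)
        also have "\<dots> \<le> t" using i' by (intro is_partition_bounds(2)[OF part]) simp
        finally show "\<rho> n (i + k n - 1) < t" by (simp only: r)
        show "0 \<le> \<rho> n i" using i' by (intro is_partition_bounds(1)[OF part]) simp
      qed
      have W: "i \<in> ?W n s \<longleftrightarrow> \<rho> n i < s \<and> s \<le> \<rho> n (i + k n - 1)" if "s \<in> D" for s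
        using in_window_iff[OF _ i', of s] that Dsub i by auto
      show ?thesis
      proof (cases "\<exists>s\<in>D. i \<in> ?W n s")
        case True
        then obtain s where s: "s \<in> D" "i \<in> ?W n s" by blast
        have "i \<notin> ?W n s'" if s': "s' \<in> D" "s' \<noteq> s" for s'
        proof
          assume "i \<in> ?W n s'"
          with W[OF s'(1)] W[OF s(1)] s have "\<bar>s - s'\<bar> < \<rho> n (i + k n - 1) - \<rho> n i" by auto
          also have "\<dots> \<le> real (i + k n - 1 - i) * \<Delta> n"
            by (rule grid_diff_le[OF \<Delta>_pos]) (use k_pos[of n] in simp)
          also have "\<dots> \<le> real (k n) * \<Delta> n" using \<Delta>_pos[of n] by (intro mult_right_mono) auto
          also have "\<dots> < \<delta>" by (rule elim)
          finally show False using D0(4)[of s s'] D0(4)[of s' s] s s' unfolding D_def by force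
        qed
        then have "(\<Sum>s'\<in>D. if i \<in> ?W n s' then \<psi> (preav f n i) else 0) = (\<Sum>s'\<in>D. if s' = s then \<psi> (preav f n i) else 0)"
          using s by (intro sum.cong refl) metis
        then show ?thesis using s finD by simp
      next
        case False
        have nD: "D0 \<inter> {\<rho> n i<..\<rho> n (i + k n - 1)} = {}"
        proof (rule ccontr)
          assume "\<not> ?thesis"
          then obtain s where s: "s \<in> D0" "\<rho> n i < s" "s \<le> \<rho> n (i + k n - 1)" by auto
          with lt have "s \<in> D" unfolding D_def by auto
          with W[OF this] s False show False by blast
        qed
        have "\<bar>preav f n i\<bar> \<le> 3 * C * e0"
        proof (rule preav_small[OF i' less_imp_le[OF e0(1)]])
          fix j assume j: "i \<le> j" "j \<le> i + k n - 1"
          have m: "\<rho> n i \<le> \<rho> n j" "\<rho> n j \<le> \<rho> n (i + k n - 1)"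
            using j i' by (auto intro!: is_partition_mono[OF part])
          show "\<bar>f (\<rho> n j) - f (\<rho> n i)\<bar> \<le> e0"
            using m lt nD by (intro D0(3)) auto
        qed
        then have 0: "\<psi> (preav f n i) = 0" using e0 by (intro \<psi>0) simp
        show ?thesis unfolding 0 by simp
      qed
    qed
    have "(\<Sum>i<R n - k n. \<psi> (preav f n i)) = (\<Sum>i<R n - k n. \<Sum>s\<in>D. if i \<in> ?W n s then \<psi> (preav f n i) else 0)"
      using each by (intro sum.cong) auto
    also have "\<dots> = (\<Sum>s\<in>D. \<Sum>i<R n - k n. if i \<in> ?W n s then \<psi> (preav f n i) else 0)" by (rule sum.swap)
    also have "\<dots> = (\<Sum>s\<in>D. \<Sum>i\<in>?W n s. \<psi> (preav f n i))"
      by (intro sum.cong[OF refl] sum.mono_neutral_cong_right) auto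
    finally show ?case by (simp add: sum_divide_distrib)
  qed
  ultimately have "(\<lambda>n. (\<Sum>i<R n - k n. \<psi> (preav f n i)) / real (k n))
      \<longlonglongrightarrow> (\<Sum>s\<in>D. integral {0..1} (\<lambda>x. \<psi> (g x * jump f s)))"
    by (rule Lim_transform_eventually)
  with that[OF finD Dsub jumps] show ?thesis by blast
qed

end

section \<open>The case \<open>p > 2\<close>\<close>

definition thr :: "real \<Rightarrow> real \<Rightarrow> real \<Rightarrow> real" where
  "thr p e x = max 0 (\<bar>x\<bar> powr p - e powr p)"

lemma thr_continuous: "0 < p \<Longrightarrow> continuous_on UNIV (thr p e)"
  unfolding thr_def
  by (intro continuous_on_max continuous_on_const continuous_on_diff continuous_on_powr'
      continuous_on_rabs continuous_on_id) auto

lemma thr_zero: "0 < p \<Longrightarrow> \<bar>x\<bar> \<le> e \<Longrightarrow> thr p e x = 0"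
  using powr_mono2[of p "\<bar>x\<bar>" e] unfolding thr_def by simp

lemma thr_nonneg: "0 \<le> thr p e x"
  unfolding thr_def by simp

lemma thr_le: "thr p e x \<le> \<bar>x\<bar> powr p"
  unfolding thr_def by simp

lemma thr_ge: "\<bar>x\<bar> powr p - e powr p \<le> thr p e x"
  unfolding thr_def by simp

lemma thr_antimono: "0 < p \<Longrightarrow> 0 \<le> e' \<Longrightarrow> e' \<le> e \<Longrightarrow> thr p e x \<le> thr p e' x"
  using powr_mono2[of p e' e] unfolding thr_def by simp

text \<open>Up to \<open>e\<close>, write |x|^p as |x|^(p-2) x^2; beyond \<open>e\<close>, only the
  subtracted constant e^p = e^(p-2) e^2 has to be absorbed.\<close>

lemma thr_remainder:
  assumes p: "2 \<le> p" and e: "0 < e"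
  shows "\<bar>x\<bar> powr p \<le> thr p e x + e powr (p - 2) * x\<^sup>2"
proof (cases "x = 0")
  case False
  have sq: "y powr p = y powr (p - 2) * y\<^sup>2" if "0 < y" for y :: real
    using that powr_add[of y "p - 2" 2] by simp
  show ?thesis
  proof (cases "\<bar>x\<bar> \<le> e")
    case True
    have "\<bar>x\<bar> powr p = \<bar>x\<bar> powr (p - 2) * x\<^sup>2" using sq[of "\<bar>x\<bar>"] False by simp
    also have "\<dots> \<le> e powr (p - 2) * x\<^sup>2" using True p by (intro mult_right_mono powr_mono2) auto
    finally show ?thesis using thr_nonneg[of p e x] by simp
  next
    case False
    have "e powr p = e powr (p - 2) * e\<^sup>2" by (rule sq[OF e])
    also have "\<dots> \<le> e powr (p - 2) * x\<^sup>2"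
      using False e power_mono[of e "\<bar>x\<bar>" 2] by (intro mult_left_mono) auto
    finally show ?thesis using thr_ge[of x p e] by simp
  qed
qed (use thr_nonneg[of p e 0] p in simp)

text \<open>Holds also for divergent sums, since both sides then take the default value 0.\<close>

lemma infsum_eq_enn2real_nn_integral:
  assumes f: "\<And>x. x \<in> A \<Longrightarrow> 0 \<le> (f x :: real)"
  shows "infsum f A = enn2real (\<integral>\<^sup>+x. ennreal (f x) \<partial>count_space A)"
proof -
  have L: "lebesgue_integral (count_space A) f = enn2real (\<integral>\<^sup>+x. ennreal (f x) \<partial>count_space A)"
    using f by (intro integral_eq_nn_integral) (auto simp: AE_count_space)
  have abs: "Infinite_Sum.abs_summable_on f A \<longleftrightarrow> integrable (count_space A) f"
    unfolding abs_summable_equivalent Infinite_Set_Sum.abs_summable_on_def ..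
  show ?thesis
  proof (cases "integrable (count_space A) f")
    case True
    then have "infsetsum f A = infsum f A"
      by (intro infsetsum_infsum) (simp add: Infinite_Set_Sum.abs_summable_on_def)
    with L show ?thesis unfolding infsetsum_def by simp
  next
    case False
    then have "lebesgue_integral (count_space A) f = 0" by (rule not_integrable_integral_eq)
    moreover have "infsum f A = 0"
      using False abs summable_on_iff_abs_summable_on_real[of f A] by (intro infsum_not_exists) blast
    ultimately show ?thesis using L by simp
  qed
qed

context weight
begin

lemma integral_thr_integrable:
  assumes "0 < p"
  shows "(\<lambda>x. thr p e (g x * a)) integrable_on {0..1}" "(\<lambda>x. \<bar>g x * a\<bar> powr p) integrable_on {0..1}"
proof -
  have "continuous_on {0..1} (\<lambda>x. thr p e (g x * a))"
    by (rule continuous_on_compose2[OF thr_continuous[OF assms]]) (auto intro!: continuous_on_mult_right g_continuous)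
  then show "(\<lambda>x. thr p e (g x * a)) integrable_on {0..1}" by (rule integrable_continuous_real)
  have "continuous_on {0..1} (\<lambda>x. \<bar>g x * a\<bar> powr p)"
    using assms by (intro continuous_on_powr' continuous_on_rabs continuous_on_mult_right g_continuous continuous_on_const) auto
  then show "(\<lambda>x. \<bar>g x * a\<bar> powr p) integrable_on {0..1}" by (rule integrable_continuous_real)
qed

lemma integral_powr_scaled: "0 < p \<Longrightarrow> integral {0..1} (\<lambda>x. \<bar>g x * a\<bar> powr p) = gbar g p * \<bar>a\<bar> powr p"
  by (simp add: gbar_eq_integral abs_mult powr_mult)

lemma gbar_nonneg: "0 < p \<Longrightarrow> 0 \<le> gbar g p"
  by (simp add: gbar_eq_integral integral_nonneg[OF integrable_continuous_real[OF powr_continuous]])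

lemma integral_thr_nonneg: "0 < p \<Longrightarrow> 0 \<le> integral {0..1} (\<lambda>x. thr p e (g x * a))"
  by (intro integral_nonneg integral_thr_integrable thr_nonneg)

lemma integral_thr_le: "0 < p \<Longrightarrow> integral {0..1} (\<lambda>x. thr p e (g x * a)) \<le> gbar g p * \<bar>a\<bar> powr p"
  unfolding integral_powr_scaled[symmetric] by (intro integral_le integral_thr_integrable thr_le)

lemma integral_thr_ge:
  assumes "0 < p"
  shows "gbar g p * \<bar>a\<bar> powr p \<le> integral {0..1} (\<lambda>x. thr p e (g x * a)) + e powr p"
proof -
  have "integral {0..1} (\<lambda>x. \<bar>g x * a\<bar> powr p) \<le> integral {0..1} (\<lambda>x. thr p e (g x * a) + e powr p)"
    using thr_ge[of "g _ * a" p e] assms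
    by (intro integral_le integrable_add integral_thr_integrable integrable_const_ivl) (auto simp: algebra_simps)
  also have "\<dots> = integral {0..1} (\<lambda>x. thr p e (g x * a)) + e powr p"
    by (subst integral_add) (use integral_thr_integrable[OF assms] in auto)
  finally show ?thesis unfolding integral_powr_scaled[OF assms] .
qed

lemma integral_thr_remainder:
  assumes p: "2 \<le> p" and e: "0 < e"
  shows "gbar g p * \<bar>a\<bar> powr p \<le> integral {0..1} (\<lambda>x. thr p e (g x * a)) + e powr (p - 2) * (gbar g 2 * \<bar>a\<bar> powr 2)"
proof -
  have p0: "0 < p" using p by simp
  note int = integral_thr_integrable(1)[OF p0, of e a] integral_thr_integrable(2)[OF p0, of a] integral_thr_integrable(2)[of 2 a, simplified]
  have "integral {0..1} (\<lambda>x. \<bar>g x * a\<bar> powr p)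
      \<le> integral {0..1} (\<lambda>x. thr p e (g x * a) + e powr (p - 2) * (g x * a)\<^sup>2)"
    using int thr_remainder[OF p e] by (intro integral_le integrable_add integrable_on_mult_right) auto
  also have "\<dots> = integral {0..1} (\<lambda>x. thr p e (g x * a)) + e powr (p - 2) * integral {0..1} (\<lambda>x. (g x * a)\<^sup>2)"
    using int by (subst integral_add) (auto intro: integrable_on_mult_right)
  also have "integral {0..1} (\<lambda>x. (g x * a)\<^sup>2) = gbar g 2 * \<bar>a\<bar> powr 2"
    unfolding integral_powr_scaled[OF zero_less_numeral, symmetric] by simp
  finally show ?thesis unfolding integral_powr_scaled[OF p0] .
qed

lemma integral_thr_antimono:
  "0 < p \<Longrightarrow> 0 \<le> e' \<Longrightarrow> e' \<le> e \<Longrightarrow> integral {0..1} (\<lambda>x. thr p e (g x * a)) \<le> integral {0..1} (\<lambda>x. thr p e' (g x * a))"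
  by (intro integral_le integral_thr_integrable thr_antimono)

lemma integral_thr_tendsto:
  assumes p: "0 < p"
  shows "(\<lambda>m. integral {0..1} (\<lambda>x. thr p (1 / real (Suc m)) (g x * a))) \<longlonglongrightarrow> gbar g p * \<bar>a\<bar> powr p"
proof (rule tendsto_sandwich)
  have "(\<lambda>m. (1 / real (Suc m)) powr p) \<longlonglongrightarrow> 0 powr p"
    by (rule tendsto_powr2[OF LIMSEQ_Suc[OF lim_1_over_n] tendsto_const]) (use p in auto)
  then have "(\<lambda>m. gbar g p * \<bar>a\<bar> powr p - (1 / real (Suc m)) powr p) \<longlonglongrightarrow> gbar g p * \<bar>a\<bar> powr p - 0"
    using p by (intro tendsto_diff tendsto_const) simp
  then show "(\<lambda>m. gbar g p * \<bar>a\<bar> powr p - (1 / real (Suc m)) powr p) \<longlonglongrightarrow> gbar g p * \<bar>a\<bar> powr p" by simp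
  show "\<forall>\<^sub>F m in sequentially. gbar g p * \<bar>a\<bar> powr p - (1 / real (Suc m)) powr p
      \<le> integral {0..1} (\<lambda>x. thr p (1 / real (Suc m)) (g x * a))"
    using integral_thr_ge[OF p, of a] by (intro always_eventually allI) (simp add: diff_le_eq)
qed (use integral_thr_le[OF p] in auto)

end

section \<open>Jump sums as limits of thresholded pre-average functionals\<close>

context preaverage_setup
begin

abbreviation preav_mean :: "(real \<Rightarrow> real) \<Rightarrow> (real \<Rightarrow> real) \<Rightarrow> nat \<Rightarrow> real" where
  "preav_mean \<phi> f n \<equiv> (\<Sum>i<R n - k n. \<phi> (preav f n i)) / real (k n)"

text \<open>Integration against counting measure with values in \<open>ennreal\<close> gives access
  to monotone convergence before finiteness is known. The time \<open>t\<close> is left out, as no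
  window reaches it.\<close>

definition jump_thr :: "real \<Rightarrow> real \<Rightarrow> (real \<Rightarrow> real) \<Rightarrow> ennreal" where
  "jump_thr p e f = (\<integral>\<^sup>+s. ennreal (integral {0..1} (\<lambda>x. thr p e (g x * jump f s))) \<partial>count_space {0<..<t})"

definition jump_sum :: "real \<Rightarrow> (real \<Rightarrow> real) \<Rightarrow> ennreal" where
  "jump_sum p f = (\<integral>\<^sup>+s. ennreal (\<bar>jump f s\<bar> powr p) \<partial>count_space {0<..<t})"

definition limit_sum :: "real \<Rightarrow> (real \<Rightarrow> real) \<Rightarrow> ennreal" where
  "limit_sum p f = ennreal (gbar g p) * jump_sum p f"

lemma limit_sum_eq: "0 < p \<Longrightarrow> limit_sum p f = (\<integral>\<^sup>+s. ennreal (gbar g p * \<bar>jump f s\<bar> powr p) \<partial>count_space {0<..<t})"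
  unfolding limit_sum_def jump_sum_def
  by (subst nn_integral_cmult[symmetric]) (auto simp: ennreal_mult gbar_nonneg)

lemma jump_thr_tendsto:
  assumes f: "cadlag f" and p: "0 < p" and e: "0 < e"
  shows "jump_thr p e f < \<infinity>"
    "(\<lambda>n. preav_mean (thr p e) f n) \<longlonglongrightarrow> enn2real (jump_thr p e f)"
proof -
  from preav_functional_tendsto[OF f thr_continuous[OF p] e thr_zero[OF p]]
  obtain D where D: "finite D" "D \<subseteq> {0<..<t}" "\<And>s. s \<in> {0<..<t} \<Longrightarrow> s \<notin> D \<Longrightarrow> C * \<bar>jump f s\<bar> \<le> e"
    "(\<lambda>n. preav_mean (thr p e) f n) \<longlonglongrightarrow> (\<Sum>s\<in>D. integral {0..1} (\<lambda>x. thr p e (g x * jump f s)))"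
    by blast
  have "jump_thr p e f = (\<Sum>s\<in>D. ennreal (integral {0..1} (\<lambda>x. thr p e (g x * jump f s))))"
    unfolding jump_thr_def
  proof (rule nn_integral_count_space'[OF D(1) _ D(2)])
    fix s assume s: "s \<in> {0<..<t}" "s \<notin> D"
    have "thr p e (g x * jump f s) = 0" for x
    proof (rule thr_zero[OF p])
      have "\<bar>g x * jump f s\<bar> \<le> C * \<bar>jump f s\<bar>" unfolding abs_mult by (intro mult_right_mono g_bound) simp
      with D(3)[OF s] show "\<bar>g x * jump f s\<bar> \<le> e" by simp
    qed
    then show "ennreal (integral {0..1} (\<lambda>x. thr p e (g x * jump f s))) = 0" by simp
  qed
  also have "\<dots> = ennreal (\<Sum>s\<in>D. integral {0..1} (\<lambda>x. thr p e (g x * jump f s)))"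
    by (intro sum_ennreal integral_thr_nonneg[OF p])
  finally have eq: "jump_thr p e f = ennreal (\<Sum>s\<in>D. integral {0..1} (\<lambda>x. thr p e (g x * jump f s)))" .
  then show "jump_thr p e f < \<infinity>" by simp
  have "enn2real (jump_thr p e f) = (\<Sum>s\<in>D. integral {0..1} (\<lambda>x. thr p e (g x * jump f s)))"
    unfolding eq by (intro enn2real_ennreal sum_nonneg integral_thr_nonneg[OF p])
  with D(4) show "(\<lambda>n. preav_mean (thr p e) f n) \<longlonglongrightarrow> enn2real (jump_thr p e f)" by simp
qed

lemma jump_thr_antimono:
  "0 < p \<Longrightarrow> 0 \<le> e' \<Longrightarrow> e' \<le> e \<Longrightarrow> jump_thr p e f \<le> jump_thr p e' f"
  unfolding jump_thr_def by (intro nn_integral_mono ennreal_leI integral_thr_antimono)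

text \<open>Monotone convergence as the threshold decreases to 0. It expresses a sum over
  uncountably many times as a countable supremum, from which measurability and finiteness
  follow.\<close>

lemma limit_sum_SUP:
  assumes p: "0 < p"
  shows "limit_sum p f = (SUP m. jump_thr p (1 / real (Suc m)) f)"
proof -
  define a where "a m s = ennreal (integral {0..1} (\<lambda>x. thr p (1 / real (Suc m)) (g x * jump f s)))" for m s
  have inc: "incseq a"
    unfolding incseq_def le_fun_def a_def using p
    by (auto intro!: ennreal_leI integral_thr_antimono divide_left_mono simp del: of_nat_Suc)
  have "(SUP m. a m s) = ennreal (gbar g p * \<bar>jump f s\<bar> powr p)" for s
  proof (rule LIMSEQ_unique[OF LIMSEQ_SUP])
    show "incseq (\<lambda>m. a m s)" using inc unfolding incseq_def le_fun_def by blast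
    show "(\<lambda>m. a m s) \<longlonglongrightarrow> ennreal (gbar g p * \<bar>jump f s\<bar> powr p)"
      unfolding a_def by (intro tendsto_ennrealI integral_thr_tendsto p)
  qed
  then have "limit_sum p f = (\<integral>\<^sup>+s. (SUP m. a m s) \<partial>count_space {0<..<t})"
    unfolding limit_sum_eq[OF p] by simp
  also have "\<dots> = (SUP m. \<integral>\<^sup>+s. a m s \<partial>count_space {0<..<t})"
    by (rule nn_integral_monotone_convergence_SUP[OF inc]) simp
  finally show ?thesis unfolding jump_thr_def a_def .
qed

lemma jump_thr_le: "0 < p \<Longrightarrow> jump_thr p e f \<le> limit_sum p f"
  unfolding limit_sum_eq jump_thr_def by (intro nn_integral_mono ennreal_leI integral_thr_le)

lemma limit_sum_le:
  assumes p: "2 \<le> p" and e: "0 < e"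
  shows "limit_sum p f \<le> jump_thr p e f + ennreal (e powr (p - 2)) * limit_sum 2 f"
proof -
  have p0: "0 < p" using p by simp
  have "limit_sum p f \<le> (\<integral>\<^sup>+s. ennreal (integral {0..1} (\<lambda>x. thr p e (g x * jump f s)))
      + ennreal (e powr (p - 2)) * ennreal (gbar g 2 * \<bar>jump f s\<bar> powr 2) \<partial>count_space {0<..<t})"
    unfolding limit_sum_eq[OF p0]
  proof (rule nn_integral_mono)
    fix s
    have "ennreal (gbar g p * \<bar>jump f s\<bar> powr p) \<le> ennreal (integral {0..1} (\<lambda>x. thr p e (g x * jump f s))
        + e powr (p - 2) * (gbar g 2 * \<bar>jump f s\<bar> powr 2))"
      by (rule ennreal_leI[OF integral_thr_remainder[OF p e]])
    also have "\<dots> = ennreal (integral {0..1} (\<lambda>x. thr p e (g x * jump f s)))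
        + ennreal (e powr (p - 2)) * ennreal (gbar g 2 * \<bar>jump f s\<bar> powr 2)"
      using gbar_nonneg[of 2] by (subst ennreal_plus) (auto simp: ennreal_mult integral_thr_nonneg[OF p0] simp del: powr_numeral)
    finally show "ennreal (gbar g p * \<bar>jump f s\<bar> powr p) \<le> ennreal (integral {0..1} (\<lambda>x. thr p e (g x * jump f s)))
        + ennreal (e powr (p - 2)) * ennreal (gbar g 2 * \<bar>jump f s\<bar> powr 2)" .
  qed
  also have "\<dots> = jump_thr p e f + ennreal (e powr (p - 2)) * limit_sum 2 f"
    unfolding jump_thr_def limit_sum_eq[OF zero_less_numeral]
    by (subst nn_integral_add) (simp_all add: nn_integral_cmult del: powr_numeral)
  finally show ?thesis .
qed

abbreviation sample :: "'a \<Rightarrow> real \<Rightarrow> real" where "sample \<omega> \<equiv> (\<lambda>s. X s \<omega>)"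

lemma preav_sum_measurable:
  assumes [measurable]: "\<phi> \<in> borel_measurable borel"
  shows "(\<lambda>\<omega>. preav_mean \<phi> (sample \<omega>) n) \<in> borel_measurable M"
proof -
  note [measurable] = preav_measurable
  show ?thesis by measurable
qed

lemma thr_measurable: "0 < p \<Longrightarrow> thr p e \<in> borel_measurable borel"
  by (intro borel_measurable_continuous_onI thr_continuous)

lemma jump_thr_measurable:
  assumes "0 < p" "0 < e"
  shows "(\<lambda>\<omega>. enn2real (jump_thr p e (sample \<omega>))) \<in> borel_measurable M"
proof (rule borel_measurable_LIMSEQ_real)
  show "(\<lambda>n. preav_mean (thr p e) (sample \<omega>) n) \<longlonglongrightarrow> enn2real (jump_thr p e (sample \<omega>))"
    if "\<omega> \<in> space M" for \<omega>
    by (rule jump_thr_tendsto(2)[OF cadlag_path[OF that] assms])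
  show "(\<lambda>\<omega>. preav_mean (thr p e) (sample \<omega>) n) \<in> borel_measurable M" for n
    by (rule preav_sum_measurable[OF thr_measurable[OF assms(1)]])
qed

text \<open>The thresholded sums are measurable as path-by-path limits of pre-average functionals,
  so no measurable enumeration of jump times is involved.\<close>

lemma limit_sum_measurable:
  assumes p: "0 < p"
  shows "(\<lambda>\<omega>. limit_sum p (sample \<omega>)) \<in> borel_measurable M"
proof -
  have "(\<lambda>\<omega>. SUP m. ennreal (enn2real (jump_thr p (1 / real (Suc m)) (sample \<omega>)))) \<in> borel_measurable M"
    using jump_thr_measurable[OF p] by (intro borel_measurable_SUP) auto
  also have "?this \<longleftrightarrow> ?thesis"
  proof (rule measurable_cong)
    fix \<omega> assume w: "\<omega> \<in> space M"
    show "(SUP m. ennreal (enn2real (jump_thr p (1 / real (Suc m)) (sample \<omega>)))) = limit_sum p (sample \<omega>)"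
      unfolding limit_sum_SUP[OF p]
      using jump_thr_tendsto(1)[OF cadlag_path[OF w] p] by (intro SUP_cong) auto
  qed
  finally show ?thesis .
qed

definition sq :: "nat \<Rightarrow> 'a \<Rightarrow> real" where
  "sq n \<omega> = (\<Sum>i<R n - k n. (preav (sample \<omega>) n i)\<^sup>2) / real (k n)"

lemma sq_tight: "prob_tight M sq"
  using conv_in_prob_tight[OF squares_preav_conv] unfolding sq_def by simp

lemma sq_measurable: "sq n \<in> borel_measurable M"
  using preav_sum_measurable[of "\<lambda>x. x\<^sup>2"] unfolding sq_def by simp

text \<open>Thresholded jump sums are limits of functionals bounded by \<open>sq\<close>, so
  tightness of \<open>sq\<close> bounds them in probability uniformly in the threshold. Being
  monotone in the threshold, they cannot increase to infinity on a set of positive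
  probability.\<close>

lemma limit_sum_2_finite: "AE \<omega> in M. limit_sum 2 (sample \<omega>) < \<infinity>"
proof -
  define Y where "Y m \<omega> = enn2real (jump_thr 2 (1 / real (Suc m)) (sample \<omega>))" for m \<omega>
  have Ym [measurable]: "Y m \<in> borel_measurable M" for m unfolding Y_def by (rule jump_thr_measurable) auto
  have Yeq: "jump_thr 2 (1 / real (Suc m)) (sample \<omega>) = ennreal (Y m \<omega>)" "0 \<le> Y m \<omega>" if "\<omega> \<in> space M" for m \<omega>
    unfolding Y_def using jump_thr_tendsto(1)[OF cadlag_path[OF that], of 2 "1 / real (Suc m)"] by auto
  note [measurable] = limit_sum_measurable[of 2] sq_measurable
  have "prob {\<omega>\<in>space M. limit_sum 2 (sample \<omega>) = \<infinity>} \<le> 0"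
  proof (rule field_le_epsilon)
    fix \<delta> :: real assume d: "0 < \<delta>"
    then have d2: "0 < \<delta> / 2" by simp
    from prob_tightD[OF sq_tight d2] obtain B where B: "0 < B"
      "\<forall>\<^sub>F n in sequentially. prob {\<omega>\<in>space M. \<bar>sq n \<omega>\<bar> > B} \<le> \<delta> / 2" .
    define E where "E m = {\<omega>\<in>space M. Y m \<omega> > B + 1}" for m
    have E [measurable]: "E m \<in> events" for m unfolding E_def by measurable
    have PE: "prob (E m) \<le> \<delta>" for m
    proof -
      have "conv_in_prob M (\<lambda>n \<omega>. preav_mean (thr 2 (1 / real (Suc m))) (sample \<omega>) n) (Y m)"
      proof (rule conv_in_prob_AE[OF _ Ym AE_I2])
        show "(\<lambda>\<omega>. preav_mean (thr 2 (1 / real (Suc m))) (sample \<omega>) n) \<in> borel_measurable M" for n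
          by (rule preav_sum_measurable[OF thr_measurable]) simp
        show "(\<lambda>n. preav_mean (thr 2 (1 / real (Suc m))) (sample \<omega>) n) \<longlonglongrightarrow> Y m \<omega>"
          if "\<omega> \<in> space M" for \<omega>
          unfolding Y_def by (rule jump_thr_tendsto(2)[OF cadlag_path[OF that]]) auto
      qed
      from conv_in_probD[OF this zero_less_one d2] B(2)
      have "\<forall>\<^sub>F n in sequentially. prob (E m) \<le> \<delta>"
      proof eventually_elim
        case (elim n)
        let ?T = "\<lambda>\<omega>. preav_mean (thr 2 (1 / real (Suc m))) (sample \<omega>) n"
        have [measurable]: "?T \<in> borel_measurable M"
          by (rule preav_sum_measurable[OF thr_measurable]) simp
        \<comment> \<open>If \<open>Y m\<close> exceeds \<open>B + 1\<close>, either the thresholded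
          mean is off by more than 1, or it exceeds \<open>B\<close> and so does \<open>sq\<close>,
          which dominates it.\<close>
        have "prob {\<omega>\<in>space M. Y m \<omega> > B + 1} \<le> \<delta> / 2 + \<delta> / 2"
        proof (rule prob_le_add[OF _ _ _ elim])
          fix \<omega> assume "Y m \<omega> > B + 1"
          moreover have "?T \<omega> \<le> sq n \<omega>"
          proof -
            have "thr 2 (1 / real (Suc m)) x \<le> x\<^sup>2" for x using thr_le[of 2 _ x] by simp
            then show ?thesis unfolding sq_def by (intro divide_right_mono sum_mono) auto
          qed
          ultimately show "1 < \<bar>?T \<omega> - Y m \<omega>\<bar> \<or> B < \<bar>sq n \<omega>\<bar>" by arith
        qed (measurable)
        then show ?case unfolding E_def by simp
      qed
      then show ?thesis by simp
    qed
    have "incseq E"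
    proof (rule incseq_SucI, rule subsetI)
      fix m \<omega> assume "\<omega> \<in> E m"
      then have w: "\<omega> \<in> space M" "Y m \<omega> > B + 1" unfolding E_def by auto
      have "ennreal (Y m \<omega>) \<le> ennreal (Y (Suc m) \<omega>)"
        unfolding Yeq(1)[OF w(1), symmetric] by (rule jump_thr_antimono) (auto simp: field_simps)
      then have "Y m \<omega> \<le> Y (Suc m) \<omega>" using Yeq(2)[OF w(1)] by simp
      with w show "\<omega> \<in> E (Suc m)" unfolding E_def by simp
    qed
    then have "(\<lambda>m. prob (E m)) \<longlonglongrightarrow> prob (\<Union>m. E m)"
      by (intro finite_Lim_measure_incseq) auto
    then have U: "prob (\<Union>m. E m) \<le> \<delta>" by (rule LIMSEQ_le_const2) (use PE in auto)
    have "prob {\<omega>\<in>space M. limit_sum 2 (sample \<omega>) = \<infinity>} \<le> prob (\<Union>m. E m)"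
    proof (rule finite_measure_mono)
      show "{\<omega>\<in>space M. limit_sum 2 (sample \<omega>) = \<infinity>} \<subseteq> (\<Union>m. E m)"
      proof safe
        fix \<omega> assume w: "\<omega> \<in> space M" and inf: "limit_sum 2 (sample \<omega>) = \<infinity>"
        have "ennreal (B + 1) < limit_sum 2 (sample \<omega>)" using inf by simp
        then obtain m where "ennreal (B + 1) < jump_thr 2 (1 / real (Suc m)) (sample \<omega>)"
          unfolding limit_sum_SUP[OF zero_less_numeral] less_SUP_iff by blast
        then have "B + 1 < Y m \<omega>" unfolding Yeq(1)[OF w] using B(1) by (subst (asm) ennreal_less_iff) auto
        with w show "\<omega> \<in> (\<Union>m. E m)" unfolding E_def by blast
      qed
    qed auto
    with U show "prob {\<omega>\<in>space M. limit_sum 2 (sample \<omega>) = \<infinity>} \<le> 0 + \<delta>" by simp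
  qed
  then have "prob {\<omega>\<in>space M. limit_sum 2 (sample \<omega>) = \<infinity>} = 0" by (simp add: measure_le_0_iff)
  then have "AE \<omega> in M. \<omega> \<notin> {\<omega>\<in>space M. limit_sum 2 (sample \<omega>) = \<infinity>}"
    by (subst (asm) prob_eq_0) auto
  with AE_space show ?thesis by eventually_elim (simp add: less_top)
qed

text \<open>Three approximations, each worth a third of \<open>\<eta>\<close>: thresholding the
  pre-averages costs \<open>r * sq\<close>, the thresholded mean converges on every path, and
  removing the threshold from the jump sum costs \<open>r\<close> times the quadratic jump
  sum.\<close>

theorem powr_preav_conv:
  assumes p: "2 < p"
  shows "conv_in_prob M (\<lambda>n \<omega>. 1 / real (k n) * (\<Sum>i<R n - k n. \<bar>preav (sample \<omega>) n i\<bar> powr p))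
     (\<lambda>\<omega>. enn2real (limit_sum p (sample \<omega>)))"
proof (rule conv_in_probI)
  have p0: "0 < p" and p2: "2 \<le> p" using p by auto
  define Z where "Z n \<omega> = (\<Sum>i<R n - k n. \<bar>preav (sample \<omega>) n i\<bar> powr p) / real (k n)" for n \<omega>
  define W where "W \<omega> = enn2real (limit_sum p (sample \<omega>))" for \<omega>
  define Q where "Q \<omega> = enn2real (limit_sum 2 (sample \<omega>))" for \<omega>
  have Zm [measurable]: "Z n \<in> borel_measurable M" for n
    unfolding Z_def by (rule preav_sum_measurable) measurable
  then show "(\<lambda>\<omega>. 1 / real (k n) * (\<Sum>i<R n - k n. \<bar>preav (sample \<omega>) n i\<bar> powr p)) \<in> borel_measurable M" for n
    unfolding Z_def by simp
  have Wm [measurable]: "W \<in> borel_measurable M"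
    unfolding W_def using limit_sum_measurable[OF p0] by measurable
  then show "(\<lambda>\<omega>. enn2real (limit_sum p (sample \<omega>))) \<in> borel_measurable M" unfolding W_def .
  have Qm [measurable]: "Q \<in> borel_measurable M"
    unfolding Q_def using limit_sum_measurable[of 2] by measurable
  note [measurable] = sq_measurable
  fix \<eta> \<delta> :: real assume eta: "0 < \<eta>" and d: "0 < \<delta>"
  then have eta3: "0 < \<eta> / 3" and d3: "0 < \<delta> / 3" by auto
  from prob_tightD[OF sq_tight d3] obtain B where B: "0 < B"
    "\<forall>\<^sub>F n in sequentially. prob {\<omega>\<in>space M. \<bar>sq n \<omega>\<bar> > B} \<le> \<delta> / 3" .
  have "prob_tight M (\<lambda>_. Q)" by (rule prob_tight_AE_bounded) auto
  from prob_tightD[OF this d3] obtain B' where B': "0 < B'" "prob {\<omega>\<in>space M. \<bar>Q \<omega>\<bar> > B'} \<le> \<delta> / 3" by auto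
  \<comment> \<open>Then \<open>r * B\<close> and \<open>r * B'\<close> add up to
    \<open>\<eta> / 3\<close>, so each is at most that.\<close>
  define r where "r = \<eta> / (3 * (B + B'))"
  have r: "0 < r" "r * B \<le> \<eta> / 3" "r * B' \<le> \<eta> / 3"
  proof -
    show "0 < r" unfolding r_def using eta B B' by simp
    then have "0 \<le> r * B" "0 \<le> r * B'" using B B' by auto
    moreover have "r * B + r * B' = \<eta> / 3"
    proof -
      have "\<eta> / (3 * S) * S = \<eta> / 3" if "S \<noteq> 0" for S using that by simp
      from this[of "B + B'"] show ?thesis
        unfolding distrib_left[symmetric] r_def using B B' by linarith
    qed
    ultimately show "r * B \<le> \<eta> / 3" "r * B' \<le> \<eta> / 3" by linarith+
  qed
  \<comment> \<open>The solution of \<open>e powr (p - 2) = r\<close>; this is where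
    \<open>p > 2\<close> enters.\<close>
  define e where "e = r powr (1 / (p - 2))"
  have e: "0 < e" "e powr (p - 2) = r" unfolding e_def using r p by (auto simp: powr_powr)
  define T where "T n \<omega> = preav_mean (thr p e) (sample \<omega>) n" for n \<omega>
  define Y where "Y \<omega> = enn2real (jump_thr p e (sample \<omega>))" for \<omega>
  have Tm [measurable]: "T n \<in> borel_measurable M" for n
    unfolding T_def by (rule preav_sum_measurable[OF thr_measurable[OF p0]])
  have Ym [measurable]: "Y \<in> borel_measurable M"
    unfolding Y_def by (rule jump_thr_measurable[OF p0 e(1)])
  have "conv_in_prob M T Y"
  proof (rule conv_in_prob_AE[OF Tm Ym AE_I2])
    fix \<omega> assume "\<omega> \<in> space M"
    from jump_thr_tendsto(2)[OF cadlag_path[OF this] p0 e(1)]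
    show "(\<lambda>n. T n \<omega>) \<longlonglongrightarrow> Y \<omega>" unfolding T_def Y_def .
  qed
  note TY = conv_in_probD[OF this eta3 d3]
  have ZT: "\<bar>Z n \<omega> - T n \<omega>\<bar> \<le> r * sq n \<omega>" for n \<omega>
  proof -
    have "T n \<omega> \<le> Z n \<omega>"
      unfolding T_def Z_def by (intro divide_right_mono sum_mono thr_le) auto
    moreover have "Z n \<omega> \<le> T n \<omega> + r * sq n \<omega>"
    proof -
      have "Z n \<omega> \<le> (\<Sum>i<R n - k n. thr p e (preav (sample \<omega>) n i) + r * (preav (sample \<omega>) n i)\<^sup>2) / real (k n)"
        unfolding Z_def using thr_remainder[OF p2 e(1)] e(2) by (intro divide_right_mono sum_mono) auto
      also have "\<dots> = T n \<omega> + r * sq n \<omega>"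
        unfolding T_def sq_def by (simp add: sum.distrib sum_distrib_left add_divide_distrib)
      finally show ?thesis .
    qed
    ultimately show ?thesis by linarith
  qed
  have YW: "AE \<omega> in M. \<bar>Y \<omega> - W \<omega>\<bar> \<le> r * Q \<omega>"
    using limit_sum_2_finite AE_space
  proof eventually_elim
    case (elim \<omega>)
    have fin: "jump_thr p e (sample \<omega>) < \<infinity>" by (rule jump_thr_tendsto(1)[OF cadlag_path[OF elim(2)] p0 e(1)])
    have Q: "limit_sum 2 (sample \<omega>) = ennreal (Q \<omega>)" "0 \<le> Q \<omega>" using elim(1) unfolding Q_def by auto
    have Y: "jump_thr p e (sample \<omega>) = ennreal (Y \<omega>)" "0 \<le> Y \<omega>" using fin unfolding Y_def by auto
    have le: "limit_sum p (sample \<omega>) \<le> ennreal (Y \<omega> + r * Q \<omega>)"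
      using limit_sum_le[OF p2 e(1), of "sample \<omega>"] Q Y r(1) unfolding e(2) by (simp add: ennreal_mult)
    then have "limit_sum p (sample \<omega>) < \<infinity>" by (rule le_less_trans) simp
    then have W: "limit_sum p (sample \<omega>) = ennreal (W \<omega>)" "0 \<le> W \<omega>" unfolding W_def by auto
    have "Y \<omega> \<le> W \<omega>" using jump_thr_le[OF p0, of e "sample \<omega>"] unfolding W(1) Y(1) using W(2) by simp
    moreover have "W \<omega> \<le> Y \<omega> + r * Q \<omega>" using le Y(2) Q(2) r(1) unfolding W(1) by (subst (asm) ennreal_le_iff) auto
    ultimately show ?case by linarith
  qed
  have YWp: "prob {\<omega>\<in>space M. \<bar>Y \<omega> - W \<omega>\<bar> > \<eta> / 3} \<le> \<delta> / 3"
  proof -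
    have "prob {\<omega>\<in>space M. \<bar>Y \<omega> - W \<omega>\<bar> > \<eta> / 3} \<le> prob {\<omega>\<in>space M. \<bar>Q \<omega>\<bar> > B'}"
    proof (rule finite_measure_mono_AE)
      show "AE \<omega> in M. \<omega> \<in> {\<omega>\<in>space M. \<bar>Y \<omega> - W \<omega>\<bar> > \<eta> / 3} \<longrightarrow> \<omega> \<in> {\<omega>\<in>space M. \<bar>Q \<omega>\<bar> > B'}"
        using YW
      proof eventually_elim
        case (elim \<omega>)
        have "B' < \<bar>Q \<omega>\<bar>" if "\<eta> / 3 < \<bar>Y \<omega> - W \<omega>\<bar>"
        proof -
          have "r * B' < r * Q \<omega>" using that elim r by linarith
          then have "B' < Q \<omega>" using r(1) by simp
          then show ?thesis by linarith
        qed
        then show ?case by blast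
      qed
    qed measurable
    with B' show ?thesis by linarith
  qed
  from TY B(2)
  have "\<forall>\<^sub>F n in sequentially. prob {\<omega>\<in>space M. \<bar>Z n \<omega> - W \<omega>\<bar> > \<eta>} \<le> \<delta>"
  proof eventually_elim
    case (elim n)
    have 1: "prob {\<omega>\<in>space M. \<bar>T n \<omega> - Y \<omega>\<bar> > \<eta> / 3 \<or> \<bar>Y \<omega> - W \<omega>\<bar> > \<eta> / 3} \<le> \<delta> / 3 + \<delta> / 3"
      by (rule prob_le_add[OF _ _ _ elim(1) YWp]) (blast, measurable, measurable)
    have "prob {\<omega>\<in>space M. \<bar>Z n \<omega> - W \<omega>\<bar> > \<eta>} \<le> (\<delta> / 3 + \<delta> / 3) + \<delta> / 3"
    proof (rule prob_le_add[OF _ _ _ 1 elim(2)])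
      fix \<omega> assume gt: "\<bar>Z n \<omega> - W \<omega>\<bar> > \<eta>"
      show "(\<bar>T n \<omega> - Y \<omega>\<bar> > \<eta> / 3 \<or> \<bar>Y \<omega> - W \<omega>\<bar> > \<eta> / 3) \<or> B < \<bar>sq n \<omega>\<bar>"
      proof (rule ccontr)
        assume neg: "\<not> ?thesis"
        then have "r * sq n \<omega> \<le> r * B" using r(1) by (intro mult_left_mono) auto
        with ZT[of n \<omega>] r have "\<bar>Z n \<omega> - T n \<omega>\<bar> \<le> \<eta> / 3" by linarith
        moreover have "\<bar>T n \<omega> - Y \<omega>\<bar> \<le> \<eta> / 3" "\<bar>Y \<omega> - W \<omega>\<bar> \<le> \<eta> / 3" using neg by auto
        ultimately show False using gt by linarith
      qed
    qed (measurable)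
    then show ?case by simp
  qed
  then show "\<forall>\<^sub>F n in sequentially. prob {\<omega>\<in>space M. \<bar>1 / real (k n) * (\<Sum>i<R n - k n. \<bar>preav (sample \<omega>) n i\<bar> powr p) - enn2real (limit_sum p (sample \<omega>))\<bar> > \<eta>} \<le> \<delta>"
    unfolding Z_def W_def by simp
qed

text \<open>The time \<open>t\<close> is split off because pre-averages see only earlier jumps. Time
  0 contributes nothing by the convention for \<open>jump\<close>, which also settles
  \<open>t = 0\<close>.\<close>

lemma jump_infsum:
  "(\<Sum>\<^sub>\<infinity>s\<in>{0..t}. \<bar>jump f s\<bar> powr p) = enn2real (jump_sum p f + ennreal (\<bar>jump f t\<bar> powr p))"
proof -
  let ?h = "\<lambda>s. ennreal (\<bar>jump f s\<bar> powr p)"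
  have h0: "?h 0 = 0" by (simp add: jump_def)
  have "(\<integral>\<^sup>+s. ?h s \<partial>count_space {0..t}) = (\<integral>\<^sup>+s. ?h s * indicator {0<..<t} s + ?h s * indicator {t} s \<partial>count_space UNIV)"
    unfolding nn_integral_count_space_indicator[of "{0..t}", simplified]
  proof (rule nn_integral_cong)
    fix s
    show "?h s * indicator {0..t} s = ?h s * indicator {0<..<t} s + ?h s * indicator {t} s"
      using t h0 by (cases "s = 0") (auto simp: indicator_def)
  qed
  also have "\<dots> = (\<integral>\<^sup>+s. ?h s * indicator {0<..<t} s \<partial>count_space UNIV) + (\<integral>\<^sup>+s. ?h s * indicator {t} s \<partial>count_space UNIV)"
    by (rule nn_integral_add) auto
  also have "(\<integral>\<^sup>+s. ?h s * indicator {0<..<t} s \<partial>count_space UNIV) = jump_sum p f"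
    unfolding jump_sum_def nn_integral_count_space_indicator[of "{0<..<t}", simplified] ..
  also have "(\<integral>\<^sup>+s. ?h s * indicator {t} s \<partial>count_space UNIV) = ?h t"
    unfolding nn_integral_count_space_indicator[of "{t}", simplified, symmetric]
    by (simp add: nn_integral_count_space_finite)
  finally show ?thesis
    by (subst infsum_eq_enn2real_nn_integral) auto
qed

theorem power_variation_conv:
  assumes p: "2 < p"
  shows "conv_in_prob M (\<lambda>n \<omega>. 1 / real (k n) * power_variation g p (k n) (\<Delta> n) (sample \<omega>) t)
    (\<lambda>\<omega>. gbar g p * (\<Sum>\<^sub>\<infinity>s\<in>{0..t}. \<bar>jump (sample \<omega>) s\<bar> powr p))"
proof (rule conv_in_prob_AE_cong[OF powr_preav_conv[OF p]])
  have p0: "0 < p" using p by simp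
  show "(\<lambda>\<omega>. 1 / real (k n) * power_variation g p (k n) (\<Delta> n) (sample \<omega>) t) \<in> borel_measurable M" for n
    unfolding power_variation_preav using preav_sum_measurable[of "\<lambda>x. \<bar>x\<bar> powr p"] by simp
  show "AE \<omega> in M. 1 / real (k n) * (\<Sum>i<R n - k n. \<bar>preav (sample \<omega>) n i\<bar> powr p)
      = 1 / real (k n) * power_variation g p (k n) (\<Delta> n) (sample \<omega>) t" for n
    unfolding power_variation_preav by simp
  \<comment> \<open>The claimed sum also counts the time \<open>t\<close>, where almost surely there
    is no jump.\<close>
  show "AE \<omega> in M. enn2real (limit_sum p (sample \<omega>)) = gbar g p * (\<Sum>\<^sub>\<infinity>s\<in>{0..t}. \<bar>jump (sample \<omega>) s\<bar> powr p)"
    using AE_no_jump[OF ad cad no_fixed]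
    by eventually_elim (use gbar_nonneg[OF p0] in \<open>simp add: jump_infsum limit_sum_def enn2real_mult\<close>)
  show "(\<lambda>\<omega>. gbar g p * (\<Sum>\<^sub>\<infinity>s\<in>{0..t}. \<bar>jump (sample \<omega>) s\<bar> powr p)) \<in> borel_measurable M"
  \<comment> \<open>Measurability of the bare jump sum is inherited from \<open>limit_sum\<close> by
    dividing out the factor; if the factor is 0, the limit is constant.\<close>
  proof (cases "gbar g p = 0")
    case False
    then have gp: "0 < gbar g p" using gbar_nonneg[OF p0] by simp
    have "jump_sum p f = ennreal (1 / gbar g p) * limit_sum p f" for f
      unfolding limit_sum_def mult.assoc[symmetric] using gp by (simp add: ennreal_mult[symmetric])
    note [measurable] = limit_sum_measurable[OF p0] jump_measurable[OF ad cad]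
    show ?thesis
      unfolding jump_infsum \<open>\<And>f. jump_sum p f = ennreal (1 / gbar g p) * limit_sum p f\<close> by measurable
  qed simp
qed

theorem power_variation_conv_2:
  "conv_in_prob M (\<lambda>n \<omega>. 1 / real (k n) * power_variation g 2 (k n) (\<Delta> n) (sample \<omega>) t)
    (\<lambda>\<omega>. gbar g 2 * quadratic_variation M X t \<omega>)"
  using squares_preav_conv unfolding power_variation_preav by simp

end

theorem theorem3p1:
  fixes M :: "'a measure" and F :: "real \<Rightarrow> 'a measure" and X :: "real \<Rightarrow> 'a \<Rightarrow> real"
    and g :: "real \<Rightarrow> real" and \<Delta> :: "nat \<Rightarrow> real" and k :: "nat \<Rightarrow> nat" and p t :: real
  assumes "filtered_prob_space M F"
    and "semimartingale M F X"
    and "weight_function g"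
    and "\<And>n. \<Delta> n > 0" and "\<Delta> \<longlonglongrightarrow> 0"
    and "\<And>n. k n > 0" and "filterlim k at_top sequentially"
    and "(\<lambda>n. real (k n) * \<Delta> n) \<longlonglongrightarrow> 0"
    and "t \<ge> 0" and "\<not> fixed_time_of_discontinuity M X t"
    and "p \<ge> 2"
  shows "conv_in_prob M
    (\<lambda>n \<omega>. 1 / real (k n) * power_variation g p (k n) (\<Delta> n) (\<lambda>s. X s \<omega>) t)
    (\<lambda>\<omega>. if p > 2 then gbar g p * (\<Sum>\<^sub>\<infinity>s\<in>{0..t}. \<bar>jump (\<lambda>r. X r \<omega>) s\<bar> powr p)
         else gbar g 2 * quadratic_variation M X t \<omega>)"
proof -
  obtain C where C: "0 < C" "\<And>x y. \<bar>g x - g y\<bar> \<le> C * \<bar>x - y\<bar>"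
    using weight_function_Lipschitz[OF assms(3)] by blast
  have M: "prob_space M" "filtration (space M) F" "\<And>t. subalgebra M (F t)"
    using assms(1) unfolding filtered_prob_space_def by auto
  interpret prob_space M by (rule M(1))
  interpret preaverage_setup M F g C X \<Delta> k t
    by unfold_locales (fact M assms C filtration.space_F[OF M(2)] filtration.sets_F_mono[OF M(2)])+
  show ?thesis
  proof (cases "p > 2")
    case True
    then show ?thesis using power_variation_conv by simp
  next
    case False
    then have "p = 2" using assms(11) by simp
    then show ?thesis using power_variation_conv_2 by simp
  qed
qed

end
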